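(* Let $\{\xi(m)\}_{m\in\mathbb Z}$ and $\{\eta(m)\}_{m\in\mathbb Z}$ be uncorrelated stationary stochastic sequences whose spectral densities $f(\lambda)$ and $g(\lambda)$ satisfy $$\int_{-\pi}^{\pi}\frac{1}{f(\lambda)+g(\lambda)}\,d\lambda<\infty .$$ Let $\{a(k)\}_{k\ge 0}$ be coefficients with $\sum_{k=0}^\infty |a(k)|<\infty$ and $\sum_{k=0}^\infty (k+1)|a(k)|^2<\infty$, and put $\mathbf a=(a(0),a(1),a(2),\ldots)'$ and $A(e^{i\lambda})=\sum_{k=0}^\infty a(k)e^{-i\lambda k}$. Then the mean-square optimal linear estimate $\widehat A\xi$ of $A\xi=\sum_{k=0}^\infty a(k)\xi(-k)$ based on observations of $\xi(m)+\eta(m)$ at the points $m=0,-1,-2,\ldots$ is $$\widehat A\xi=\int_{-\pi}^{\pi}h(\lambda)\,dZ_{\xi+\eta}(\lambda),$$ with spectral characteristic $$h(\lambda)=A(e^{i\lambda})\frac{f(\lambda)}{f(\lambda)+g(\lambda)}-\frac{\sum_{k=0}^\infty(\mathbf P^{-1}\mathbf R\mathbf a)_k\,e^{i\lambda(k+1)}}{f(\lambda)+g(\lambda)},$$ and its mean-square error $\Delta(f,g;\widehat A\xi)=\mathsf E|A\xi-\widehat A\xi|^2$ is $$\begin{aligned}\Delta(f,g;\widehat A\xi)&=\frac1{2\pi}\int_{-\pi}^{\pi}\frac{\left|A(e^{i\lambda})g(\lambda)+\sum_{k=0}^\infty(\mathbf P^{-1}\mathbf R\mathbf a)_ke^{i\lambda(k+1)}\right|^2}{(f(\lambda)+g(\lambda))^2}f(\lambda)\,d\lambda\\&\quad+\frac1{2\pi}\int_{-\pi}^{\pi}\frac{\left|A(e^{i\lambda})f(\lambda)-\sum_{k=0}^\infty(\mathbf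 P^{-1}\mathbf R\mathbf a)_ke^{i\lambda(k+1)}\right|^2}{(f(\lambda)+g(\lambda))^2}g(\lambda)\,d\lambda\\&=\langle\mathbf R\mathbf a,\mathbf P^{-1}\mathbf R\mathbf a\rangle+\langle\mathbf Q\mathbf a,\mathbf a\rangle .\end{aligned}$$ Moreover, if the spectral density $f(\lambda)+g(\lambda)$ admits the canonical factorization $$\frac1{f(\lambda)+g(\lambda)}=\left|\sum_{k=0}^\infty\psi(k)e^{-i\lambda k}\right|^2=\left|\sum_{k=0}^\infty\theta(k)e^{-i\lambda k}\right|^{-2},$$ then in these formulas $\mathbf P^{-1}=\overline{\Theta}\,\Theta'$.
   Context: All sequences are zero-mean, wide-sense stationary, complex-valued, with finite second moments; $\xi$ and $\eta$ are mutually uncorrelated, with spectral densities $f,g\ge0$ (integrable on $[-\pi,\pi)$), normalized so that $\mathsf E\,\xi(m+k)\overline{\xi(m)}=\frac1{2\pi}\int_{-\pi}^{\pi}e^{ik\lambda}f(\lambda)d\lambda$, and similarly for $\eta,g$. Spectral representations: $\xi(m)=\int_{-\pi}^{\pi}e^{im\lambda}dZ_\xi(\lambda)$, $\eta(m)=\int_{-\pi}^{\pi}e^{im\lambda}dZ_\eta(\lambda)$, with $Z_\xi,Z_\eta$ having uncorrelated increments, and $Z_{\xi+\eta}=Z_\xi+Z_\eta$. Let $H$ be the Hilbert space of zero-mean, finite-variance random variables and $H^0(\xi+\eta)$ the closed linear span in $H$ of $\{\xi(m)+\eta(m):m=0,-1,-2,\ldots\}$. The mean-square optimal linear estimate of an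 element of $H$ is its orthogonal projection onto $H^0(\xi+\eta)$; the spectral characteristic of an estimate is the function $h\in L_2(f+g)$ representing it as $\int h\,dZ_{\xi+\eta}$. Inner product on $\ell_2$: $\langle x,y\rangle=\sum_{k\ge0}x_k\overline{y_k}$. $\mathbf P,\mathbf R,\mathbf Q$ are the linear operators on $\ell_2$ given by the matrices ($l,k,m\ge0$) $$(\mathbf P)_{l,k}=\frac1{2\pi}\int_{-\pi}^{\pi}\frac{e^{i\lambda(k-l)}}{f(\lambda)+g(\lambda)}d\lambda,\quad(\mathbf R)_{l,m}=\frac1{2\pi}\int_{-\pi}^{\pi}e^{-i\lambda(l+1+m)}\frac{f(\lambda)}{f(\lambda)+g(\lambda)}d\lambda,\quad(\mathbf Q)_{l,k}=\frac1{2\pi}\int_{-\pi}^{\pi}e^{i\lambda(l-k)}\frac{f(\lambda)g(\lambda)}{f(\lambda)+g(\lambda)}d\lambda .$$ It is understood that these matrices define linear operators on $\ell_2$ and that $\mathbf P$ is invertible. $(x)_k$ is the $k$th coordinate of $x$ ($k\ge0$). In the canonical factorization, $\psi,\theta$ are square-summable sequences whose power series are reciprocal: $\left(\sum_{k\ge0}\psi(k)e^{-i\lambda k}\right)\left(\sum_{k\ge0}\theta(k)e^{-i\lambda k}\right)=1$. $\Theta$ is the linear operator on $\ell_2$ with matrix $(\Theta)_{k,j}=\theta(k-j)$ for $0\le j\le k$ and $0$ for $0\le k<j$; $\Theta'$ is its transpose and $\overline\Theta$ its entrywise complex conjugate. *)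

theory Defs
  imports "HOL-Probability.Probability"
begin

section \<open>Square-integrable functions and mean-square convergence\<close>

definition L2_fun :: "'a measure \<Rightarrow> ('a \<Rightarrow> complex) set" where
  "L2_fun M = {X \<in> borel_measurable M. integrable M (\<lambda>x. (cmod (X x))\<^sup>2)}"

definition L2_tendsto :: "'a measure \<Rightarrow> (nat \<Rightarrow> 'a \<Rightarrow> complex) \<Rightarrow> ('a \<Rightarrow> complex) \<Rightarrow> bool" where
  "L2_tendsto M Xs X \<longleftrightarrow> (\<forall>n. Xs n \<in> L2_fun M) \<and> X \<in> L2_fun M \<and>
     (\<lambda>n. LINT x|M. (cmod (Xs n x - X x))\<^sup>2) \<longlonglongrightarrow> 0"


section \<open>The Hilbert space of random variables\<close>

text \<open>
  Elements of the Hilbert space are represented by functions rather than by classes modulo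
  almost sure equality; closed spans, projections and mean-square sums (but not the finite linear
  combinations themselves) are invariant under changes on null sets.
\<close>

definition rv_space :: "'w measure \<Rightarrow> ('w \<Rightarrow> complex) set" where
  "rv_space M = {X \<in> L2_fun M. (LINT \<omega>|M. X \<omega>) = 0}"

definition lin_combs :: "('w \<Rightarrow> complex) set \<Rightarrow> ('w \<Rightarrow> complex) set" where
  "lin_combs S = {Y. \<exists>T c. finite T \<and> T \<subseteq> S \<and> Y = (\<lambda>\<omega>. \<Sum>X\<in>T. c X * X \<omega>)}"

definition closed_lin_span :: "'w measure \<Rightarrow> ('w \<Rightarrow> complex) set \<Rightarrow> ('w \<Rightarrow> complex) set" where
  "closed_lin_span M S =
     {Y \<in> rv_space M. \<exists>Ys. (\<forall>n. Ys n \<in> lin_combs S) \<and> L2_tendsto M Ys Y}"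

definition is_orth_projection ::
  "'w measure \<Rightarrow> ('w \<Rightarrow> complex) set \<Rightarrow> ('w \<Rightarrow> complex) \<Rightarrow> ('w \<Rightarrow> complex) \<Rightarrow> bool" where
  "is_orth_projection M S X Y \<longleftrightarrow>
     Y \<in> S \<and> (\<forall>W\<in>S. (LINT \<omega>|M. (X \<omega> - Y \<omega>) * cnj (W \<omega>)) = 0)"

definition ms_sums :: "'w measure \<Rightarrow> (nat \<Rightarrow> 'w \<Rightarrow> complex) \<Rightarrow> ('w \<Rightarrow> complex) \<Rightarrow> bool" where
  "ms_sums M Xs X \<longleftrightarrow> X \<in> rv_space M \<and> L2_tendsto M (\<lambda>n \<omega>. \<Sum>k<n. Xs k \<omega>) X"


section \<open>Stationary sequences and spectral representations\<close>

definition stationary_seq :: "'w measure \<Rightarrow> (int \<Rightarrow> 'w \<Rightarrow> complex) \<Rightarrow> bool" where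
  "stationary_seq M \<xi> \<longleftrightarrow> (\<forall>m. \<xi> m \<in> rv_space M) \<and>
     (\<forall>k m n. (LINT \<omega>|M. \<xi> (m + k) \<omega> * cnj (\<xi> m \<omega>)) = (LINT \<omega>|M. \<xi> (n + k) \<omega> * cnj (\<xi> n \<omega>)))"

definition uncorrelated_seqs ::
  "'w measure \<Rightarrow> (int \<Rightarrow> 'w \<Rightarrow> complex) \<Rightarrow> (int \<Rightarrow> 'w \<Rightarrow> complex) \<Rightarrow> bool" where
  "uncorrelated_seqs M \<xi> \<eta> \<longleftrightarrow> (\<forall>m n. (LINT \<omega>|M. \<xi> m \<omega> * cnj (\<eta> n \<omega>)) = 0)"

definition has_spectral_density ::
  "'w measure \<Rightarrow> (int \<Rightarrow> 'w \<Rightarrow> complex) \<Rightarrow> (real \<Rightarrow> real) \<Rightarrow> bool" where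
  "has_spectral_density M \<xi> f \<longleftrightarrow>
     (\<forall>t\<in>{-pi..<pi}. 0 \<le> f t) \<and> set_integrable lborel {-pi..<pi} f \<and>
     (\<forall>k m. (LINT \<omega>|M. \<xi> (m + k) \<omega> * cnj (\<xi> m \<omega>)) =
        1 / (2 * pi) * (CLBINT t:{-pi..<pi}. cis (of_int k * t) * f t))"

definition leb_band :: "real measure" where
  "leb_band = restrict_space lborel {-pi..<pi}"

definition spectral_measure :: "(real \<Rightarrow> real) \<Rightarrow> real measure" where
  "spectral_measure f = density leb_band (\<lambda>t. ennreal (f t / (2 * pi)))"

definition uncorrelated_increments ::
  "'w measure \<Rightarrow> (real \<Rightarrow> real) \<Rightarrow> (real \<Rightarrow> 'w \<Rightarrow> complex) \<Rightarrow> bool" where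
  "uncorrelated_increments M f Z \<longleftrightarrow>
     (\<forall>a b. -pi \<le> a \<and> a \<le> b \<and> b \<le> pi \<longrightarrow>
        (\<lambda>\<omega>. Z b \<omega> - Z a \<omega>) \<in> rv_space M \<and>
        (LINT \<omega>|M. (cmod (Z b \<omega> - Z a \<omega>))\<^sup>2) = 1 / (2 * pi) * (LBINT t:{a..<b}. f t)) \<and>
     (\<forall>a b c d. -pi \<le> a \<and> a \<le> b \<and> b \<le> c \<and> c \<le> d \<and> d \<le> pi \<longrightarrow>
        (LINT \<omega>|M. (Z b \<omega> - Z a \<omega>) * cnj (Z d \<omega> - Z c \<omega>)) = 0)"

definition band_partition :: "nat \<Rightarrow> (nat \<Rightarrow> real) \<Rightarrow> bool" where
  "band_partition n s \<longleftrightarrow> s 0 = -pi \<and> s n = pi \<and> (\<forall>i<n. s i \<le> s (Suc i))"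

definition step_fun :: "nat \<Rightarrow> (nat \<Rightarrow> real) \<Rightarrow> (nat \<Rightarrow> complex) \<Rightarrow> real \<Rightarrow> complex" where
  "step_fun n s c t = (\<Sum>i<n. c i * indicator {s i..<s (Suc i)} t)"

definition step_integral ::
  "(real \<Rightarrow> 'w \<Rightarrow> complex) \<Rightarrow> nat \<Rightarrow> (nat \<Rightarrow> real) \<Rightarrow> (nat \<Rightarrow> complex) \<Rightarrow> 'w \<Rightarrow> complex" where
  "step_integral Z n s c \<omega> = (\<Sum>i<n. c i * (Z (s (Suc i)) \<omega> - Z (s i) \<omega>))"

text \<open>
  \<open>has_stoch_integral M f Z h Y\<close>: the function \<open>h\<close> belongs to \<open>L\<^sub>2(f)\<close> and \<open>Y\<close> is (a version of)
  the integral of \<open>h\<close> over \<open>[-\<pi>, \<pi>)\<close> with respect to \<open>dZ\<close>, where \<open>f\<close> is the density of the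
  structure function of \<open>Z\<close>.
\<close>

definition has_stoch_integral ::
  "'w measure \<Rightarrow> (real \<Rightarrow> real) \<Rightarrow> (real \<Rightarrow> 'w \<Rightarrow> complex) \<Rightarrow> (real \<Rightarrow> complex) \<Rightarrow> ('w \<Rightarrow> complex) \<Rightarrow> bool"
  where
  "has_stoch_integral M f Z h Y \<longleftrightarrow> Y \<in> rv_space M \<and>
     (\<exists>n s c. (\<forall>j. band_partition (n j) (s j)) \<and>
        L2_tendsto (spectral_measure f) (\<lambda>j. step_fun (n j) (s j) (c j)) h \<and>
        L2_tendsto M (\<lambda>j. step_integral Z (n j) (s j) (c j)) Y)"

definition spectral_representation ::
  "'w measure \<Rightarrow> (real \<Rightarrow> real) \<Rightarrow> (real \<Rightarrow> 'w \<Rightarrow> complex) \<Rightarrow> (int \<Rightarrow> 'w \<Rightarrow> complex) \<Rightarrow> bool" where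
  "spectral_representation M f Z \<xi> \<longleftrightarrow> uncorrelated_increments M f Z \<and>
     (\<forall>m. has_stoch_integral M f Z (\<lambda>t. cis (of_int m * t)) (\<xi> m))"


section \<open>Matrix operators on square-summable sequences\<close>

definition l2 :: "(nat \<Rightarrow> complex) set" where
  "l2 = {x. summable (\<lambda>k. (cmod (x k))\<^sup>2)}"

definition l2_inner :: "(nat \<Rightarrow> complex) \<Rightarrow> (nat \<Rightarrow> complex) \<Rightarrow> complex" where
  "l2_inner x y = (\<Sum>k. x k * cnj (y k))"

type_synonym inf_matrix = "nat \<Rightarrow> nat \<Rightarrow> complex"

definition mat_app :: "inf_matrix \<Rightarrow> (nat \<Rightarrow> complex) \<Rightarrow> nat \<Rightarrow> complex" where
  "mat_app K x l = (\<Sum>k. K l k * x k)"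

text \<open>
  Boundedness is not required separately: a matrix acting on all of \<open>\<ell>\<^sub>2\<close> is automatically bounded.
\<close>

definition l2_operator :: "inf_matrix \<Rightarrow> bool" where
  "l2_operator K \<longleftrightarrow> (\<forall>x\<in>l2. (\<forall>l. summable (\<lambda>k. K l k * x k)) \<and> mat_app K x \<in> l2)"

definition l2_invertible :: "inf_matrix \<Rightarrow> bool" where
  "l2_invertible K \<longleftrightarrow> l2_operator K \<and> bij_betw (mat_app K) l2 l2"

definition l2_inverse :: "inf_matrix \<Rightarrow> (nat \<Rightarrow> complex) \<Rightarrow> nat \<Rightarrow> complex" where
  "l2_inverse K = inv_into l2 (mat_app K)"

definition P_mat :: "(real \<Rightarrow> real) \<Rightarrow> (real \<Rightarrow> real) \<Rightarrow> inf_matrix" where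
  "P_mat f g l k = 1 / (2 * pi) *
     (CLBINT t:{-pi..<pi}. cis (t * (real k - real l)) / (f t + g t))"

definition R_mat :: "(real \<Rightarrow> real) \<Rightarrow> (real \<Rightarrow> real) \<Rightarrow> inf_matrix" where
  "R_mat f g l m = 1 / (2 * pi) *
     (CLBINT t:{-pi..<pi}. cis (- t * (real l + 1 + real m)) * (f t / (f t + g t)))"

definition Q_mat :: "(real \<Rightarrow> real) \<Rightarrow> (real \<Rightarrow> real) \<Rightarrow> inf_matrix" where
  "Q_mat f g l k = 1 / (2 * pi) *
     (CLBINT t:{-pi..<pi}. cis (t * (real l - real k)) * (f t * g t / (f t + g t)))"

definition Theta_mat :: "(nat \<Rightarrow> complex) \<Rightarrow> inf_matrix" where
  "Theta_mat \<theta> k j = (if j \<le> k then \<theta> (k - j) else 0)"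

definition mat_transpose :: "inf_matrix \<Rightarrow> inf_matrix" where
  "mat_transpose K k j = K j k"

definition mat_cnj :: "inf_matrix \<Rightarrow> inf_matrix" where
  "mat_cnj K k j = cnj (K k j)"


section \<open>Trigonometric series and the spectral characteristic\<close>

text \<open>
  Series with merely square-summable coefficients are summed in \<open>L\<^sub>2[-\<pi>, \<pi>)\<close>, not pointwise, so
  the sum \<open>C\<close> is determined almost everywhere: \<open>C(t) = \<Sum>\<^sub>k c(k) exp(i e(k) t)\<close>.
\<close>

definition trig_L2_sums :: "(nat \<Rightarrow> int) \<Rightarrow> (nat \<Rightarrow> complex) \<Rightarrow> (real \<Rightarrow> complex) \<Rightarrow> bool" where
  "trig_L2_sums e c C \<longleftrightarrow>
     L2_tendsto leb_band (\<lambda>n t. \<Sum>k<n. c k * cis (of_int (e k) * t)) C"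

definition A_fun :: "(nat \<Rightarrow> complex) \<Rightarrow> real \<Rightarrow> complex" where
  "A_fun a t = (\<Sum>k. a k * cis (- (real k * t)))"

definition spectral_char ::
  "(real \<Rightarrow> real) \<Rightarrow> (real \<Rightarrow> real) \<Rightarrow> (nat \<Rightarrow> complex) \<Rightarrow> (real \<Rightarrow> complex) \<Rightarrow> real \<Rightarrow> complex" where
  "spectral_char f g a C t = A_fun a t * (f t / (f t + g t)) - C t / (f t + g t)"

definition canonical_factorization ::
  "(real \<Rightarrow> real) \<Rightarrow> (nat \<Rightarrow> complex) \<Rightarrow> (nat \<Rightarrow> complex) \<Rightarrow> bool" where
  "canonical_factorization w \<psi> \<theta> \<longleftrightarrow> \<psi> \<in> l2 \<and> \<theta> \<in> l2 \<and>
     (\<exists>\<Psi> \<Theta>. trig_L2_sums (\<lambda>k. - int k) \<psi> \<Psi> \<and> trig_L2_sums (\<lambda>k. - int k) \<theta> \<Theta> \<and>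
        (AE t in leb_band. \<Psi> t * \<Theta> t = 1 \<and>
           1 / w t = (cmod (\<Psi> t))\<^sup>2 \<and> 1 / w t = cmod (\<Theta> t) powi (-2)))"

end

theory Submission
  imports Defs
begin

text \<open>
  Projecting onto the past of \<open>\<xi> + \<eta>\<close> is a problem about functions on the band: through the isometries
  \<open>\<xi> m \<mapsto> exp(i m t)\<close> and \<open>\<eta> m \<mapsto> exp(i m t)\<close> into \<open>L\<^sub>2(f)\<close> and \<open>L\<^sub>2(g)\<close>, one seeks a limit \<open>h\<close> of trigonometric
  polynomials with frequencies \<open>m \<le> 0\<close> in \<open>L\<^sub>2(f + g)\<close> such that \<open>A f - h (f + g)\<close> is orthogonal to all
  \<open>exp(i m t)\<close> with \<open>m \<le> 0\<close>. The latter says that \<open>A f - h (f + g) = C\<close> is a series with positive frequencies, so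
  that \<open>h = A f / (f + g) - C / (f + g)\<close>; and \<open>h\<close> has no positive frequencies exactly when the coefficients of \<open>C\<close> solve
  \<open>P c = R a\<close>.

  Two points are not formal: that \<open>C / (f + g)\<close> belongs to the right space, and that a function
  without positive frequencies is a limit of polynomials without positive frequencies in the weighted space. Both come
  from the invertibility of \<open>P\<close>, the Toeplitz matrix of \<open>1 / (f + g)\<close>. A symmetric matrix acting on all of
  \<open>\<ell>\<^sub>2\<close> is bounded (\<open>Hellinger_Toeplitz\<close>), and so is its inverse. The quadratic form of \<open>P\<close> is
  \<open>X \<mapsto> \<integral> \<bar>X\<bar>\<^sup>2 / (f + g)\<close>, and trigonometric polynomials are dense in \<open>L\<^sub>2\<close> of every finite measure on the band;
  hence bounds on the form are bounds on the weight (\<open>trig_polys_weight_nonneg\<close>), and \<open>f + g\<close> lies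
  between two positive constants almost everywhere (\<open>toeplitz_operator_symbol_bounded\<close>,
  \<open>toeplitz_invertible_symbol_bounded_below\<close>). The weighted space then has the topology of the unweighted one, where the
  Fourier series of \<open>h\<close> does what is required.

  The error is the sum of the squared norms of \<open>A - h\<close> in \<open>L\<^sub>2(f)\<close> and of \<open>h\<close> in \<open>L\<^sub>2(g)\<close>, because \<open>\<xi>\<close> and
  \<open>\<eta>\<close> are uncorrelated. A pointwise identity (\<open>filtering_error_identity\<close>) rewrites it as
  \<open>\<integral> \<bar>A\<bar>\<^sup>2 f g / (f + g) + \<integral> \<bar>C\<bar>\<^sup>2 / (f + g)\<close>, up to the factor \<open>1 / (2 \<pi>)\<close>, and Parseval's identity gives
  \<open><Q a, a>\<close> and \<open><R a, c>\<close>. The inverse of \<open>P\<close> in terms of the canonical factorization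
  (\<open>toeplitz_inverse_factorization\<close>) results from following the frequencies through multiplications by \<open>\<Theta>\<close>, by its
  conjugate and by \<open>1 / (f + g)\<close>.

  Stochastic integrals are defined by step functions. Step functions and trigonometric polynomials are matched with
  random variables by isometries, which are obtained from Gram matrices alone (\<open>lin_pairs_inner\<close>), and sampling a
  trigonometric polynomial on finer and finer partitions leads from one to the other. This identifies the
  projection with the integral of \<open>h\<close> (\<open>stoch_integral_of_limit\<close>), and integrals are unique up to null sets
  (\<open>stoch_integral_unique\<close>).
\<close>

section \<open>The geometry of mean-square convergence\<close>

definition L2_inner :: "'a measure \<Rightarrow> ('a \<Rightarrow> complex) \<Rightarrow> ('a \<Rightarrow> complex) \<Rightarrow> complex" where
  "L2_inner M X Y = (LINT x|M. X x * cnj (Y x))"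

definition L2_norm :: "'a measure \<Rightarrow> ('a \<Rightarrow> complex) \<Rightarrow> real" where
  "L2_norm M X = sqrt (LINT x|M. (cmod (X x))\<^sup>2)"

lemma L2_fun_measurable: "X \<in> L2_fun M \<Longrightarrow> X \<in> borel_measurable M"
  by (simp add: L2_fun_def)

lemma L2_fun_integrable: "X \<in> L2_fun M \<Longrightarrow> integrable M (\<lambda>x. (cmod (X x))\<^sup>2)"
  by (simp add: L2_fun_def)

lemma L2_fun_bound:
  assumes "Y \<in> borel_measurable M" "integrable M u" "AE x in M. (cmod (Y x))\<^sup>2 \<le> u x"
  shows "Y \<in> L2_fun M"
proof -
  note assms(1)[measurable]
  have "integrable M (\<lambda>x. (cmod (Y x))\<^sup>2)"
    by (rule Bochner_Integration.integrable_bound[OF assms(2)]) (use assms(3) in auto)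
  then show ?thesis using assms(1) by (simp add: L2_fun_def)
qed

lemma cmod_add_sq_le: "(cmod (a + b))\<^sup>2 \<le> 2 * (cmod a)\<^sup>2 + 2 * (cmod b)\<^sup>2"
proof -
  have "(cmod (a + b))\<^sup>2 \<le> (cmod a + cmod b)\<^sup>2"
    by (intro power_mono norm_triangle_ineq) auto
  also have "\<dots> \<le> 2 * (cmod a)\<^sup>2 + 2 * (cmod b)\<^sup>2"
    using zero_le_power2[of "cmod a - cmod b"] by (simp add: power2_eq_square algebra_simps)
  finally show ?thesis .
qed

lemma L2_fun_zero [simp]: "(\<lambda>x. 0) \<in> L2_fun M"
  by (simp add: L2_fun_def)

lemma L2_fun_add [intro]:
  assumes "X \<in> L2_fun M" "Y \<in> L2_fun M"
  shows "(\<lambda>x. X x + Y x) \<in> L2_fun M"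
  by (rule L2_fun_bound[where u = "\<lambda>x. 2 * (cmod (X x))\<^sup>2 + 2 * (cmod (Y x))\<^sup>2"])
    (use assms in \<open>auto simp: L2_fun_def cmod_add_sq_le\<close>)

lemma L2_fun_cmult [intro]:
  assumes "X \<in> L2_fun M"
  shows "(\<lambda>x. c * X x) \<in> L2_fun M"
  using assms by (auto simp: L2_fun_def norm_mult power_mult_distrib)

lemma L2_fun_diff [intro]:
  assumes "X \<in> L2_fun M" "Y \<in> L2_fun M"
  shows "(\<lambda>x. X x - Y x) \<in> L2_fun M"
  using L2_fun_add[OF assms(1) L2_fun_cmult[OF assms(2), of "-1"]] by simp

lemma L2_fun_sum [intro]:
  assumes "\<And>i. i \<in> I \<Longrightarrow> X i \<in> L2_fun M"
  shows "(\<lambda>x. \<Sum>i\<in>I. X i x) \<in> L2_fun M"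
  using assms by (induction I rule: infinite_finite_induct) auto

lemma borel_measurable_cnj [measurable]: "cnj \<in> borel_measurable borel"
  by (intro borel_measurable_continuous_onI continuous_intros)

lemma L2_fun_cnj [intro]: "X \<in> L2_fun M \<Longrightarrow> (\<lambda>x. cnj (X x)) \<in> L2_fun M"
  by (auto simp: L2_fun_def intro: measurable_compose[OF _ borel_measurable_cnj])

lemma L2_fun_bounded_mult:
  assumes "X \<in> L2_fun M" "u \<in> borel_measurable M" "AE x in M. cmod (u x) \<le> K"
  shows "(\<lambda>x. u x * X x) \<in> L2_fun M"
proof (rule L2_fun_bound[where u = "\<lambda>x. K\<^sup>2 * (cmod (X x))\<^sup>2"])
  show "AE x in M. (cmod (u x * X x))\<^sup>2 \<le> K\<^sup>2 * (cmod (X x))\<^sup>2"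
    using assms(3) by (auto simp: norm_mult power_mult_distrib intro!: mult_right_mono power_mono)
qed (use assms in \<open>auto simp: L2_fun_def\<close>)

lemma integrable_mult_cnj:
  assumes "X \<in> L2_fun M" "Y \<in> L2_fun M"
  shows "integrable M (\<lambda>x. X x * cnj (Y x))"
proof (rule Bochner_Integration.integrable_bound[where f = "\<lambda>x. (cmod (X x))\<^sup>2 + (cmod (Y x))\<^sup>2"])
  show "AE x in M. norm (X x * cnj (Y x)) \<le> norm ((cmod (X x))\<^sup>2 + (cmod (Y x))\<^sup>2)"
  proof (rule AE_I2)
    fix x
    have "2 * (cmod (X x) * cmod (Y x)) \<le> (cmod (X x))\<^sup>2 + (cmod (Y x))\<^sup>2"
      using zero_le_power2[of "cmod (X x) - cmod (Y x)"] by (simp add: power2_eq_square algebra_simps)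
    moreover have "0 \<le> cmod (X x) * cmod (Y x)" by simp
    ultimately have "cmod (X x) * cmod (Y x) \<le> (cmod (X x))\<^sup>2 + (cmod (Y x))\<^sup>2"
      by linarith
    then show "norm (X x * cnj (Y x)) \<le> norm ((cmod (X x))\<^sup>2 + (cmod (Y x))\<^sup>2)"
      by (simp add: norm_mult)
  qed
qed (use assms in \<open>auto simp: L2_fun_def\<close>)

lemma integrable_mult_L2:
  assumes "X \<in> L2_fun M" "Y \<in> L2_fun M"
  shows "integrable M (\<lambda>x. X x * Y x)"
  using integrable_mult_cnj[OF assms(1) L2_fun_cnj[OF assms(2)]] by simp

lemma L2_inner_commute: "L2_inner M Y X = cnj (L2_inner M X Y)"
  unfolding L2_inner_def by (subst Bochner_Integration.integral_cnj[symmetric]) (simp add: mult.commute)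

lemma L2_inner_add_left:
  assumes "X \<in> L2_fun M" "Y \<in> L2_fun M" "W \<in> L2_fun M"
  shows "L2_inner M (\<lambda>x. X x + Y x) W = L2_inner M X W + L2_inner M Y W"
  unfolding L2_inner_def using assms by (simp add: distrib_right integrable_mult_cnj)

lemma L2_inner_diff_left:
  assumes "X \<in> L2_fun M" "Y \<in> L2_fun M" "W \<in> L2_fun M"
  shows "L2_inner M (\<lambda>x. X x - Y x) W = L2_inner M X W - L2_inner M Y W"
  unfolding L2_inner_def using assms by (simp add: left_diff_distrib integrable_mult_cnj)

lemma L2_inner_cmult_left: "L2_inner M (\<lambda>x. c * X x) W = c * L2_inner M X W"
  unfolding L2_inner_def by (simp add: mult.assoc)

lemma L2_inner_sum_left:
  assumes "\<And>i. i \<in> I \<Longrightarrow> X i \<in> L2_fun M" "W \<in> L2_fun M"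
  shows "L2_inner M (\<lambda>x. \<Sum>i\<in>I. X i x) W = (\<Sum>i\<in>I. L2_inner M (X i) W)"
  unfolding L2_inner_def sum_distrib_right
  by (rule Bochner_Integration.integral_sum) (use assms in \<open>auto intro: integrable_mult_cnj\<close>)

lemma L2_inner_add_right:
  assumes "X \<in> L2_fun M" "Y \<in> L2_fun M" "W \<in> L2_fun M"
  shows "L2_inner M W (\<lambda>x. X x + Y x) = L2_inner M W X + L2_inner M W Y"
  using L2_inner_add_left[OF assms] L2_inner_commute[of M W] by simp

lemma L2_inner_diff_right:
  assumes "X \<in> L2_fun M" "Y \<in> L2_fun M" "W \<in> L2_fun M"
  shows "L2_inner M W (\<lambda>x. X x - Y x) = L2_inner M W X - L2_inner M W Y"
  using L2_inner_diff_left[OF assms] L2_inner_commute[of M W] by simp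

lemma L2_inner_cmult_right: "L2_inner M W (\<lambda>x. c * X x) = cnj c * L2_inner M W X"
  using L2_inner_cmult_left[of M c X W] L2_inner_commute[of M W] by simp

lemma L2_inner_sum_right:
  assumes "\<And>i. i \<in> I \<Longrightarrow> X i \<in> L2_fun M" "W \<in> L2_fun M"
  shows "L2_inner M W (\<lambda>x. \<Sum>i\<in>I. X i x) = (\<Sum>i\<in>I. L2_inner M W (X i))"
  using arg_cong[OF L2_inner_sum_left[of I X M W], of cnj] assms
  by (subst L2_inner_commute, simp, subst (2) L2_inner_commute, simp)

lemma L2_norm_nonneg [simp]: "0 \<le> L2_norm M X"
  by (simp add: L2_norm_def)

lemma L2_norm_sq: "(L2_norm M X)\<^sup>2 = (LINT x|M. (cmod (X x))\<^sup>2)"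
  by (simp add: L2_norm_def)

lemma L2_norm_zero [simp]: "L2_norm M (\<lambda>x. 0) = 0"
  by (simp add: L2_norm_def)

lemma L2_inner_self: "L2_inner M X X = complex_of_real ((L2_norm M X)\<^sup>2)"
  unfolding L2_inner_def L2_norm_sq complex_norm_square[symmetric] by (rule integral_complex_of_real)

lemma L2_norm_cmult: "L2_norm M (\<lambda>x. c * X x) = cmod c * L2_norm M X"
  by (simp add: L2_norm_def norm_mult power_mult_distrib real_sqrt_mult)

lemma L2_norm_minus_commute: "L2_norm M (\<lambda>x. X x - Y x) = L2_norm M (\<lambda>x. Y x - X x)"
  by (simp add: L2_norm_def norm_minus_commute)

lemma L2_norm_cong_AE:
  assumes "X \<in> borel_measurable M" "Y \<in> borel_measurable M" "AE x in M. X x = Y x"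
  shows "L2_norm M X = L2_norm M Y"
proof -
  have "(LINT x|M. (cmod (X x))\<^sup>2) = (LINT x|M. (cmod (Y x))\<^sup>2)"
    using assms by (intro integral_cong_AE) auto
  then show ?thesis by (simp add: L2_norm_def)
qed

lemma nn_integral_L2_norm:
  assumes "X \<in> L2_fun M"
  shows "(\<integral>\<^sup>+x. ennreal ((cmod (X x))\<^sup>2) \<partial>M) = ennreal ((L2_norm M X)\<^sup>2)"
  unfolding L2_norm_sq using assms by (intro nn_integral_eq_integral) (auto simp: L2_fun_def)

lemma integral_norm_mult_le:
  assumes X: "X \<in> L2_fun M" and Y: "Y \<in> L2_fun M"
  shows "(LINT x|M. cmod (X x) * cmod (Y x)) \<le> L2_norm M X * L2_norm M Y"
proof -
  note [measurable] = L2_fun_measurable[OF X] L2_fun_measurable[OF Y]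
  have int: "integrable M (\<lambda>x. cmod (X x) * cmod (Y x))"
    using integrable_norm[OF integrable_mult_cnj[OF X Y]] by (simp add: norm_mult)
  have "(ennreal (LINT x|M. cmod (X x) * cmod (Y x)))\<^sup>2
        = (\<integral>\<^sup>+x. ennreal (cmod (X x)) * ennreal (cmod (Y x)) \<partial>M)\<^sup>2"
    by (subst nn_integral_eq_integral[OF int, symmetric]) (auto simp: ennreal_mult)
  also have "\<dots> \<le> (\<integral>\<^sup>+x. (ennreal (cmod (X x)))\<^sup>2 \<partial>M) * (\<integral>\<^sup>+x. (ennreal (cmod (Y x)))\<^sup>2 \<partial>M)"
    by (rule Cauchy_Schwarz_nn_integral) auto
  also have "\<dots> = ennreal ((L2_norm M X * L2_norm M Y)\<^sup>2)"
    using nn_integral_L2_norm[OF X] nn_integral_L2_norm[OF Y]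
    by (simp add: ennreal_power ennreal_mult[symmetric] power_mult_distrib)
  finally have "(LINT x|M. cmod (X x) * cmod (Y x))\<^sup>2 \<le> (L2_norm M X * L2_norm M Y)\<^sup>2"
    by (subst (asm) ennreal_power) (auto intro: Bochner_Integration.integral_nonneg)
  then show ?thesis
    by (rule power2_le_imp_le) simp
qed

lemma L2_Cauchy_Schwarz:
  assumes X: "X \<in> L2_fun M" and Y: "Y \<in> L2_fun M"
  shows "cmod (L2_inner M X Y) \<le> L2_norm M X * L2_norm M Y"
proof -
  have "cmod (L2_inner M X Y) \<le> (LINT x|M. cmod (X x * cnj (Y x)))"
    unfolding L2_inner_def by (rule integral_norm_bound)
  also have "\<dots> \<le> L2_norm M X * L2_norm M Y"
    using integral_norm_mult_le[OF X Y] by (simp add: norm_mult)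
  finally show ?thesis .
qed

lemma L2_norm_sq_add:
  assumes X: "X \<in> L2_fun M" and Y: "Y \<in> L2_fun M"
  shows "(L2_norm M (\<lambda>x. X x + Y x))\<^sup>2
    = (L2_norm M X)\<^sup>2 + 2 * Re (L2_inner M X Y) + (L2_norm M Y)\<^sup>2"
proof -
  have "complex_of_real ((L2_norm M (\<lambda>x. X x + Y x))\<^sup>2)
      = L2_inner M X X + L2_inner M X Y + L2_inner M Y X + L2_inner M Y Y"
    unfolding L2_inner_self[symmetric] using X Y
    by (simp add: L2_inner_add_left L2_inner_add_right L2_fun_add)
  then have "Re (complex_of_real ((L2_norm M (\<lambda>x. X x + Y x))\<^sup>2))
      = Re (L2_inner M X X + L2_inner M X Y + L2_inner M Y X + L2_inner M Y Y)"
    by (rule arg_cong)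
  then show ?thesis
    using L2_inner_commute[of M Y X] by (simp add: L2_inner_self del: of_real_power)
qed

lemma L2_norm_triangle:
  assumes X: "X \<in> L2_fun M" and Y: "Y \<in> L2_fun M"
  shows "L2_norm M (\<lambda>x. X x + Y x) \<le> L2_norm M X + L2_norm M Y"
proof (rule power2_le_imp_le)
  have "Re (L2_inner M X Y) \<le> L2_norm M X * L2_norm M Y"
    using L2_Cauchy_Schwarz[OF X Y] complex_Re_le_cmod order_trans by blast
  then show "(L2_norm M (\<lambda>x. X x + Y x))\<^sup>2 \<le> (L2_norm M X + L2_norm M Y)\<^sup>2"
    unfolding L2_norm_sq_add[OF X Y] by (simp add: power2_eq_square algebra_simps)
qed simp

lemma L2_norm_triangle_diff:
  assumes "X \<in> L2_fun M" and "Y \<in> L2_fun M" and "W \<in> L2_fun M"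
  shows "L2_norm M (\<lambda>x. X x - W x) \<le> L2_norm M (\<lambda>x. X x - Y x) + L2_norm M (\<lambda>x. Y x - W x)"
  using L2_norm_triangle[of "\<lambda>x. X x - Y x" M "\<lambda>x. Y x - W x"] assms by (simp add: L2_fun_diff)

lemma L2_norm_le_diff_add:
  assumes "X \<in> L2_fun M" and "Y \<in> L2_fun M"
  shows "L2_norm M X \<le> L2_norm M (\<lambda>x. X x - Y x) + L2_norm M Y"
  using L2_norm_triangle[of "\<lambda>x. X x - Y x" M Y] assms by (simp add: L2_fun_diff)

lemma L2_norm_sum_le:
  assumes "\<And>i. i \<in> I \<Longrightarrow> X i \<in> L2_fun M"
  shows "L2_norm M (\<lambda>x. \<Sum>i\<in>I. X i x) \<le> (\<Sum>i\<in>I. L2_norm M (X i))"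
  using assms
proof (induction I rule: infinite_finite_induct)
  case (insert i I)
  then have "L2_norm M (\<lambda>x. X i x + (\<Sum>i\<in>I. X i x)) \<le> L2_norm M (X i) + L2_norm M (\<lambda>x. \<Sum>i\<in>I. X i x)"
    by (intro L2_norm_triangle) auto
  also have "\<dots> \<le> L2_norm M (X i) + (\<Sum>i\<in>I. L2_norm M (X i))"
    using insert by (intro add_left_mono insert.IH) auto
  finally show ?case using insert by simp
qed auto

lemma L2_norm_eq_0_imp_AE:
  assumes "X \<in> L2_fun M" "L2_norm M X = 0"
  shows "AE x in M. X x = 0"
proof -
  have "(LINT x|M. (cmod (X x))\<^sup>2) = 0"
    using assms(2) by (simp add: L2_norm_def)
  then have "AE x in M. (cmod (X x))\<^sup>2 = 0"
    using integral_nonneg_eq_0_iff_AE[of M "\<lambda>x. (cmod (X x))\<^sup>2"] assms(1) by (simp add: L2_fun_def)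
  then show ?thesis by simp
qed

lemma L2_tendsto_iff:
  "L2_tendsto M Xs X \<longleftrightarrow> (\<forall>n. Xs n \<in> L2_fun M) \<and> X \<in> L2_fun M \<and>
     (\<lambda>n. L2_norm M (\<lambda>x. Xs n x - X x)) \<longlonglongrightarrow> 0"
proof -
  have "((\<lambda>n. (L2_norm M (\<lambda>x. Xs n x - X x))\<^sup>2) \<longlonglongrightarrow> 0)
     \<longleftrightarrow> (\<lambda>n. L2_norm M (\<lambda>x. Xs n x - X x)) \<longlonglongrightarrow> 0"
    (is "?sq \<longlonglongrightarrow> 0 \<longleftrightarrow> ?nm \<longlonglongrightarrow> 0")
  proof
    assume "?sq \<longlonglongrightarrow> 0"
    from tendsto_real_sqrt[OF this] show "?nm \<longlonglongrightarrow> 0" by simp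
  next
    assume "?nm \<longlonglongrightarrow> 0"
    from tendsto_power[OF this, of 2] show "?sq \<longlonglongrightarrow> 0" by simp
  qed
  then show ?thesis unfolding L2_tendsto_def L2_norm_sq by simp
qed

lemma L2_tendsto_norm: "L2_tendsto M Xs X \<Longrightarrow> (\<lambda>n. L2_norm M (\<lambda>x. Xs n x - X x)) \<longlonglongrightarrow> 0"
  and L2_tendsto_fun: "L2_tendsto M Xs X \<Longrightarrow> Xs n \<in> L2_fun M"
  and L2_tendsto_lim_fun: "L2_tendsto M Xs X \<Longrightarrow> X \<in> L2_fun M"
  by (auto simp: L2_tendsto_iff)

lemma L2_tendstoI_bound:
  assumes "\<And>n. Xs n \<in> L2_fun M" "X \<in> L2_fun M"
    and "\<And>n. L2_norm M (\<lambda>x. Xs n x - X x) \<le> r n" "r \<longlonglongrightarrow> 0"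
  shows "L2_tendsto M Xs X"
  unfolding L2_tendsto_iff
  using assms by (auto intro!: tendsto_sandwich[OF _ _ tendsto_const assms(4)])

lemma L2_tendsto_const: "X \<in> L2_fun M \<Longrightarrow> L2_tendsto M (\<lambda>n. X) X"
  by (simp add: L2_tendsto_iff)

lemma L2_tendsto_add:
  assumes "L2_tendsto M Xs X" "L2_tendsto M Ys Y"
  shows "L2_tendsto M (\<lambda>n x. Xs n x + Ys n x) (\<lambda>x. X x + Y x)"
proof (rule L2_tendstoI_bound)
  note f = assms[THEN L2_tendsto_fun] assms[THEN L2_tendsto_lim_fun]
  show "L2_norm M (\<lambda>x. Xs n x + Ys n x - (X x + Y x))
     \<le> L2_norm M (\<lambda>x. Xs n x - X x) + L2_norm M (\<lambda>x. Ys n x - Y x)" for n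
    using L2_norm_triangle[of "\<lambda>x. Xs n x - X x" M "\<lambda>x. Ys n x - Y x"] f
    by (simp add: L2_fun_diff algebra_simps)
  show "(\<lambda>n. L2_norm M (\<lambda>x. Xs n x - X x) + L2_norm M (\<lambda>x. Ys n x - Y x)) \<longlonglongrightarrow> 0"
    using tendsto_add[OF assms[THEN L2_tendsto_norm]] by simp
  show "\<And>n. (\<lambda>x. Xs n x + Ys n x) \<in> L2_fun M" "(\<lambda>x. X x + Y x) \<in> L2_fun M"
    using f by auto
qed

lemma L2_tendsto_cmult:
  assumes "L2_tendsto M Xs X"
  shows "L2_tendsto M (\<lambda>n x. c * Xs n x) (\<lambda>x. c * X x)"
proof (rule L2_tendstoI_bound)
  note f = assms[THEN L2_tendsto_fun] assms[THEN L2_tendsto_lim_fun]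
  show "L2_norm M (\<lambda>x. c * Xs n x - c * X x) \<le> cmod c * L2_norm M (\<lambda>x. Xs n x - X x)" for n
    using L2_norm_cmult[of M c "\<lambda>x. Xs n x - X x"] by (simp add: algebra_simps)
  show "(\<lambda>n. cmod c * L2_norm M (\<lambda>x. Xs n x - X x)) \<longlonglongrightarrow> 0"
    using tendsto_mult_left[OF L2_tendsto_norm[OF assms], of "cmod c"] by simp
qed (use assms in \<open>auto dest: L2_tendsto_fun L2_tendsto_lim_fun\<close>)

lemma L2_tendsto_diff:
  assumes "L2_tendsto M Xs X" "L2_tendsto M Ys Y"
  shows "L2_tendsto M (\<lambda>n x. Xs n x - Ys n x) (\<lambda>x. X x - Y x)"
  using L2_tendsto_add[OF assms(1) L2_tendsto_cmult[OF assms(2), of "-1"]] by simp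

lemma L2_tendsto_sum:
  assumes "\<And>i. i \<in> I \<Longrightarrow> L2_tendsto M (Xs i) (X i)"
  shows "L2_tendsto M (\<lambda>n x. \<Sum>i\<in>I. Xs i n x) (\<lambda>x. \<Sum>i\<in>I. X i x)"
  using assms by (induction I rule: infinite_finite_induct) (auto intro: L2_tendsto_add L2_tendsto_const)

lemma L2_tendsto_bounded_mult:
  assumes "L2_tendsto M Xs X" and u: "u \<in> borel_measurable M" "AE x in M. cmod (u x) \<le> K"
  shows "L2_tendsto M (\<lambda>n x. u x * Xs n x) (\<lambda>x. u x * X x)"
proof -
  note f = assms(1)[THEN L2_tendsto_fun] assms(1)[THEN L2_tendsto_lim_fun]
  have "(\<lambda>n. LINT x|M. (cmod (u x * Xs n x - u x * X x))\<^sup>2) \<longlonglongrightarrow> 0"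
  proof (rule tendsto_sandwich[OF always_eventually always_eventually tendsto_const])
    show "\<forall>n. (LINT x|M. (cmod (u x * Xs n x - u x * X x))\<^sup>2)
        \<le> K\<^sup>2 * (LINT x|M. (cmod (Xs n x - X x))\<^sup>2)"
    proof
      fix n
      have "(LINT x|M. (cmod (u x * Xs n x - u x * X x))\<^sup>2) \<le> (LINT x|M. K\<^sup>2 * (cmod (Xs n x - X x))\<^sup>2)"
      proof (rule integral_mono_AE)
        show "integrable M (\<lambda>x. (cmod (u x * Xs n x - u x * X x))\<^sup>2)"
          using L2_fun_bounded_mult[OF L2_fun_diff[OF f(1)[of n] f(2)] u] by (simp add: L2_fun_def algebra_simps)
        show "integrable M (\<lambda>x. K\<^sup>2 * (cmod (Xs n x - X x))\<^sup>2)"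
          using L2_fun_diff[OF f(1)[of n] f(2)] by (simp add: L2_fun_def)
        show "AE x in M. (cmod (u x * Xs n x - u x * X x))\<^sup>2 \<le> K\<^sup>2 * (cmod (Xs n x - X x))\<^sup>2"
          using u(2) unfolding right_diff_distrib[symmetric] norm_mult power_mult_distrib
          by (auto intro!: mult_right_mono power_mono)
      qed
      then show "(LINT x|M. (cmod (u x * Xs n x - u x * X x))\<^sup>2)
        \<le> K\<^sup>2 * (LINT x|M. (cmod (Xs n x - X x))\<^sup>2)" by simp
    qed
    show "(\<lambda>n. K\<^sup>2 * (LINT x|M. (cmod (Xs n x - X x))\<^sup>2)) \<longlonglongrightarrow> 0"
      using assms(1) unfolding L2_tendsto_def by (auto intro: tendsto_mult_right_zero)
  qed (auto intro: Bochner_Integration.integral_nonneg)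
  then show ?thesis
    unfolding L2_tendsto_def using f L2_fun_bounded_mult[OF _ u] by auto
qed

lemma L2_inner_tendsto:
  assumes X: "L2_tendsto M Xs X" and Y: "L2_tendsto M Ys Y"
  shows "(\<lambda>n. L2_inner M (Xs n) (Ys n)) \<longlonglongrightarrow> L2_inner M X Y"
proof -
  note f = X[THEN L2_tendsto_fun] X[THEN L2_tendsto_lim_fun] Y[THEN L2_tendsto_fun] Y[THEN L2_tendsto_lim_fun]
  let ?d = "\<lambda>n. L2_norm M (\<lambda>x. Xs n x - X x)" and ?e = "\<lambda>n. L2_norm M (\<lambda>x. Ys n x - Y x)"
  have "(\<lambda>n. L2_inner M (Xs n) (Ys n) - L2_inner M X Y) \<longlonglongrightarrow> 0"
  proof (rule Lim_null_comparison[OF always_eventually])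
    show "\<forall>n. norm (L2_inner M (Xs n) (Ys n) - L2_inner M X Y) \<le> ?d n * (?e n + L2_norm M Y) + L2_norm M X * ?e n"
    proof
      fix n
      have "L2_inner M (Xs n) (Ys n) - L2_inner M X Y
          = L2_inner M (\<lambda>x. Xs n x - X x) (Ys n) + L2_inner M X (\<lambda>x. Ys n x - Y x)"
        using f by (simp add: L2_inner_diff_left L2_inner_diff_right)
      also have "norm \<dots> \<le> ?d n * L2_norm M (Ys n) + L2_norm M X * ?e n"
        using f by (intro norm_triangle_le add_mono L2_Cauchy_Schwarz) auto
      also have "\<dots> \<le> ?d n * (?e n + L2_norm M Y) + L2_norm M X * ?e n"
        using f by (intro add_mono mult_left_mono L2_norm_le_diff_add) auto
      finally show "norm (L2_inner M (Xs n) (Ys n) - L2_inner M X Y) \<le> ?d n * (?e n + L2_norm M Y) + L2_norm M X * ?e n" .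
    qed
    have "(\<lambda>n. ?d n * (?e n + L2_norm M Y) + L2_norm M X * ?e n) \<longlonglongrightarrow> 0 * (0 + L2_norm M Y) + L2_norm M X * 0"
      using X Y by (intro tendsto_intros L2_tendsto_norm)
    then show "(\<lambda>n. ?d n * (?e n + L2_norm M Y) + L2_norm M X * ?e n) \<longlonglongrightarrow> 0" by simp
  qed
  then show ?thesis by (simp add: LIM_zero_iff)
qed

lemma L2_norm_tendsto:
  assumes X: "L2_tendsto M Xs X"
  shows "(\<lambda>n. (L2_norm M (Xs n))\<^sup>2) \<longlonglongrightarrow> (L2_norm M X)\<^sup>2"
proof -
  have "(\<lambda>n. Re (L2_inner M (Xs n) (Xs n))) \<longlonglongrightarrow> Re (L2_inner M X X)"
    by (intro tendsto_Re L2_inner_tendsto X)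
  then show ?thesis by (simp add: L2_inner_self del: of_real_power)
qed

lemma L2_tendsto_unique:
  assumes X: "L2_tendsto M Xs X" and Y: "L2_tendsto M Xs Y"
  shows "AE x in M. X x = Y x"
proof -
  have "L2_tendsto M (\<lambda>n x. Xs n x - Xs n x) (\<lambda>x. X x - Y x)"
    by (rule L2_tendsto_diff[OF X Y])
  then have "(\<lambda>n. (0::real)) \<longlonglongrightarrow> (L2_norm M (\<lambda>x. X x - Y x))\<^sup>2" "(\<lambda>x. X x - Y x) \<in> L2_fun M"
    using L2_norm_tendsto[of M "\<lambda>n x. Xs n x - Xs n x"] L2_tendsto_lim_fun by fastforce+
  then have "L2_norm M (\<lambda>x. X x - Y x) = 0"
    using LIMSEQ_unique tendsto_const by (metis power_eq_0_iff)
  with L2_norm_eq_0_imp_AE[OF \<open>(\<lambda>x. X x - Y x) \<in> L2_fun M\<close>] show ?thesis by simp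
qed

lemma L2_tendsto_cong_AE:
  assumes X: "L2_tendsto M Xs X" and "Y \<in> borel_measurable M" "AE x in M. X x = Y x"
  shows "L2_tendsto M Xs Y"
proof -
  have Y: "Y \<in> L2_fun M"
    using X assms by (intro L2_fun_bound[where u = "\<lambda>x. (cmod (X x))\<^sup>2"])
      (auto simp: L2_tendsto_def L2_fun_def)
  have "L2_norm M (\<lambda>x. Xs n x - X x) = L2_norm M (\<lambda>x. Xs n x - Y x)" for n
    using assms(3) X Y by (intro L2_norm_cong_AE)
      (auto simp: L2_tendsto_def intro!: borel_measurable_diff dest: L2_fun_measurable)
  then show ?thesis using X Y by (simp add: L2_tendsto_iff)
qed

lemma L2_tendsto_shift_diff:
  assumes X: "L2_tendsto M Xs X" and Ys: "\<And>n. Ys n \<in> L2_fun M"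
    and d: "(\<lambda>n. L2_norm M (\<lambda>x. Xs n x - Ys n x)) \<longlonglongrightarrow> 0"
  shows "L2_tendsto M Ys X"
proof (rule L2_tendstoI_bound)
  show "(\<lambda>n. L2_norm M (\<lambda>x. Xs n x - Ys n x) + L2_norm M (\<lambda>x. Xs n x - X x)) \<longlonglongrightarrow> 0"
    using tendsto_add[OF d L2_tendsto_norm[OF X]] by simp
  show "L2_norm M (\<lambda>x. Ys n x - X x) \<le> L2_norm M (\<lambda>x. Xs n x - Ys n x) + L2_norm M (\<lambda>x. Xs n x - X x)" for n
    using L2_norm_triangle_diff[of "Ys n" M "Xs n" X] X Ys
    by (simp add: L2_norm_minus_commute[of M "Xs n" "Ys n"] L2_tendsto_def)
qed (use X Ys in \<open>auto simp: L2_tendsto_def\<close>)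

section \<open>Completeness and uniform boundedness\<close>

text \<open>
  The Riesz-Fischer argument. By monotone convergence \<open>\<Sum>\<bar>Xs (n + 1) - Xs
  n\<bar>\<close> has finite norm, hence is finite almost everywhere, so that the sequence
  converges pointwise; Fatou's lemma bounds the distance to the limit by a tail of
  \<open>r\<close>. This explicit rate is what the proof of uniform boundedness relies on.
\<close>

lemma L2_complete_summable:
  fixes Xs :: "nat \<Rightarrow> 'a \<Rightarrow> complex"
  assumes Xs: "\<And>n. Xs n \<in> L2_fun M"
    and r: "\<And>n. L2_norm M (\<lambda>x. Xs (Suc n) x - Xs n x) \<le> r n" "summable r"
  obtains X where "L2_tendsto M Xs X" "\<And>n. L2_norm M (\<lambda>x. Xs n x - X x) \<le> (\<Sum>k. r (k + n))"
proof -
  have r0: "0 \<le> r n" for n using r(1)[of n] L2_norm_nonneg order_trans by blast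
  note [measurable] = Xs[THEN L2_fun_measurable]
  define G where "G n x = (\<Sum>k<n. cmod (Xs (Suc k) x - Xs k x))" for n x
  have G_meas[measurable]: "G n \<in> borel_measurable M" for n unfolding G_def by measurable
  have abs_L2: "(\<lambda>x. complex_of_real (cmod (Xs (Suc k) x - Xs k x))) \<in> L2_fun M" for k
    using L2_fun_diff[OF Xs[of "Suc k"] Xs[of k]] by (simp add: L2_fun_def)
  have GL2: "(\<lambda>x. complex_of_real (G n x)) \<in> L2_fun M" for n
    unfolding G_def of_real_sum by (intro L2_fun_sum abs_L2)
  have Gnorm: "L2_norm M (\<lambda>x. complex_of_real (G n x)) \<le> suminf r" for n
  proof -
    have "L2_norm M (\<lambda>x. complex_of_real (G n x)) \<le> (\<Sum>k<n. L2_norm M (\<lambda>x. complex_of_real (cmod (Xs (Suc k) x - Xs k x))))"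
      unfolding G_def of_real_sum by (intro L2_norm_sum_le abs_L2)
    also have "\<dots> = (\<Sum>k<n. L2_norm M (\<lambda>x. Xs (Suc k) x - Xs k x))"
      by (simp add: L2_norm_def)
    also have "\<dots> \<le> (\<Sum>k<n. r k)" by (intro sum_mono r)
    also have "\<dots> \<le> suminf r" by (intro sum_le_suminf r) (auto simp: r0)
    finally show ?thesis .
  qed
  have Gint: "(\<integral>\<^sup>+x. ennreal ((G n x)\<^sup>2) \<partial>M) \<le> ennreal ((suminf r)\<^sup>2)" for n
    using nn_integral_L2_norm[OF GL2[of n]] Gnorm[of n] by (simp add: ennreal_leI power_mono)
  have "(\<integral>\<^sup>+x. (SUP n. ennreal ((G n x)\<^sup>2)) \<partial>M) = (SUP n. \<integral>\<^sup>+x. ennreal ((G n x)\<^sup>2) \<partial>M)"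
  proof (rule nn_integral_monotone_convergence_SUP)
    show "incseq (\<lambda>n x. ennreal ((G n x)\<^sup>2))"
      unfolding G_def by (intro incseq_SucI le_funI ennreal_leI power_mono) (auto intro: sum_nonneg)
  qed measurable
  also have "\<dots> \<le> ennreal ((suminf r)\<^sup>2)" by (intro SUP_least Gint)
  finally have "(\<integral>\<^sup>+x. (SUP n. ennreal ((G n x)\<^sup>2)) \<partial>M) \<noteq> \<infinity>"
    by (metis ennreal_less_top infinity_ennreal_def leD)
  then have "AE x in M. (SUP n. ennreal ((G n x)\<^sup>2)) \<noteq> \<infinity>"
    by (rule nn_integral_noteq_infinite[rotated]) measurable
  then have conv: "AE x in M. convergent (\<lambda>n. Xs n x)"
  proof (rule AE_mp, intro AE_I2 impI)
    fix x assume "(SUP n. ennreal ((G n x)\<^sup>2)) \<noteq> \<infinity>"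
    then obtain K where K: "0 \<le> K" "(SUP n. ennreal ((G n x)\<^sup>2)) = ennreal K"
      by (metis ennreal_cases infinity_ennreal_def)
    have "(G n x)\<^sup>2 \<le> K" for n
      using SUP_upper[of n UNIV "\<lambda>n. ennreal ((G n x)\<^sup>2)"] K by simp
    then have "G n x \<le> sqrt K" for n by (simp add: real_le_rsqrt)
    then have "summable (\<lambda>k. cmod (Xs (Suc k) x - Xs k x))"
      unfolding G_def by (intro summableI_nonneg_bounded[where x = "sqrt K"]) auto
    then have "summable (\<lambda>k. Xs (Suc k) x - Xs k x)" by (rule summable_norm_cancel)
    then have "convergent (\<lambda>n. \<Sum>k<n. Xs (Suc k) x - Xs k x)"
      by (simp add: summable_iff_convergent)
    then have "convergent (\<lambda>n. Xs n x - Xs 0 x)"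
      unfolding sum_lessThan_telescope[of "\<lambda>k. Xs k x"] .
    then show "convergent (\<lambda>n. Xs n x)"
      using convergent_diff_const_right_iff by blast
  qed
  define X where "X x = lim (\<lambda>n. Xs n x)" for x
  have X_meas[measurable]: "X \<in> borel_measurable M" unfolding X_def by measurable
  have lim: "AE x in M. (\<lambda>n. Xs n x) \<longlonglongrightarrow> X x"
    using conv by eventually_elim (simp add: X_def convergent_LIMSEQ_iff)
  define T where "T n = (\<Sum>k. r (k + n))" for n
  have T0: "0 \<le> T n" for n unfolding T_def by (intro suminf_nonneg) (auto simp: r0 summable_iff_shift r)
  have diff_le: "L2_norm M (\<lambda>x. Xs (m + n) x - Xs n x) \<le> T n" for m n
  proof -
    have "L2_norm M (\<lambda>x. Xs (m + n) x - Xs n x) = L2_norm M (\<lambda>x. \<Sum>k<m. Xs (Suc k + n) x - Xs (k + n) x)"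
      using sum_lessThan_telescope[of "\<lambda>k. Xs (k + n) x" m for x] by simp
    also have "\<dots> \<le> (\<Sum>k<m. L2_norm M (\<lambda>x. Xs (Suc k + n) x - Xs (k + n) x))"
      by (intro L2_norm_sum_le L2_fun_diff Xs)
    also have "\<dots> \<le> (\<Sum>k<m. r (k + n))" using r(1) by (intro sum_mono) simp
    also have "\<dots> \<le> T n" unfolding T_def by (intro sum_le_suminf) (auto simp: r0 summable_iff_shift r)
    finally show ?thesis .
  qed
  have fatou: "(\<integral>\<^sup>+x. ennreal ((cmod (Xs n x - X x))\<^sup>2) \<partial>M) \<le> ennreal ((T n)\<^sup>2)" for n
  proof -
    have "(\<integral>\<^sup>+x. ennreal ((cmod (Xs n x - X x))\<^sup>2) \<partial>M)
        = (\<integral>\<^sup>+x. liminf (\<lambda>m. ennreal ((cmod (Xs (m + n) x - Xs n x))\<^sup>2)) \<partial>M)"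
    proof (rule nn_integral_cong_AE)
      show "AE x in M. ennreal ((cmod (Xs n x - X x))\<^sup>2) = liminf (\<lambda>m. ennreal ((cmod (Xs (m + n) x - Xs n x))\<^sup>2))"
        using lim
      proof eventually_elim
        case (elim x)
        have "(\<lambda>m. ennreal ((cmod (Xs (m + n) x - Xs n x))\<^sup>2)) \<longlonglongrightarrow> ennreal ((cmod (X x - Xs n x))\<^sup>2)"
          by (intro tendsto_ennrealI tendsto_power tendsto_norm tendsto_diff tendsto_const
            LIMSEQ_ignore_initial_segment[OF elim])
        from lim_imp_Liminf[OF trivial_limit_sequentially this] show ?case
          by (subst norm_minus_commute) (rule sym)
      qed
    qed
    also have "\<dots> \<le> liminf (\<lambda>m. \<integral>\<^sup>+x. ennreal ((cmod (Xs (m + n) x - Xs n x))\<^sup>2) \<partial>M)"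
      by (rule nn_integral_liminf) measurable
    also have "\<dots> = liminf (\<lambda>m. ennreal ((L2_norm M (\<lambda>x. Xs (m + n) x - Xs n x))\<^sup>2))"
      by (subst nn_integral_L2_norm) (auto intro: Xs)
    also have "\<dots> \<le> liminf (\<lambda>m. ennreal ((T n)\<^sup>2))"
      by (intro Liminf_mono always_eventually allI ennreal_leI power_mono diff_le) simp
    also have "\<dots> = ennreal ((T n)\<^sup>2)" by (simp add: Liminf_const)
    finally show ?thesis .
  qed
  have dL2: "(\<lambda>x. Xs n x - X x) \<in> L2_fun M" for n
  proof -
    have "integrable M (\<lambda>x. (cmod (Xs n x - X x))\<^sup>2)"
    proof (rule integrableI_bounded)
      show "(\<integral>\<^sup>+x. ennreal (norm ((cmod (Xs n x - X x))\<^sup>2)) \<partial>M) < \<infinity>"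
        using le_less_trans[OF fatou[of n] ennreal_less_top] by simp
    qed measurable
    then show ?thesis by (simp add: L2_fun_def)
  qed
  have XL2: "X \<in> L2_fun M" using L2_fun_diff[OF Xs[of 0] dL2[of 0]] by simp
  have le: "L2_norm M (\<lambda>x. Xs n x - X x) \<le> T n" for n
    using fatou[of n] unfolding nn_integral_L2_norm[OF dL2]
    by (intro power2_le_imp_le[OF _ T0]) simp
  have "T \<longlonglongrightarrow> 0" unfolding T_def by (rule suminf_exist_split2[OF r(2)])
  with le have "L2_tendsto M Xs X" by (intro L2_tendstoI_bound[where r = T] Xs XL2)
  then show ?thesis using le unfolding T_def by (rule that)
qed

lemma L2_complete:
  assumes Xs: "\<And>n. Xs n \<in> L2_fun M"
    and cauchy: "\<And>e. 0 < e \<Longrightarrow> \<exists>N. \<forall>m\<ge>N. \<forall>n\<ge>N. L2_norm M (\<lambda>x. Xs m x - Xs n x) < e"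
  shows "\<exists>X. L2_tendsto M Xs X"
proof -
  have "\<forall>k. \<exists>N. \<forall>m\<ge>N. \<forall>n\<ge>N. L2_norm M (\<lambda>x. Xs m x - Xs n x) < (1/2)^k"
    using cauchy by simp
  then obtain N where N: "\<And>k m n. m \<ge> N k \<Longrightarrow> n \<ge> N k \<Longrightarrow> L2_norm M (\<lambda>x. Xs m x - Xs n x) < (1/2)^k"
    by metis
  \<comment> \<open>Sums of the thresholds are increasing indices beyond each of them.\<close>
  define s where "s k = (\<Sum>i\<le>k. N i)" for k
  have sN: "N k \<le> s k" for k unfolding s_def by (rule member_le_sum) auto
  have sS: "N k \<le> s (Suc k)" for k unfolding s_def by (rule member_le_sum) auto
  have summ: "summable (\<lambda>k. (1/2::real)^k)" by (intro summable_geometric) simp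
  obtain X where X: "L2_tendsto M (\<lambda>k. Xs (s k)) X"
      "\<And>n. L2_norm M (\<lambda>x. Xs (s n) x - X x) \<le> (\<Sum>k. (1/2)^(k + n))"
    by (rule L2_complete_summable[where M = M and Xs = "\<lambda>k. Xs (s k)" and r = "\<lambda>k. (1/2)^k"])
      (use Xs N sN sS summ in \<open>auto intro: less_imp_le\<close>)
  have "(\<lambda>n. L2_norm M (\<lambda>x. Xs n x - X x)) \<longlonglongrightarrow> 0"
  proof (rule LIMSEQ_I)
    fix e :: real assume e: "0 < e"
    have "(\<lambda>k. (1/2)^k + L2_norm M (\<lambda>x. Xs (s k) x - X x)) \<longlonglongrightarrow> 0 + 0"
      by (intro tendsto_add LIMSEQ_power_zero L2_tendsto_norm[OF X(1)]) simp
    then obtain k where k: "(1/2)^k + L2_norm M (\<lambda>x. Xs (s k) x - X x) < e"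
      using order_tendstoD(2)[of _ "0::real" sequentially e] e eventually_happens'[OF trivial_limit_sequentially]
      by (metis (lifting) add_0 sequentially_bot)
    show "\<exists>no. \<forall>n\<ge>no. norm (L2_norm M (\<lambda>x. Xs n x - X x) - 0) < e"
    proof (intro exI allI impI)
      fix n assume "s k \<le> n"
      then have "L2_norm M (\<lambda>x. Xs n x - Xs (s k) x) < (1/2)^k"
        using sN[of k] by (intro N) auto
      moreover have "L2_norm M (\<lambda>x. Xs n x - X x)
          \<le> L2_norm M (\<lambda>x. Xs n x - Xs (s k) x) + L2_norm M (\<lambda>x. Xs (s k) x - X x)"
        by (intro L2_norm_triangle_diff Xs L2_tendsto_lim_fun[OF X(1)])
      ultimately show "norm (L2_norm M (\<lambda>x. Xs n x - X x) - 0) < e" using k by simp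
    qed
  qed
  then show ?thesis using Xs L2_tendsto_lim_fun[OF X(1)] by (auto simp: L2_tendsto_iff)
qed

text \<open>
  A direct argument in place of Baire category. If the norms of \<open>U\<close> are unbounded,
  choose \<open>u n\<close> with norm above \<open>4^n\<close> and walk from \<open>0\<close> in
  steps of length \<open>3^(-n)\<close> along \<open>\<plusminus> u n\<close>, with the sign
  that makes the inner product with \<open>u n\<close> large. All later steps together are half
  as long as the \<open>n\<close>-th one, so the limit still has an inner product with \<open>u
  n\<close> of order \<open>(4/3)^n\<close>.
\<close>

lemma L2_uniform_boundedness:
  assumes U: "U \<subseteq> L2_fun M"
    and bdd: "\<And>x. x \<in> L2_fun M \<Longrightarrow> \<exists>K. \<forall>u\<in>U. cmod (L2_inner M x u) \<le> K"
  shows "\<exists>K. \<forall>u\<in>U. L2_norm M u \<le> K"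
proof (rule ccontr)
  assume "\<not> ?thesis"
  then have "\<forall>n::nat. \<exists>u\<in>U. L2_norm M u > 4^n" by (meson not_le)
  then obtain u where u: "\<And>n::nat. u n \<in> U" "\<And>n. L2_norm M (u n) > 4^n" by metis
  have uL: "u n \<in> L2_fun M" for n using u U by auto
  have up: "0 < L2_norm M (u n)" for n using u(2)[of n] less_trans[of 0 "4^n :: real"] by simp
  define y where "y n = (\<lambda>t. complex_of_real ((1/3)^n / L2_norm M (u n)) * u n t)" for n
  have yL: "y n \<in> L2_fun M" for n unfolding y_def by (intro L2_fun_cmult uL)
  have ynorm: "L2_norm M (y n) = (1/3)^n" for n
    unfolding y_def L2_norm_cmult using up[of n] by (simp add: norm_divide norm_power)
  have yu: "cmod (L2_inner M (y n) (u n)) = (1/3)^n * L2_norm M (u n)" for n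
    unfolding y_def L2_inner_cmult_left L2_inner_self using up[of n]
    by (simp add: norm_mult norm_divide norm_power power2_eq_square)
  \<comment> \<open>The inner products of \<open>u n\<close> with \<open>z + y n\<close> and \<open>z - y n\<close> differ by twice the one with \<open>y n\<close>,
      so one of them is at least as large as that one.\<close>
  define stp where "stp n z = (if cmod (L2_inner M (\<lambda>t. z t + y n t) (u n)) \<ge> cmod (L2_inner M (y n) (u n))
      then (\<lambda>t. z t + y n t) else (\<lambda>t. z t - y n t))" for n z
  have stp: "stp n z \<in> L2_fun M \<and> L2_norm M (\<lambda>t. stp n z t - z t) = (1/3)^n
      \<and> cmod (L2_inner M (stp n z) (u n)) \<ge> (1/3)^n * L2_norm M (u n)" if "z \<in> L2_fun M" for n z
  proof -
    let ?a = "L2_inner M z (u n)" and ?b = "L2_inner M (y n) (u n)"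
    have eq: "L2_inner M (\<lambda>t. z t + y n t) (u n) = ?a + ?b" "L2_inner M (\<lambda>t. z t - y n t) (u n) = ?a - ?b"
      using that uL yL by (simp_all add: L2_inner_add_left L2_inner_diff_left)
    have "2 * cmod ?b = cmod ((?a + ?b) - (?a - ?b))"
    proof -
      have "(?a + ?b) - (?a - ?b) = 2 * ?b" by simp
      then show ?thesis by (metis norm_mult norm_numeral)
    qed
    also have "\<dots> \<le> cmod (?a + ?b) + cmod (?a - ?b)" by (rule norm_triangle_ineq4)
    finally have 1: "cmod ?b \<le> cmod (?a + ?b) \<or> cmod ?b \<le> cmod (?a - ?b)" by linarith
    have 2: "L2_norm M (\<lambda>t. - y n t) = L2_norm M (y n)" by (simp add: L2_norm_def)
    show ?thesis
      using 1 2 that yL ynorm[of n] yu[of n] unfolding stp_def by (auto simp: eq)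
  qed
  define x where "x n = rec_nat (\<lambda>t. 0) stp n" for n
  have x0: "x 0 = (\<lambda>t. 0)" and xS: "x (Suc n) = stp n (x n)" for n by (simp_all add: x_def)
  have xL: "x n \<in> L2_fun M" for n by (induction n) (use stp in \<open>auto simp: x0 xS\<close>)
  have summ: "summable (\<lambda>k. (1/3::real)^k)" by (intro summable_geometric) simp
  obtain X where X: "L2_tendsto M x X" "\<And>n. L2_norm M (\<lambda>t. x n t - X t) \<le> (\<Sum>k. (1/3)^(k + n))"
    by (rule L2_complete_summable[where M = M and Xs = x and r = "\<lambda>k. (1/3)^k"])
      (use xL stp summ in \<open>auto simp: xS\<close>)
  have XL: "X \<in> L2_fun M" by (rule L2_tendsto_lim_fun[OF X(1)])
  have tail: "(\<Sum>k. (1/3::real)^(k + Suc n)) = (1/3)^n / 2" for n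
  proof -
    have "(\<Sum>k. (1/3::real)^(k + Suc n)) = (\<Sum>k. (1/3)^k * (1/3)^Suc n)"
      unfolding power_add ..
    also have "\<dots> = (\<Sum>k. (1/3)^k) * (1/3)^Suc n"
      using suminf_mult2[OF summ, of "(1/3)^Suc n"] by (rule sym)
    also have "(\<Sum>k. (1/3::real)^k) = 3 / 2" by (subst suminf_geometric) auto
    finally show ?thesis by simp
  qed
  have big: "(4/3)^n / 2 \<le> cmod (L2_inner M X (u n))" for n
  proof -
    have "cmod (L2_inner M (x (Suc n)) (u n)) - cmod (L2_inner M X (u n))
        \<le> cmod (L2_inner M (x (Suc n)) (u n) - L2_inner M X (u n))" by (rule norm_triangle_ineq2)
    also have "\<dots> = cmod (L2_inner M (\<lambda>t. x (Suc n) t - X t) (u n))"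
      using xL XL uL by (simp add: L2_inner_diff_left)
    also have "\<dots> \<le> L2_norm M (\<lambda>t. x (Suc n) t - X t) * L2_norm M (u n)"
      using xL XL uL by (intro L2_Cauchy_Schwarz) auto
    also have "\<dots> \<le> (1/3)^n / 2 * L2_norm M (u n)"
      using X(2)[of "Suc n"] tail[of n] by (intro mult_right_mono) auto
    finally have "(1/3)^n * L2_norm M (u n) / 2 \<le> cmod (L2_inner M X (u n))"
      using stp[OF xL[of n], of n] xS[of n] by auto
    moreover have "(1/3)^n * 4^n \<le> (1/3)^n * L2_norm M (u n)"
      using u(2)[of n] by (intro mult_left_mono) auto
    moreover have "(1/3::real)^n * 4^n = (4/3)^n" by (simp flip: power_mult_distrib)
    ultimately show ?thesis by linarith
  qed
  obtain K where K: "\<forall>u\<in>U. cmod (L2_inner M X u) \<le> K" using bdd[OF XL] by auto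
  obtain n where "(4/3::real)^n > 2 * K" using real_arch_pow[of "4/3" "2 * K"] by auto
  with big[of n] K u(1)[of n] show False by fastforce
qed

section \<open>Operators on square-summable sequences\<close>

text \<open>
  Square-summable sequences are the \<open>L\<^sub>2\<close> functions of the counting measure,
  and so inherit completeness and uniform boundedness.
\<close>

lemma l2_eq_L2_fun: "l2 = L2_fun (count_space UNIV)"
  unfolding l2_def L2_fun_def by (auto simp: integrable_count_space_nat_iff)

abbreviation l2_norm :: "(nat \<Rightarrow> complex) \<Rightarrow> real" where
  "l2_norm \<equiv> L2_norm (count_space UNIV)"

lemma l2_inner_eq_L2_inner:
  assumes "x \<in> l2" "y \<in> l2"
  shows "l2_inner x y = L2_inner (count_space UNIV) x y"
  using integrable_mult_cnj[OF assms[unfolded l2_eq_L2_fun]]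
  unfolding l2_inner_def L2_inner_def by (simp add: integral_count_space_nat)

lemma l2_norm_sq: "x \<in> l2 \<Longrightarrow> (l2_norm x)\<^sup>2 = (\<Sum>k. (cmod (x k))\<^sup>2)"
  unfolding L2_norm_sq by (rule integral_count_space_nat) (simp add: l2_eq_L2_fun L2_fun_def)

definition seq_trunc :: "nat \<Rightarrow> (nat \<Rightarrow> complex) \<Rightarrow> nat \<Rightarrow> complex" where
  "seq_trunc n x k = (if k < n then x k else 0)"

lemma suminf_seq_trunc:
  assumes "\<And>k. F k 0 = 0"
  shows "(\<Sum>k. F k (seq_trunc n y k)) = (\<Sum>k<n. F k (y k) :: 'b :: {t2_space, comm_monoid_add})"
  by (subst suminf_finite[of "{..<n}"]) (auto simp: seq_trunc_def assms)

lemma seq_trunc_l2 [simp]: "seq_trunc n x \<in> l2"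
proof -
  have "summable (\<lambda>k. (cmod (seq_trunc n x k))\<^sup>2)"
    by (rule summable_finite[of "{..<n}"]) (auto simp: seq_trunc_def)
  then show ?thesis by (simp add: l2_def)
qed

lemma seq_trunc_tendsto:
  assumes "x \<in> l2"
  shows "L2_tendsto (count_space UNIV) (\<lambda>n. seq_trunc n x) x"
proof -
  have s: "summable (\<lambda>k. (cmod (x k))\<^sup>2)" using assms by (simp add: l2_def)
  have "(LINT k|count_space UNIV. (cmod (seq_trunc n x k - x k))\<^sup>2) = (\<Sum>k. (cmod (x (k + n)))\<^sup>2)" for n
  proof -
    have "(\<lambda>k. seq_trunc n x k - x k) \<in> l2"
      using assms seq_trunc_l2 unfolding l2_eq_L2_fun by blast
    then have summ: "summable (\<lambda>k. (cmod (seq_trunc n x k - x k))\<^sup>2)" by (simp add: l2_def)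
    then have "(LINT k|count_space UNIV. (cmod (seq_trunc n x k - x k))\<^sup>2) = (\<Sum>k. (cmod (seq_trunc n x k - x k))\<^sup>2)"
      by (intro integral_count_space_nat) (simp add: integrable_count_space_nat_iff)
    also have "\<dots> = (\<Sum>k. (cmod (seq_trunc n x (k + n) - x (k + n)))\<^sup>2) + (\<Sum>k<n. (cmod (seq_trunc n x k - x k))\<^sup>2)"
      by (rule suminf_split_initial_segment[OF summ])
    finally show ?thesis by (simp add: seq_trunc_def)
  qed
  then show ?thesis
    unfolding L2_tendsto_def using suminf_exist_split2[OF s] assms seq_trunc_l2
    by (simp add: l2_eq_L2_fun)
qed

text \<open>
  The functionals \<open>x \<mapsto> <x, T z>\<close>, with \<open>z\<close> a finitely
  supported unit vector, are bounded at each \<open>x\<close> by the norm of \<open>T x\<close>,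
  because \<open><x, T z> = <T x, z>\<close>. Uniform boundedness therefore bounds
  \<open>T\<close> on finitely supported vectors, and duality carries the bound over to all of
  \<open>\<ell>\<^sub>2\<close>. Symmetry is only asked against truncated vectors since for a
  matrix no more is clear beforehand.
\<close>

lemma Hellinger_Toeplitz:
  assumes T: "\<And>x. x \<in> l2 \<Longrightarrow> T x \<in> l2"
    and sym: "\<And>x y n. x \<in> l2 \<Longrightarrow> y \<in> l2 \<Longrightarrow> l2_inner (T x) (seq_trunc n y) = l2_inner x (T (seq_trunc n y))"
  shows "\<exists>B\<ge>0. \<forall>x\<in>l2. l2_norm (T x) \<le> B * l2_norm x"
proof -
  let ?C = "count_space (UNIV::nat set)"
  define U where "U = {(\<lambda>k. complex_of_real (1 / l2_norm (seq_trunc n y)) * T (seq_trunc n y) k) | n y.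
      y \<in> l2 \<and> l2_norm (seq_trunc n y) \<noteq> 0}"
  have "\<exists>K. \<forall>u\<in>U. L2_norm ?C u \<le> K"
  proof (rule L2_uniform_boundedness)
    show "U \<subseteq> L2_fun ?C"
    proof
      fix u assume "u \<in> U"
      then obtain n y where u: "u = (\<lambda>k. complex_of_real (1 / l2_norm (seq_trunc n y)) * T (seq_trunc n y) k)"
        unfolding U_def by auto
      show "u \<in> L2_fun ?C"
        unfolding u by (intro L2_fun_cmult) (use T[of "seq_trunc n y"] in \<open>simp add: l2_eq_L2_fun[symmetric]\<close>)
    qed
    fix x assume "x \<in> L2_fun ?C"
    then have x: "x \<in> l2" by (simp add: l2_eq_L2_fun)
    show "\<exists>K. \<forall>u\<in>U. cmod (L2_inner ?C x u) \<le> K"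
    proof (intro exI ballI)
      fix u assume "u \<in> U"
      then obtain n y where u: "u = (\<lambda>k. complex_of_real (1 / l2_norm (seq_trunc n y)) * T (seq_trunc n y) k)"
        and y: "y \<in> l2" and nz: "l2_norm (seq_trunc n y) \<noteq> 0" unfolding U_def by auto
      have pos: "0 < l2_norm (seq_trunc n y)" using nz L2_norm_nonneg by (metis less_eq_real_def)
      have "cmod (L2_inner ?C x u) = cmod (l2_inner (T x) (seq_trunc n y)) / l2_norm (seq_trunc n y)"
        using pos unfolding u L2_inner_cmult_right sym[OF x y]
        by (simp add: norm_divide l2_inner_eq_L2_inner x T)
      also have "\<dots> \<le> l2_norm (T x) * l2_norm (seq_trunc n y) / l2_norm (seq_trunc n y)"
        using x T by (intro divide_right_mono) (auto simp: l2_inner_eq_L2_inner l2_eq_L2_fun[symmetric] intro!: L2_Cauchy_Schwarz)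
      finally show "cmod (L2_inner ?C x u) \<le> l2_norm (T x)" using pos by simp
    qed
  qed
  then obtain K where K: "\<And>u. u \<in> U \<Longrightarrow> L2_norm ?C u \<le> K" by auto
  define B where "B = max K 0"
  have fin: "l2_norm (T (seq_trunc n y)) \<le> B * l2_norm (seq_trunc n y)"
    if "y \<in> l2" "l2_norm (seq_trunc n y) \<noteq> 0" for n y
  proof -
    have pos: "0 < l2_norm (seq_trunc n y)" using that L2_norm_nonneg by (metis less_eq_real_def)
    have "L2_norm ?C (\<lambda>k. complex_of_real (1 / l2_norm (seq_trunc n y)) * T (seq_trunc n y) k) \<le> K"
      by (rule K) (use that in \<open>auto simp: U_def\<close>)
    then have "l2_norm (T (seq_trunc n y)) / l2_norm (seq_trunc n y) \<le> B"
      unfolding L2_norm_cmult B_def by (simp add: norm_divide)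
    then show ?thesis using pos by (simp add: field_simps)
  qed
  have "l2_norm (T x) \<le> B * l2_norm x" if x: "x \<in> l2" for x
  proof -
    \<comment> \<open>Pair \<open>T x\<close> with its own truncation and move \<open>T\<close> to the other side.\<close>
    have le: "l2_norm (seq_trunc n (T x)) \<le> B * l2_norm x" for n
    proof (cases "l2_norm (seq_trunc n (T x)) = 0")
      case False
      let ?z = "seq_trunc n (T x)"
      have "complex_of_real ((l2_norm ?z)\<^sup>2) = l2_inner (T x) ?z"
      proof -
        have "l2_inner ?z ?z = l2_inner (T x) ?z"
          unfolding l2_inner_def by (intro arg_cong[where f = suminf]) (auto simp: seq_trunc_def)
        then show ?thesis by (simp add: l2_inner_eq_L2_inner L2_inner_self T x)
      qed
      also have "\<dots> = l2_inner x (T ?z)" by (rule sym) (use T x in auto)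
      finally have "(l2_norm ?z)\<^sup>2 = cmod (l2_inner x (T ?z))"
        by (metis abs_of_nonneg norm_of_real zero_le_power2)
      also have "\<dots> \<le> l2_norm x * l2_norm (T ?z)"
        using x T by (simp add: l2_inner_eq_L2_inner L2_Cauchy_Schwarz l2_eq_L2_fun[symmetric])
      also have "\<dots> \<le> l2_norm x * (B * l2_norm ?z)"
        using False T x by (intro mult_left_mono fin) auto
      finally show ?thesis
        using False L2_norm_nonneg[of ?C ?z] by (simp add: power2_eq_square mult.assoc mult.left_commute)
    qed (simp add: B_def)
    have "(\<lambda>n. (l2_norm (seq_trunc n (T x)))\<^sup>2) \<longlonglongrightarrow> (l2_norm (T x))\<^sup>2"
      by (intro L2_norm_tendsto seq_trunc_tendsto T x)
    then have "(l2_norm (T x))\<^sup>2 \<le> (B * l2_norm x)\<^sup>2"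
      by (rule LIMSEQ_le_const2) (use le in \<open>auto intro!: power_mono\<close>)
    then show ?thesis by (rule power2_le_imp_le) (simp add: B_def)
  qed
  then show ?thesis by (intro exI[of _ B]) (auto simp: B_def)
qed

section \<open>Lebesgue measure on the band\<close>

lemma space_leb_band [simp]: "space leb_band = {-pi..<pi}"
  by (simp add: leb_band_def space_restrict_space)

lemma sets_leb_band: "sets leb_band = {E. E \<subseteq> {-pi..<pi} \<and> E \<in> sets borel}"
  unfolding leb_band_def by (intro set_eqI) (simp add: sets_restrict_space_iff)

lemma measurable_leb_band [measurable (raw)]: "f \<in> borel_measurable borel \<Longrightarrow> f \<in> borel_measurable leb_band"
  unfolding leb_band_def by (intro measurable_restrict_space1) simp

lemma emeasure_leb_band: "emeasure leb_band {-pi..<pi} = ennreal (2 * pi)"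
  unfolding leb_band_def by (subst emeasure_restrict_space) auto

lemma finite_measure_leb_band: "finite_measure leb_band"
  by (rule finite_measureI) (simp add: emeasure_leb_band)

interpretation leb_band: finite_measure leb_band
  by (rule finite_measure_leb_band)

lemma measure_leb_band [simp]: "measure leb_band {-pi..<pi} = 2 * pi"
  by (simp add: measure_def emeasure_leb_band)

lemma set_integral_leb_band:
  "(LBINT t:{-pi..<pi}. F t) = (LINT t|leb_band. F t)" for F :: "real \<Rightarrow> 'b::{banach, second_countable_topology}"
  unfolding leb_band_def set_lebesgue_integral_def by (subst integral_restrict_space) auto

lemma set_integrable_leb_band:
  "set_integrable lborel {-pi..<pi} F \<longleftrightarrow> integrable leb_band F" for F :: "real \<Rightarrow> 'b::{banach, second_countable_topology}"
  unfolding leb_band_def set_integrable_def by (subst integrable_restrict_space) auto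

lemma (in finite_measure) L2_fun_bounded:
  assumes "X \<in> borel_measurable M" "AE x in M. cmod (X x) \<le> K"
  shows "X \<in> L2_fun M"
proof (rule L2_fun_bound[where u = "\<lambda>x. K\<^sup>2", OF assms(1)])
  show "AE x in M. (cmod (X x))\<^sup>2 \<le> K\<^sup>2"
    using assms(2) by eventually_elim (simp add: power_mono)
qed simp

lemma (in finite_measure) L2_tendsto_bounded_pointwise:
  assumes [measurable]: "\<And>n. Xs n \<in> borel_measurable M" "X \<in> borel_measurable M"
    and lim: "AE x in M. (\<lambda>n. Xs n x) \<longlonglongrightarrow> X x" and bd: "\<And>n. AE x in M. cmod (Xs n x) \<le> K"
  shows "L2_tendsto M Xs X"
proof -
  have bdX: "AE x in M. cmod (X x) \<le> K"
  proof -
    have "AE x in M. \<forall>n. cmod (Xs n x) \<le> K" using bd by (simp add: AE_all_countable)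
    with lim show ?thesis
    proof eventually_elim
      case (elim x)
      show ?case by (rule LIMSEQ_le_const2[OF tendsto_norm[OF elim(1)]]) (use elim in auto)
    qed
  qed
  have "(\<lambda>n. LINT x|M. (cmod (Xs n x - X x))\<^sup>2) \<longlonglongrightarrow> (LINT x|M. 0)"
  proof (rule integral_dominated_convergence[where w = "\<lambda>x. (2 * K)\<^sup>2"])
    show "AE x in M. (\<lambda>n. (cmod (Xs n x - X x))\<^sup>2) \<longlonglongrightarrow> 0"
      using lim
    proof eventually_elim
      case (elim x)
      have "(\<lambda>n. (cmod (Xs n x - X x))\<^sup>2) \<longlonglongrightarrow> (cmod (X x - X x))\<^sup>2"
        by (intro tendsto_power tendsto_norm tendsto_diff elim tendsto_const)
      then show ?case by simp
    qed
    show "AE x in M. norm ((cmod (Xs n x - X x))\<^sup>2) \<le> (2 * K)\<^sup>2" for n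
      using bd[of n] bdX
    proof eventually_elim
      case (elim x)
      have "cmod (Xs n x - X x) \<le> 2 * K" using norm_triangle_ineq4[of "Xs n x" "X x"] elim by simp
      then show ?case using power_mono[of "cmod (Xs n x - X x)" "2 * K" 2] by simp
    qed
  qed auto
  then show ?thesis
    unfolding L2_tendsto_def using L2_fun_bounded[OF _ bd] L2_fun_bounded[OF _ bdX] by simp
qed

section \<open>Trigonometric polynomials\<close>

definition trig_exp :: "int \<Rightarrow> real \<Rightarrow> complex" where
  "trig_exp m t = cis (of_int m * t)"

definition trig_polys :: "(real \<Rightarrow> complex) set" where
  "trig_polys = {p. \<exists>F b. finite F \<and> p = (\<lambda>t. \<Sum>m\<in>F. b m * trig_exp m t)}"

lemma trig_exp_mult: "trig_exp m t * trig_exp n t = trig_exp (m + n) t"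
  by (simp add: trig_exp_def cis_mult algebra_simps)

lemma trig_exp_cnj: "cnj (trig_exp m t) = trig_exp (- m) t"
  by (simp add: trig_exp_def cis_cnj)

lemma norm_trig_exp [simp]: "cmod (trig_exp m t) = 1"
  by (simp add: trig_exp_def)

lemma continuous_on_cis' [continuous_intros]: "continuous_on A f \<Longrightarrow> continuous_on A (\<lambda>t. cis (f t))"
  unfolding cis_conv_exp by (intro continuous_intros)

lemma measurable_cis [measurable]: "cis \<in> borel_measurable borel"
  by (intro borel_measurable_continuous_onI continuous_intros)

lemma measurable_trig_exp [measurable]: "trig_exp m \<in> borel_measurable borel"
  unfolding trig_exp_def by measurable

lemma trig_exp_L2:
  assumes "finite_measure M" "sets M = sets leb_band"
  shows "trig_exp m \<in> L2_fun M"
  by (rule finite_measure.L2_fun_bounded[OF assms(1), where K = 1])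
    (auto simp: measurable_cong_sets[OF assms(2) refl])

lemma trig_exp_leb_band [simp]: "trig_exp m \<in> L2_fun leb_band"
  by (rule trig_exp_L2[OF finite_measure_leb_band refl])

lemma trig_polysI: "finite F \<Longrightarrow> (\<lambda>t. \<Sum>m\<in>F. b m * trig_exp m t) \<in> trig_polys"
  unfolding trig_polys_def by blast

lemma trig_polysE:
  assumes "p \<in> trig_polys"
  obtains F b where "finite F" "p = (\<lambda>t. \<Sum>m\<in>F. b m * trig_exp m t)"
  using assms unfolding trig_polys_def by blast

lemma trig_polys_exp: "(\<lambda>t. c * trig_exp m t) \<in> trig_polys"
  using trig_polysI[of "{m}" "\<lambda>_. c"] by simp

lemma trig_polys_const: "(\<lambda>t. c) \<in> trig_polys"
  using trig_polys_exp[of c 0] by (simp add: trig_exp_def)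

lemma trig_polys_add:
  assumes "p \<in> trig_polys" "q \<in> trig_polys"
  shows "(\<lambda>t. p t + q t) \<in> trig_polys"
proof -
  obtain F b where F: "finite F" "p = (\<lambda>t. \<Sum>m\<in>F. b m * trig_exp m t)" by (rule trig_polysE[OF assms(1)])
  obtain G c where G: "finite G" "q = (\<lambda>t. \<Sum>m\<in>G. c m * trig_exp m t)" by (rule trig_polysE[OF assms(2)])
  have "(\<lambda>t. p t + q t) = (\<lambda>t. \<Sum>m\<in>F \<union> G. ((if m \<in> F then b m else 0) + (if m \<in> G then c m else 0)) * trig_exp m t)"
  proof
    fix t
    have "(\<Sum>m\<in>F \<union> G. (if m \<in> F then b m else 0) * trig_exp m t) = p t"
      unfolding F(2) using F(1) G(1) by (intro sum.mono_neutral_cong_right) auto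
    moreover have "(\<Sum>m\<in>F \<union> G. (if m \<in> G then c m else 0) * trig_exp m t) = q t"
      unfolding G(2) using F(1) G(1) by (intro sum.mono_neutral_cong_right) auto
    ultimately show "p t + q t = (\<Sum>m\<in>F \<union> G. ((if m \<in> F then b m else 0) + (if m \<in> G then c m else 0)) * trig_exp m t)"
      by (simp add: distrib_right sum.distrib)
  qed
  then show ?thesis using trig_polysI[of "F \<union> G"] F G by auto
qed

lemma trig_polys_sum:
  "(\<And>i. i \<in> I \<Longrightarrow> p i \<in> trig_polys) \<Longrightarrow> (\<lambda>t. \<Sum>i\<in>I. p i t) \<in> trig_polys"
  by (induction I rule: infinite_finite_induct) (auto intro: trig_polys_const trig_polys_add)

lemma trig_polys_mult:
  assumes "p \<in> trig_polys" "q \<in> trig_polys"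
  shows "(\<lambda>t. p t * q t) \<in> trig_polys"
proof -
  obtain F b where F: "finite F" "p = (\<lambda>t. \<Sum>m\<in>F. b m * trig_exp m t)" by (rule trig_polysE[OF assms(1)])
  obtain G c where G: "finite G" "q = (\<lambda>t. \<Sum>m\<in>G. c m * trig_exp m t)" by (rule trig_polysE[OF assms(2)])
  have "(\<lambda>t. p t * q t) = (\<lambda>t. \<Sum>m\<in>F. \<Sum>n\<in>G. (b m * c n) * trig_exp (m + n) t)"
    unfolding F G sum_product by (intro ext sum.cong refl) (simp add: trig_exp_mult[symmetric])
  then show ?thesis by (simp add: trig_polys_sum trig_polys_exp)
qed

lemma trig_polys_cmult: "p \<in> trig_polys \<Longrightarrow> (\<lambda>t. c * p t) \<in> trig_polys"
  by (rule trig_polys_mult[OF trig_polys_const])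

lemma trig_polys_L2:
  assumes "finite_measure M" "sets M = sets leb_band" "p \<in> trig_polys"
  shows "p \<in> L2_fun M"
  using assms(3) by (elim trig_polysE) (auto intro!: L2_fun_sum L2_fun_cmult trig_exp_L2 assms(1,2))

text \<open>
  On the unit circle the coordinates are the cosine and the sine, which are trigonometric
  polynomials. This is how the Stone-Weierstrass theorem in the plane provides trigonometric
  approximations.
\<close>

lemma trig_polys_real_polynomial:
  assumes "real_polynomial_function r"
  shows "(\<lambda>t. complex_of_real (r (cis t))) \<in> trig_polys"
  using assms
proof induction
  case (linear h)
  interpret h: bounded_linear h by fact
  have h: "h z = Re z * h 1 + Im z * h \<i>" for z
  proof -
    have "z = Re z *\<^sub>R 1 + Im z *\<^sub>R \<i>" by (simp add: complex_eq_iff)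
    then have "h z = h (Re z *\<^sub>R 1 + Im z *\<^sub>R \<i>)" by simp
    then show ?thesis by (simp only: h.add h.scaleR real_scaleR_def)
  qed
  have "complex_of_real (h (cis t))
      = (h 1 / 2 + h \<i> / (2 * \<i>)) * trig_exp 1 t + (h 1 / 2 - h \<i> / (2 * \<i>)) * trig_exp (-1) t" for t
    by (subst h) (simp add: complex_eq_iff trig_exp_def field_simps)
  then show ?case by (simp add: trig_polys_add trig_polys_exp)
next
  case (const c)
  then show ?case by (rule trig_polys_const)
next
  case (add f g)
  then show ?case using trig_polys_add by fastforce
next
  case (mult f g)
  then show ?case using trig_polys_mult by fastforce
qed

section \<open>Density of the trigonometric polynomials\<close>

definition L2_closure :: "'a measure \<Rightarrow> ('a \<Rightarrow> complex) set \<Rightarrow> ('a \<Rightarrow> complex) set" where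
  "L2_closure M S = {X \<in> L2_fun M. \<forall>e>0. \<exists>Y\<in>S. L2_norm M (\<lambda>x. Y x - X x) < e}"

lemma L2_closure_seq:
  assumes "S \<subseteq> L2_fun M" "X \<in> L2_closure M S"
  obtains Ys where "\<And>n. Ys n \<in> S" "L2_tendsto M Ys X"
proof -
  have "\<forall>n. \<exists>Y\<in>S. L2_norm M (\<lambda>x. Y x - X x) < 1 / real (Suc n)"
    using assms(2) unfolding L2_closure_def by auto
  then obtain Ys where Ys: "\<And>n. Ys n \<in> S" "\<And>n. L2_norm M (\<lambda>x. Ys n x - X x) < 1 / real (Suc n)" by metis
  have "L2_tendsto M Ys X"
    by (rule L2_tendstoI_bound[where r = "\<lambda>n. 1 / real (Suc n)"])
      (use assms Ys LIMSEQ_Suc[OF lim_1_over_n] in \<open>auto simp: L2_closure_def less_imp_le\<close>)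
  with Ys(1) show ?thesis by (rule that)
qed

lemma L2_closure_limit:
  assumes "S \<subseteq> L2_fun M" "\<And>n. Xs n \<in> L2_closure M S" "L2_tendsto M Xs X"
  shows "X \<in> L2_closure M S"
  unfolding L2_closure_def
proof (intro CollectI conjI allI impI)
  show "X \<in> L2_fun M" by (rule L2_tendsto_lim_fun[OF assms(3)])
  fix e :: real assume "0 < e"
  then have "eventually (\<lambda>n. L2_norm M (\<lambda>x. Xs n x - X x) < e / 2) sequentially"
    by (intro order_tendstoD(2)[OF L2_tendsto_norm[OF assms(3)]]) simp
  then obtain n where n: "L2_norm M (\<lambda>x. Xs n x - X x) < e / 2"
    by (auto simp: eventually_sequentially)
  obtain Y where Y: "Y \<in> S" "L2_norm M (\<lambda>x. Y x - Xs n x) < e / 2"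
    using assms(2)[of n] \<open>0 < e\<close> unfolding L2_closure_def by (auto dest: spec[of _ "e / 2"])
  have "L2_norm M (\<lambda>x. Y x - X x) \<le> L2_norm M (\<lambda>x. Y x - Xs n x) + L2_norm M (\<lambda>x. Xs n x - X x)"
    by (rule L2_norm_triangle_diff) (use assms Y in \<open>auto simp: L2_tendsto_def\<close>)
  with n Y show "\<exists>Y\<in>S. L2_norm M (\<lambda>x. Y x - X x) < e" by (intro bexI[of _ Y]) auto
qed

lemma L2_closure_base: "X \<in> S \<Longrightarrow> X \<in> L2_fun M \<Longrightarrow> X \<in> L2_closure M S"
  unfolding L2_closure_def by (auto intro!: bexI[of _ X])

lemma L2_closure_iff_seq:
  assumes "S \<subseteq> L2_fun M"
  shows "X \<in> L2_closure M S \<longleftrightarrow> (\<exists>Ys. (\<forall>n. Ys n \<in> S) \<and> L2_tendsto M Ys X)"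
proof
  assume "X \<in> L2_closure M S"
  then show "\<exists>Ys. (\<forall>n. Ys n \<in> S) \<and> L2_tendsto M Ys X"
    using L2_closure_seq[OF assms] by metis
next
  assume "\<exists>Ys. (\<forall>n. Ys n \<in> S) \<and> L2_tendsto M Ys X"
  then show "X \<in> L2_closure M S"
    using L2_closure_limit[OF assms] L2_closure_base[of _ S M] assms by blast
qed

lemma L2_closure_add:
  assumes S: "S \<subseteq> L2_fun M" and closed: "\<And>X Y. X \<in> S \<Longrightarrow> Y \<in> S \<Longrightarrow> (\<lambda>x. X x + Y x) \<in> S"
    and XY: "X \<in> L2_closure M S" "Y \<in> L2_closure M S"
  shows "(\<lambda>x. X x + Y x) \<in> L2_closure M S"
proof -
  obtain Xs Ys where "\<And>n. Xs n \<in> S" "L2_tendsto M Xs X" "\<And>n. Ys n \<in> S" "L2_tendsto M Ys Y"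
    by (metis L2_closure_seq[OF S] XY)
  then show ?thesis
    unfolding L2_closure_iff_seq[OF S]
    by (intro exI[of _ "\<lambda>n x. Xs n x + Ys n x"]) (auto intro: closed L2_tendsto_add)
qed

text \<open>
  The continuous functions \<open>max 0 (1 - n * dist(z, K))\<close> tend to the indicator of
  \<open>K\<close> and stay bounded; replacing each by a polynomial that is within \<open>1 / (n
  + 1)\<close> of it on the circle changes neither property.
\<close>

lemma trig_polys_dense_closed:
  fixes \<nu> :: "real measure" and K :: "complex set"
  assumes fin: "finite_measure \<nu>" and sets: "sets \<nu> = sets leb_band" and K: "closed K"
  shows "(\<lambda>t. indicator K (cis t)) \<in> L2_closure \<nu> trig_polys"
proof (cases "K = {}")
  case True
  then show ?thesis using trig_polys_const[of 0] by (auto intro: L2_closure_base)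
next
  case False
  interpret finite_measure \<nu> by fact
  define U where "U n z = max 0 (1 - real n * infdist z K)" for n and z :: complex
  have "\<forall>n. \<exists>r. real_polynomial_function r \<and> (\<forall>z\<in>sphere 0 1. \<bar>U n z - r z\<bar> < 1 / real (Suc n))"
  proof
    fix n
    have "continuous_on (sphere 0 1) (U n)" unfolding U_def by (intro continuous_intros)
    then show "\<exists>r. real_polynomial_function r \<and> (\<forall>z\<in>sphere 0 1. \<bar>U n z - r z\<bar> < 1 / real (Suc n))"
      using Stone_Weierstrass_real_polynomial_function[of "sphere 0 1" "U n" "1 / real (Suc n)"] by (metis compact_sphere of_nat_0_less_iff zero_less_Suc zero_less_divide_1_iff)
  qed
  then obtain r where r: "\<And>n. real_polynomial_function (r n)"
    "\<And>n z. z \<in> sphere 0 1 \<Longrightarrow> \<bar>U n z - r n z\<bar> < 1 / real (Suc n)" by metis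
  have r': "\<bar>U n (cis t) - r n (cis t)\<bar> < 1 / real (Suc n)" for n t by (intro r) simp
  have U01: "0 \<le> U n z" "U n z \<le> 1" for n z unfolding U_def by (auto simp: infdist_nonneg)
  define p where "p n t = complex_of_real (r n (cis t))" for n t
  have p: "p n \<in> trig_polys" for n unfolding p_def by (rule trig_polys_real_polynomial[OF r(1)])
  have K_meas: "(\<lambda>t. indicator K (cis t) :: complex) \<in> borel_measurable \<nu>"
    unfolding measurable_cong_sets[OF sets refl] 
    using measurable_compose[OF measurable_cis borel_measurable_indicator[of K]] K
    by (intro measurable_leb_band) (simp add: borel_closed)
  have Ulim: "(\<lambda>n. U n z) \<longlonglongrightarrow> indicator K z" for z
  proof (cases "z \<in> K")
    case True
    then show ?thesis by (simp add: U_def)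
  next
    case z: False
    then have pos: "0 < infdist z K" by (intro infdist_pos_not_in_closed K False)
    obtain N where N: "1 / infdist z K < real N" using reals_Archimedean2 by blast
    have "U n z = 0" if "N \<le> n" for n
    proof -
      have "1 < real N * infdist z K" using N pos by (simp add: field_simps)
      also have "\<dots> \<le> real n * infdist z K" using that pos by (intro mult_right_mono) auto
      finally show ?thesis by (simp add: U_def)
    qed
    then have "eventually (\<lambda>n. U n z = 0) sequentially" by (auto simp: eventually_sequentially)
    then show ?thesis using z by (simp add: tendsto_eventually)
  qed
  have lim: "(\<lambda>n. p n t) \<longlonglongrightarrow> indicator K (cis t)" for t
  proof -
    have "(\<lambda>n. U n (cis t) - (U n (cis t) - r n (cis t))) \<longlonglongrightarrow> indicator K (cis t) - 0"
    proof (intro tendsto_diff Ulim)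
      show "(\<lambda>n. U n (cis t) - r n (cis t)) \<longlonglongrightarrow> 0"
        by (rule Lim_null_comparison[OF _ LIMSEQ_Suc[OF lim_1_over_n]])
          (use r' in \<open>auto intro!: always_eventually simp: less_imp_le simp del: of_nat_Suc\<close>)
    qed
    then have "(\<lambda>n. complex_of_real (r n (cis t))) \<longlonglongrightarrow> complex_of_real (indicator K (cis t))"
      by (intro tendsto_of_real) simp
    then show ?thesis unfolding p_def by (cases "cis t \<in> K") auto
  qed
  have bd: "cmod (p n t) \<le> 2" for n t
  proof -
    have "1 / real (Suc n) \<le> 1" by simp
    then have "\<bar>r n (cis t)\<bar> \<le> 2" using r'[of n t] U01[of n "cis t"] by linarith
    then show ?thesis by (simp add: p_def)
  qed
  have "L2_tendsto \<nu> p (\<lambda>t. indicator K (cis t))"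
    by (rule L2_tendsto_bounded_pointwise[where K = 2])
      (use bd lim K_meas trig_polys_L2[OF fin sets p, THEN L2_fun_measurable] in auto)
  then show ?thesis
    by (subst L2_closure_iff_seq) (use p trig_polys_L2[OF fin sets] in auto)
qed

text \<open>
  The Borel sets with this property are closed under complements and countable disjoint unions,
  and they contain the closed sets, which are stable under intersection and generate the Borel
  sets.
\<close>

lemma trig_polys_dense_borel:
  fixes \<nu> :: "real measure" and E :: "complex set"
  assumes fin: "finite_measure \<nu>" and sets: "sets \<nu> = sets leb_band" and E: "E \<in> sets borel"
  shows "(\<lambda>t. indicator E (cis t)) \<in> L2_closure \<nu> trig_polys"
proof -
  interpret finite_measure \<nu> by fact
  have tp: "trig_polys \<subseteq> L2_fun \<nu>" using trig_polys_L2[OF fin sets] by auto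
  have add: "(\<lambda>t. X t + Y t) \<in> L2_closure \<nu> trig_polys"
    if "X \<in> L2_closure \<nu> trig_polys" "Y \<in> L2_closure \<nu> trig_polys" for X Y
    by (rule L2_closure_add[OF tp _ that]) (rule trig_polys_add)
  have meas: "(\<lambda>t. indicator A (cis t) :: complex) \<in> borel_measurable \<nu>" if "A \<in> sets borel" for A :: "complex set"
    unfolding measurable_cong_sets[OF sets refl]
    using measurable_compose[OF measurable_cis borel_measurable_indicator[OF that]] by (intro measurable_leb_band) simp
  have neg: "(\<lambda>t. - X t) \<in> L2_closure \<nu> trig_polys" if X: "X \<in> L2_closure \<nu> trig_polys" for X
  proof -
    obtain Xs where "\<And>n. Xs n \<in> trig_polys" "L2_tendsto \<nu> Xs X" using L2_closure_seq[OF tp X] by metis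
    then show ?thesis unfolding L2_closure_iff_seq[OF tp]
      using L2_tendsto_cmult[of \<nu> Xs X "-1"] trig_polys_cmult[of "Xs _" "-1"]
      by (intro exI[of _ "\<lambda>n x. - Xs n x"]) auto
  qed
  have stable: "Int_stable (Collect (closed :: complex set \<Rightarrow> bool))" by (auto simp: Int_stable_def)
  have sub: "Collect (closed :: complex set \<Rightarrow> bool) \<subseteq> Pow UNIV" by simp
  have "E \<in> sigma_sets UNIV (Collect closed)"
    using E by (simp add: borel_eq_closed)
  from stable sub this show ?thesis
  proof (induction rule: sigma_sets_induct_disjoint)
    case (basic A)
    then show ?case by (intro trig_polys_dense_closed fin sets) simp
  next
    case empty
    then show ?case using trig_polys_const[of 0] by (auto intro: L2_closure_base)
  next
    case (compl A)
    have "(\<lambda>t. 1 + - indicator A (cis t)) \<in> L2_closure \<nu> trig_polys"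
      using trig_polys_const[of 1] tp by (intro add neg compl) (auto intro: L2_closure_base)
    moreover have "(\<lambda>t. 1 + - indicator A (cis t)) = (\<lambda>t. indicator (UNIV - A) (cis t) :: complex)"
      by (auto simp: indicator_def)
    ultimately show ?case by simp
  next
    case (union A)
    have A: "A i \<in> sets borel" for i using union(2) by (auto simp: borel_eq_closed)
    have ind: "(\<Sum>i<n. indicator (A i) z) = (indicator (\<Union>i<n. A i) z :: complex)" for n z
      using disjoint_family_on_mono[OF subset_UNIV union(1)]
      by (intro indicator_UN_disjoint[symmetric] finite_lessThan)
    have sum: "(\<lambda>t. \<Sum>i<n. indicator (A i) (cis t)) \<in> L2_closure \<nu> trig_polys" for n
    proof (induction n)
      case 0
      then show ?case using trig_polys_const[of 0] by (auto intro: L2_closure_base)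
    next
      case (Suc n)
      then show ?case using add[OF Suc union(3)[of n]] by simp
    qed
    have "L2_tendsto \<nu> (\<lambda>n t. \<Sum>i<n. indicator (A i) (cis t)) (\<lambda>t. indicator (\<Union>i. A i) (cis t))"
    proof (rule L2_tendsto_bounded_pointwise[where K = 1])
      show "AE t in \<nu>. (\<lambda>n. \<Sum>i<n. indicator (A i) (cis t)) \<longlonglongrightarrow> (indicator (\<Union>i. A i) (cis t) :: complex)"
        unfolding ind by (intro AE_I2 LIMSEQ_indicator_UN)
      show "AE t in \<nu>. cmod (\<Sum>i<n. indicator (A i) (cis t)) \<le> 1" for n
        unfolding ind by (auto simp: indicator_def)
    next
      fix n
      show "(\<lambda>t. \<Sum>i<n. indicator (A i) (cis t) :: complex) \<in> borel_measurable \<nu>"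
        by (intro borel_measurable_sum meas A)
    qed (intro meas sets.countable_UN, use A in auto)
    then show ?case by (rule L2_closure_limit[OF tp sum])
  qed
qed

text \<open>
  The inverse of \<open>cis\<close> on the half-open band. The point \<open>-1\<close> belongs
  to the left end of the band, and the argument of \<open>arccos\<close> is clamped to its
  domain, so that the function is Borel on the whole plane.
\<close>

definition band_angle :: "complex \<Rightarrow> real" where
  "band_angle z = (if Im z < 0 \<or> z = -1 then - arccos (max (-1) (min 1 (Re z))) else arccos (max (-1) (min 1 (Re z))))"

lemma band_angle_cis:
  assumes "t \<in> {-pi..<pi}"
  shows "band_angle (cis t) = t"
proof -
  have m: "max (-1) (min 1 (cos t)) = cos t" by simp
  consider "t = -pi" | "-pi < t" "t < 0" | "0 \<le> t" using assms by fastforce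
  then show ?thesis
  proof cases
    case 1
    then show ?thesis by (simp add: band_angle_def cis.ctr complex_eq_iff)
  next
    case 2
    then have "sin t < 0" using sin_gt_zero[of "-t"] by simp
    moreover have "arccos (cos t) = - t" using arccos_cos[of "-t"] 2 by simp
    ultimately show ?thesis by (simp add: band_angle_def m)
  next
    case 3
    then have "0 \<le> sin t" "cis t \<noteq> -1"
    proof -
      show "0 \<le> sin t" using 3 assms by (intro sin_ge_zero) auto
      show "cis t \<noteq> -1"
      proof
        assume "cis t = -1"
        then have "cos t = -1" by (simp add: complex_eq_iff)
        then have "arccos (cos t) = pi" by simp
        then show False using arccos_cos[of t] 3 assms by simp
      qed
    qed
    moreover have "arccos (cos t) = t" using arccos_cos[of t] 3 assms by simp
    ultimately show ?thesis by (simp add: band_angle_def m)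
  qed
qed

lemma measurable_band_angle [measurable]: "band_angle \<in> borel_measurable borel"
proof -
  have [measurable]: "(\<lambda>z. arccos (max (-1) (min 1 (Re z)))) \<in> borel_measurable borel"
    by (intro borel_measurable_continuous_onI continuous_on_arccos continuous_intros) auto
  have "{z. Im z < 0 \<or> z = -1} = {z. Im z < 0} \<union> {-1}" by auto
  then have "{z. Im z < 0 \<or> z = -1} \<in> sets borel"
    using open_halfspace_Im_lt[of 0] by auto
  then have [measurable]: "Measurable.pred borel (\<lambda>z. Im z < 0 \<or> z = -1)" by (simp add: pred_def)
  show ?thesis unfolding band_angle_def by measurable
qed

text \<open>
  A Borel subset \<open>E\<close> of the band is the preimage under \<open>cis\<close> of the
  Borel set \<open>band_angle -` E\<close> of the plane. The measure is arbitrary so that it can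
  be \<open>\<bar>D\<bar> dt\<close> for a merely integrable \<open>D\<close>.
\<close>

proposition trig_polys_dense_indicator:
  assumes fin: "finite_measure \<nu>" and sets: "sets \<nu> = sets leb_band" and E: "E \<in> sets leb_band"
  obtains ps where "\<And>n. ps n \<in> trig_polys" "L2_tendsto \<nu> ps (\<lambda>t. indicator E t)"
proof -
  interpret finite_measure \<nu> by fact
  have E': "E \<subseteq> {-pi..<pi}" "E \<in> sets borel" using E by (auto simp: sets_leb_band)
  have vm: "band_angle -` E \<in> sets borel"
    using measurable_sets[OF measurable_band_angle E'(2)] by simp
  have tp: "trig_polys \<subseteq> L2_fun \<nu>" using trig_polys_L2[OF fin sets] by auto
  obtain ps where ps: "\<And>n. ps n \<in> trig_polys" "L2_tendsto \<nu> ps (\<lambda>t. indicator (band_angle -` E) (cis t))"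
    using L2_closure_seq[OF tp trig_polys_dense_borel[OF fin sets vm]] by metis
  have "L2_tendsto \<nu> ps (\<lambda>t. indicator E t)"
  proof (rule L2_tendsto_cong_AE[OF ps(2)])
    show "(\<lambda>t. indicator E t :: complex) \<in> borel_measurable \<nu>"
      unfolding measurable_cong_sets[OF sets refl] using E by measurable
    have "space \<nu> = {-pi..<pi}" using sets_eq_imp_space_eq[OF sets] by simp
    then show "AE t in \<nu>. indicator (band_angle -` E) (cis t) = (indicator E t :: complex)"
      by (intro AE_I2) (simp add: indicator_def band_angle_cis)
  qed
  with ps(1) show ?thesis by (rule that)
qed

section \<open>Fourier uniqueness and bounds on weights\<close>

text \<open>
  Writing \<open>D = sgn D * \<bar>D\<bar>\<close> turns an integral against \<open>D\<close>
  into an inner product in \<open>L\<^sub>2\<close> of \<open>\<bar>D\<bar> dt\<close> with the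
  bounded multiplier \<open>sgn D\<close>. In this form it is continuous along the
  approximations just obtained, although \<open>D\<close> is only integrable.
\<close>

lemma polar_density:
  fixes D :: "real \<Rightarrow> complex"
  assumes D: "integrable leb_band D"
  defines "\<nu> \<equiv> density leb_band (\<lambda>t. ennreal (cmod (D t)))"
  shows "finite_measure \<nu>" "sets \<nu> = sets leb_band"
    "\<And>X Y. X \<in> L2_fun \<nu> \<Longrightarrow> Y \<in> L2_fun \<nu> \<Longrightarrow> L2_inner \<nu> (\<lambda>t. sgn (D t) * X t) Y = (LINT t|leb_band. D t * X t * cnj (Y t))"
    "(\<lambda>t. sgn (D t)) \<in> borel_measurable \<nu>" "\<And>t. cmod (sgn (D t)) \<le> 1"
proof -
  have [measurable]: "D \<in> borel_measurable leb_band" using D by (rule borel_measurable_integrable)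
  show sets: "sets \<nu> = sets leb_band" by (simp add: \<nu>_def)
  have "emeasure \<nu> (space \<nu>) = (\<integral>\<^sup>+t. ennreal (cmod (D t)) \<partial>leb_band)"
    unfolding \<nu>_def using sets.top[of leb_band]
    by (subst emeasure_density) (auto intro!: nn_integral_cong simp: indicator_def)
  also have "\<dots> < \<infinity>" using D by (simp add: integrable_iff_bounded)
  finally show "finite_measure \<nu>" by (intro finite_measureI) auto
  have [measurable]: "(\<lambda>t. sgn (D t)) \<in> borel_measurable leb_band" unfolding sgn_div_norm by measurable
  then show "(\<lambda>t. sgn (D t)) \<in> borel_measurable \<nu>" by (simp add: \<nu>_def)
  show "cmod (sgn (D t)) \<le> 1" for t by (simp add: norm_sgn)
  fix X Y assume "X \<in> L2_fun \<nu>" "Y \<in> L2_fun \<nu>"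
  then have [measurable]: "X \<in> borel_measurable leb_band" "Y \<in> borel_measurable leb_band"
    by (auto dest!: L2_fun_measurable simp: \<nu>_def)
  have "L2_inner \<nu> (\<lambda>t. sgn (D t) * X t) Y = (LINT t|leb_band. cmod (D t) *\<^sub>R (sgn (D t) * X t * cnj (Y t)))"
    unfolding L2_inner_def \<nu>_def by (rule integral_density) auto
  also have "\<dots> = (LINT t|leb_band. D t * X t * cnj (Y t))"
  proof -
    have "cmod z *\<^sub>R (sgn z * x * y) = z * x * y" for z x y :: complex
      by (cases "z = 0") (auto simp: sgn_div_norm)
    then show ?thesis by simp
  qed
  finally show "L2_inner \<nu> (\<lambda>t. sgn (D t) * X t) Y = (LINT t|leb_band. D t * X t * cnj (Y t))" .
qed

text \<open>
  The integral of \<open>D\<close> against every trigonometric polynomial vanishes, and by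
  approximation so does its integral over every measurable set.
\<close>

theorem fourier_uniqueness:
  fixes D :: "real \<Rightarrow> complex"
  assumes D: "integrable leb_band D"
    and zero: "\<And>m. (LINT t|leb_band. D t * trig_exp m t) = 0"
  shows "AE t in leb_band. D t = 0"
proof (rule leb_band.density_zero[OF D])
  fix E assume E: "E \<in> sets leb_band"
  define \<nu> where "\<nu> = density leb_band (\<lambda>t. ennreal (cmod (D t)))"
  note \<nu> = polar_density[OF D, folded \<nu>_def]
  interpret \<nu>: finite_measure \<nu> by (rule \<nu>)
  obtain ps where ps: "\<And>n. ps n \<in> trig_polys" "L2_tendsto \<nu> ps (\<lambda>t. indicator E t)"
    using trig_polys_dense_indicator[OF \<nu>(1,2) E] by metis
  have one: "(\<lambda>t. 1) \<in> L2_fun \<nu>" by (rule \<nu>.L2_fun_bounded[where K = 1]) auto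
  have int: "integrable leb_band (\<lambda>t. D t * (b * trig_exp m t))" for b m
    by (rule Bochner_Integration.integrable_bound[OF integrable_mult_right[OF integrable_norm[OF D], of "cmod b"]])
      (use D in \<open>auto simp: norm_mult intro!: borel_measurable_times\<close>)
  have "L2_inner \<nu> (\<lambda>t. sgn (D t) * ps n t) (\<lambda>t. 1) = 0" for n
  proof -
    obtain F b where F: "finite F" "ps n = (\<lambda>t. \<Sum>m\<in>F. b m * trig_exp m t)" by (rule trig_polysE[OF ps(1)])
    have "L2_inner \<nu> (\<lambda>t. sgn (D t) * ps n t) (\<lambda>t. 1) = (LINT t|leb_band. D t * ps n t)"
      using \<nu>(3)[OF L2_tendsto_fun[OF ps(2), of n] one] by simp
    also have "\<dots> = (\<Sum>m\<in>F. LINT t|leb_band. D t * (b m * trig_exp m t))"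
      unfolding F(2) sum_distrib_left by (rule Bochner_Integration.integral_sum) (rule int)
    also have "\<dots> = 0"
    proof (intro sum.neutral ballI)
      fix m
      have "(LINT t|leb_band. D t * (b m * trig_exp m t)) = (LINT t|leb_band. b m * (D t * trig_exp m t))"
        by (simp add: ac_simps)
      then show "(LINT t|leb_band. D t * (b m * trig_exp m t)) = 0" by (simp add: zero)
    qed
    finally show ?thesis .
  qed
  moreover have "(\<lambda>n. L2_inner \<nu> (\<lambda>t. sgn (D t) * ps n t) (\<lambda>t. 1)) \<longlonglongrightarrow>
      L2_inner \<nu> (\<lambda>t. sgn (D t) * indicator E t) (\<lambda>t. 1)"
    using \<nu>(5) by (intro L2_inner_tendsto L2_tendsto_bounded_mult[OF ps(2) \<nu>(4)] L2_tendsto_const one) auto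
  ultimately have "L2_inner \<nu> (\<lambda>t. sgn (D t) * indicator E t) (\<lambda>t. 1) = 0"
    by (simp add: LIMSEQ_const_iff)
  then have "(LINT t|leb_band. D t * indicator E t) = 0"
    using \<nu>(3)[OF L2_tendsto_lim_fun[OF ps(2)] one] by simp
  moreover have "D t * indicator E t = indicator E t *\<^sub>R D t" for t by (simp add: indicator_def)
  ultimately show "set_lebesgue_integral leb_band E D = 0"
    unfolding set_lebesgue_integral_def by simp
qed

text \<open>
  Trigonometric polynomials approximating the indicator of \<open>{u < 0}\<close> show that the
  integral of \<open>u\<close> over this set is nonnegative, so the set is null. The lemma turns
  inequalities between quadratic forms into pointwise bounds on their weights.
\<close>

theorem trig_polys_weight_nonneg:
  fixes u :: "real \<Rightarrow> real"
  assumes u: "integrable leb_band u"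
    and nonneg: "\<And>p. p \<in> trig_polys \<Longrightarrow> 0 \<le> (LINT t|leb_band. u t * (cmod (p t))\<^sup>2)"
  shows "AE t in leb_band. 0 \<le> u t"
proof -
  have [measurable]: "u \<in> borel_measurable leb_band" using u by (rule borel_measurable_integrable)
  define D where "D t = complex_of_real (u t)" for t
  have D: "integrable leb_band D" unfolding D_def using u by simp
  define \<nu> where "\<nu> = density leb_band (\<lambda>t. ennreal (cmod (D t)))"
  note \<nu> = polar_density[OF D, folded \<nu>_def]
  define E where "E = {t \<in> space leb_band. u t < 0}"
  have E: "E \<in> sets leb_band" unfolding E_def by measurable
  obtain ps where ps: "\<And>n. ps n \<in> trig_polys" "L2_tendsto \<nu> ps (\<lambda>t. indicator E t)"
    using trig_polys_dense_indicator[OF \<nu>(1,2) E] by metis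
  have inner: "L2_inner \<nu> (\<lambda>t. sgn (D t) * X t) X = complex_of_real (LINT t|leb_band. u t * (cmod (X t))\<^sup>2)"
    if "X \<in> L2_fun \<nu>" for X
  proof -
    have "L2_inner \<nu> (\<lambda>t. sgn (D t) * X t) X = (LINT t|leb_band. D t * X t * cnj (X t))"
      by (rule \<nu>(3)[OF that that])
    also have "\<dots> = (LINT t|leb_band. complex_of_real (u t * (cmod (X t))\<^sup>2))"
      by (simp add: D_def mult.assoc complex_norm_square[symmetric] del: of_real_power)
    finally show ?thesis unfolding integral_complex_of_real .
  qed
  have "(\<lambda>n. Re (L2_inner \<nu> (\<lambda>t. sgn (D t) * ps n t) (ps n))) \<longlonglongrightarrow>
      Re (L2_inner \<nu> (\<lambda>t. sgn (D t) * indicator E t) (\<lambda>t. indicator E t))"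
    using \<nu>(5) by (intro tendsto_Re L2_inner_tendsto L2_tendsto_bounded_mult[OF ps(2) \<nu>(4)] ps(2)) auto
  moreover have "0 \<le> Re (L2_inner \<nu> (\<lambda>t. sgn (D t) * ps n t) (ps n))" for n
    using nonneg[OF ps(1)[of n]] by (simp add: inner[OF L2_tendsto_fun[OF ps(2)]])
  ultimately have "0 \<le> Re (L2_inner \<nu> (\<lambda>t. sgn (D t) * indicator E t) (\<lambda>t. indicator E t))"
    by (intro LIMSEQ_le_const) auto
  then have "0 \<le> (LINT t|leb_band. u t * (cmod (indicator E t))\<^sup>2)"
    unfolding inner[OF L2_tendsto_lim_fun[OF ps(2)]] by simp
  also have "(\<lambda>t. u t * (cmod (indicator E t))\<^sup>2) = (\<lambda>t. u t * indicator E t)"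
    by (auto simp: indicator_def)
  finally have ge: "0 \<le> (LINT t|leb_band. u t * indicator E t)" .
  have int: "integrable leb_band (\<lambda>t. - (u t * indicator E t))"
    using integrable_real_mult_indicator[OF E u] by simp
  have nn: "AE t in leb_band. 0 \<le> - (u t * indicator E t)"
    by (auto simp: E_def indicator_def)
  have "(LINT t|leb_band. - (u t * indicator E t)) \<ge> 0" by (rule integral_nonneg_AE[OF nn])
  with ge have "(LINT t|leb_band. - (u t * indicator E t)) = 0" by simp
  then have "AE t in leb_band. - (u t * indicator E t) = 0"
    using integral_nonneg_eq_0_iff_AE[OF int nn] by simp
  then show ?thesis
  proof (rule AE_mp, intro AE_I2 impI)
    fix t assume "t \<in> space leb_band" "- (u t * indicator E t) = 0"
    then show "0 \<le> u t" unfolding E_def by (cases "u t < 0") auto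
  qed
qed

section \<open>Fourier series\<close>

lemma trig_exp_integral: "(LINT t|leb_band. trig_exp m t) = (if m = 0 then 2 * pi else 0)"
proof (cases "m = 0")
  case True
  then show ?thesis by (simp add: trig_exp_def scaleR_conv_of_real)
next
  case False
  define F where "F t = trig_exp m t / (\<i> * of_int m)" for t
  have deriv: "(F has_vector_derivative trig_exp m t) (at t within S)" for t S
  proof -
    have "((\<lambda>t. exp (\<i> * of_int m * complex_of_real t) / (\<i> * of_int m)) has_vector_derivative
        exp (\<i> * of_int m * complex_of_real t)) (at t within S)"
      using False by (auto intro!: derivative_eq_intros has_vector_derivative_real_field)
    then show ?thesis unfolding F_def trig_exp_def cis_conv_exp by (simp add: mult.assoc)
  qed
  have "(LINT t|leb_band. trig_exp m t) = (LINT t|lborel. indicator {-pi..pi} t *\<^sub>R trig_exp m t)"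
    unfolding set_integral_leb_band[symmetric] set_lebesgue_integral_def
  proof (rule integral_cong_AE)
    show "AE t in lborel. indicator {-pi..<pi} t *\<^sub>R trig_exp m t = indicator {-pi..pi} t *\<^sub>R trig_exp m t"
      using AE_lborel_singleton[of pi] by eventually_elim (auto simp: indicator_def)
  qed auto
  also have "\<dots> = F pi - F (-pi)"
    proof (rule integral_FTC_atLeastAtMost)
    show "continuous_on {-pi..pi} (trig_exp m)" unfolding trig_exp_def by (intro continuous_intros)
  qed (auto intro: deriv)
  also have "F pi = F (-pi)"
  proof -
    have "trig_exp m pi = trig_exp m (-pi)"
      unfolding trig_exp_def by (simp add: complex_eq_iff mult.commute)
    then show ?thesis by (simp add: F_def)
  qed
  finally show ?thesis using False by simp
qed

lemma trig_exp_inner: "L2_inner leb_band (trig_exp m) (trig_exp n) = (if m = n then 2 * pi else 0)"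
  unfolding L2_inner_def trig_exp_cnj trig_exp_mult trig_exp_integral by simp

definition fourier_coeff :: "(real \<Rightarrow> complex) \<Rightarrow> int \<Rightarrow> complex" where
  "fourier_coeff X m = L2_inner leb_band X (trig_exp m) / (2 * pi)"

abbreviation trig_sum :: "(nat \<Rightarrow> int) \<Rightarrow> (nat \<Rightarrow> complex) \<Rightarrow> nat \<Rightarrow> real \<Rightarrow> complex" where
  "trig_sum j x n t \<equiv> \<Sum>k<n. x k * trig_exp (j k) t"

lemma trig_L2_sums_iff:
  "trig_L2_sums j c C \<longleftrightarrow> L2_tendsto leb_band (trig_sum j c) C"
  by (simp add: trig_L2_sums_def trig_exp_def)

lemma trig_sum_L2 [simp]: "(\<lambda>t. \<Sum>k\<in>I. c k * trig_exp (j k) t) \<in> L2_fun leb_band"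
  by (intro L2_fun_sum L2_fun_cmult trig_exp_leb_band)

lemma trig_sum_inner:
  assumes X: "X \<in> L2_fun leb_band"
  shows "L2_inner leb_band X (\<lambda>t. \<Sum>k\<in>I. c k * trig_exp (j k) t)
    = 2 * pi * (\<Sum>k\<in>I. fourier_coeff X (j k) * cnj (c k))"
proof -
  have "L2_inner leb_band X (\<lambda>t. \<Sum>k\<in>I. c k * trig_exp (j k) t)
      = (\<Sum>k\<in>I. L2_inner leb_band X (\<lambda>t. c k * trig_exp (j k) t))"
    by (rule L2_inner_sum_right) (auto intro: X)
  then show ?thesis
    by (simp add: L2_inner_cmult_right sum_distrib_left fourier_coeff_def mult.commute)
qed

lemma fourier_coeff_trig_sum:
  assumes "inj_on j I" "finite I"
  shows "fourier_coeff (\<lambda>t. \<Sum>k\<in>I. c k * trig_exp (j k) t) m = (\<Sum>k\<in>I. if j k = m then c k else 0)"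
proof -
  have "L2_inner leb_band (\<lambda>t. \<Sum>k\<in>I. c k * trig_exp (j k) t) (trig_exp m)
     = (\<Sum>k\<in>I. c k * L2_inner leb_band (trig_exp (j k)) (trig_exp m))"
    by (subst L2_inner_sum_left) (auto simp: L2_inner_cmult_left)
  also have "\<dots> = (\<Sum>k\<in>I. 2 * pi * (if j k = m then c k else 0))"
    by (intro sum.cong) (auto simp: trig_exp_inner)
  also have "\<dots> = 2 * pi * (\<Sum>k\<in>I. (if j k = m then c k else 0))" by (simp only: sum_distrib_left)
  finally show ?thesis unfolding fourier_coeff_def by simp
qed

lemma trig_sum_norm:
  assumes "inj_on j I" "finite I"
  shows "(L2_norm leb_band (\<lambda>t. \<Sum>k\<in>I. c k * trig_exp (j k) t))\<^sup>2 = 2 * pi * (\<Sum>k\<in>I. (cmod (c k))\<^sup>2)"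
proof -
  let ?S = "\<lambda>t. \<Sum>k\<in>I. c k * trig_exp (j k) t"
  have "fourier_coeff ?S (j k) = c k" if "k \<in> I" for k
  proof -
    have "(\<Sum>i\<in>I. if j i = j k then c i else 0) = (\<Sum>i\<in>I. if i = k then c i else 0)"
      using assms(1) that by (intro sum.cong) (auto dest: inj_onD)
    then show ?thesis using that assms by (simp add: fourier_coeff_trig_sum)
  qed
  then have "L2_inner leb_band ?S ?S = 2 * pi * (\<Sum>k\<in>I. c k * cnj (c k))"
    by (subst trig_sum_inner) auto
  also have "\<dots> = complex_of_real (2 * pi * (\<Sum>k\<in>I. (cmod (c k))\<^sup>2))"
    by (simp add: complex_norm_square[symmetric])
  finally show ?thesis unfolding L2_inner_self using of_real_eq_iff by blast
qed

lemma trig_L2_sums_exists: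
  assumes j: "inj j" and c: "c \<in> l2"
  shows "\<exists>C. trig_L2_sums j c C"
  unfolding trig_L2_sums_iff
proof (rule L2_complete)
  fix e :: real assume e: "0 < e"
  have "summable (\<lambda>k. (cmod (c k))\<^sup>2)" using c by (simp add: l2_def)
  then obtain N where N: "\<And>m n. m \<ge> N \<Longrightarrow> norm (\<Sum>k=m..<n. (cmod (c k))\<^sup>2) < e\<^sup>2 / (2 * pi)"
    using summable_Cauchy[of "\<lambda>k. (cmod (c k))\<^sup>2"] e by (metis divide_pos_pos pi_gt_zero zero_less_mult_iff zero_less_numeral zero_less_power)
  define S where "S n t = trig_sum j c n t" for n t
  have le: "L2_norm leb_band (\<lambda>t. S n t - S m t) < e" if "N \<le> m" "m \<le> n" for m n
  proof -
    have "(\<lambda>t. S n t - S m t) = (\<lambda>t. \<Sum>k=m..<n. c k * trig_exp (j k) t)"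
      unfolding S_def using that by (intro ext) (simp add: sum_diff_nat_ivl[of 0 m n, unfolded atLeast0LessThan])
    then have "(L2_norm leb_band (\<lambda>t. S n t - S m t))\<^sup>2 = 2 * pi * (\<Sum>k=m..<n. (cmod (c k))\<^sup>2)"
      using trig_sum_norm[of j "{m..<n}" c] j by (simp add: inj_on_subset[OF j])
    also have "\<dots> < e\<^sup>2" using N[OF that(1), of n] by (simp add: field_simps sum_nonneg)
    finally show ?thesis using e by (simp add: power2_less_imp_less)
  qed
  show "\<exists>N. \<forall>m\<ge>N. \<forall>n\<ge>N. L2_norm leb_band (\<lambda>t. trig_sum j c m t - trig_sum j c n t) < e"
  proof (intro exI allI impI)
    fix m n assume mn: "N \<le> m" "N \<le> n"
    have "L2_norm leb_band (\<lambda>t. S m t - S n t) < e"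
      by (cases "m \<le> n") (use le[of m n] le[of n m] mn in \<open>auto simp: L2_norm_minus_commute[of _ "S m"]\<close>)
    then show "L2_norm leb_band (\<lambda>t. trig_sum j c m t - trig_sum j c n t) < e"
      by (simp add: S_def)
  qed
qed simp

lemma fourier_coeff_tendsto:
  assumes "L2_tendsto leb_band Xs X"
  shows "(\<lambda>n. fourier_coeff (Xs n) m) \<longlonglongrightarrow> fourier_coeff X m"
  unfolding fourier_coeff_def by (intro tendsto_divide L2_inner_tendsto assms L2_tendsto_const tendsto_const) auto

lemma trig_L2_sums_coeff:
  assumes C: "trig_L2_sums j c C" and j: "inj j"
  shows "fourier_coeff C (j k) = c k" and "m \<notin> range j \<Longrightarrow> fourier_coeff C m = 0"
proof -
  note lim = fourier_coeff_tendsto[OF C[unfolded trig_L2_sums_iff]]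
  have eq: "fourier_coeff (trig_sum j c n) m = (\<Sum>k<n. if j k = m then c k else 0)" for n m
    by (intro fourier_coeff_trig_sum) (auto intro: inj_on_subset[OF j])
  have "(\<lambda>n. fourier_coeff (trig_sum j c n) (j k)) \<longlonglongrightarrow> c k"
  proof (rule tendsto_eventually, unfold eventually_sequentially, intro exI allI impI)
    fix n assume "Suc k \<le> n"
    then show "fourier_coeff (trig_sum j c n) (j k) = c k"
      unfolding eq using j by (simp add: inj_eq)
  qed
  with lim[of "j k"] show "fourier_coeff C (j k) = c k" by (rule LIMSEQ_unique)
  assume "m \<notin> range j"
  then have "fourier_coeff (trig_sum j c n) m = 0" for n
    unfolding eq by (intro sum.neutral) auto
  with lim[of m] show "fourier_coeff C m = 0" by (simp add: LIMSEQ_const_iff)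
qed

lemma Bessel:
  assumes X: "X \<in> L2_fun leb_band" and j: "inj j"
  shows "(\<lambda>k. fourier_coeff X (j k)) \<in> l2"
    and "2 * pi * (l2_norm (\<lambda>k. fourier_coeff X (j k)))\<^sup>2 \<le> (L2_norm leb_band X)\<^sup>2"
proof -
  let ?c = "\<lambda>k. fourier_coeff X (j k)"
  have fin: "2 * pi * (\<Sum>k<n. (cmod (?c k))\<^sup>2) \<le> (L2_norm leb_band X)\<^sup>2" for n
  proof -
    let ?S = "trig_sum j ?c n"
    have "L2_inner leb_band X ?S = complex_of_real (2 * pi * (\<Sum>k<n. (cmod (?c k))\<^sup>2))"
      by (subst trig_sum_inner[OF X]) (simp add: complex_norm_square[symmetric])
    then have "Re (L2_inner leb_band X (\<lambda>t. - ?S t)) = - (2 * pi * (\<Sum>k<n. (cmod (?c k))\<^sup>2))"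
      using L2_inner_cmult_right[of leb_band X "-1" ?S] by simp
    moreover have "(L2_norm leb_band (\<lambda>t. - ?S t))\<^sup>2 = 2 * pi * (\<Sum>k<n. (cmod (?c k))\<^sup>2)"
    proof -
      have "L2_norm leb_band (\<lambda>t. - ?S t) = L2_norm leb_band ?S" by (simp add: L2_norm_def)
      then show ?thesis using trig_sum_norm[OF inj_on_subset[OF j subset_UNIV], of "{..<n}" ?c] by simp
    qed
    moreover have "0 \<le> (L2_norm leb_band (\<lambda>t. X t + - ?S t))\<^sup>2" by simp
    moreover have "(L2_norm leb_band (\<lambda>t. X t + - ?S t))\<^sup>2
       = (L2_norm leb_band X)\<^sup>2 + 2 * Re (L2_inner leb_band X (\<lambda>t. - ?S t)) + (L2_norm leb_band (\<lambda>t. - ?S t))\<^sup>2"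
      by (rule L2_norm_sq_add[OF X]) (use L2_fun_cmult[OF trig_sum_L2, of "-1"] in simp)
    ultimately show ?thesis by linarith
  qed
  have summ: "summable (\<lambda>k. (cmod (?c k))\<^sup>2)"
    by (rule summableI_nonneg_bounded[where x = "(L2_norm leb_band X)\<^sup>2 / (2 * pi)"])
      (use fin in \<open>auto simp: field_simps\<close>)
  then show l2: "?c \<in> l2" by (simp add: l2_def)
  have "(\<Sum>k. (cmod (?c k))\<^sup>2) \<le> (L2_norm leb_band X)\<^sup>2 / (2 * pi)"
    by (rule suminf_le_const[OF summ]) (use fin in \<open>auto simp: field_simps\<close>)
  then show "2 * pi * (l2_norm ?c)\<^sup>2 \<le> (L2_norm leb_band X)\<^sup>2"
    by (simp add: l2_norm_sq[OF l2] field_simps)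
qed

lemma leb_band_L2_integrable:
  assumes "X \<in> L2_fun leb_band"
  shows "integrable leb_band X"
  using integrable_mult_cnj[OF assms leb_band.L2_fun_bounded[of "\<lambda>t. 1" 1]] by simp

lemma fourier_coeff_unique:
  assumes X: "X \<in> L2_fun leb_band" and Y: "Y \<in> L2_fun leb_band"
    and eq: "\<And>m. fourier_coeff X m = fourier_coeff Y m"
  shows "AE t in leb_band. X t = Y t"
proof -
  have "AE t in leb_band. X t - Y t = 0"
  proof (rule fourier_uniqueness)
    show "integrable leb_band (\<lambda>t. X t - Y t)" using X Y by (intro leb_band_L2_integrable) auto
    show "(LINT t|leb_band. (X t - Y t) * trig_exp m t) = 0" for m
    proof -
      have "(LINT t|leb_band. (X t - Y t) * trig_exp m t) = L2_inner leb_band (\<lambda>t. X t - Y t) (trig_exp (-m))"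
        by (simp add: L2_inner_def trig_exp_cnj)
      also have "\<dots> = 0" using eq[of "-m"] by (simp add: L2_inner_diff_left X Y fourier_coeff_def)
      finally show ?thesis .
    qed
  qed
  then show ?thesis by simp
qed

text \<open>
  By Bessel's inequality the coefficients are square-summable, hence are the coefficients of
  some \<open>L\<^sub>2\<close> sum, which is \<open>X\<close> by uniqueness.
\<close>

theorem fourier_series:
  assumes X: "X \<in> L2_fun leb_band" and j: "inj j"
    and zero: "\<And>m. m \<notin> range j \<Longrightarrow> fourier_coeff X m = 0"
  shows "trig_L2_sums j (\<lambda>k. fourier_coeff X (j k)) X"
proof -
  obtain C where C: "trig_L2_sums j (\<lambda>k. fourier_coeff X (j k)) C"
    using trig_L2_sums_exists[OF j Bessel(1)[OF X j]] by blast
  note lim = C[unfolded trig_L2_sums_iff]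
  have "AE t in leb_band. C t = X t"
  proof (rule fourier_coeff_unique[OF L2_tendsto_lim_fun[OF lim] X])
    fix m show "fourier_coeff C m = fourier_coeff X m"
      using trig_L2_sums_coeff[OF C j] zero by (cases "m \<in> range j") auto
  qed
  then show ?thesis unfolding trig_L2_sums_iff
    by (intro L2_tendsto_cong_AE[OF lim] L2_fun_measurable[OF X])
qed

section \<open>Toeplitz operators\<close>

lemma l2_diff: "x \<in> l2 \<Longrightarrow> y \<in> l2 \<Longrightarrow> (\<lambda>k. x k - y k) \<in> l2"
  unfolding l2_eq_L2_fun by (rule L2_fun_diff)

lemma mat_app_summable: "l2_operator K \<Longrightarrow> x \<in> l2 \<Longrightarrow> summable (\<lambda>k. K l k * x k)"
  and mat_app_l2: "l2_operator K \<Longrightarrow> x \<in> l2 \<Longrightarrow> mat_app K x \<in> l2"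
  by (auto simp: l2_operator_def)

lemma mat_app_diff:
  assumes "l2_operator K" "x \<in> l2" "y \<in> l2"
  shows "mat_app K (\<lambda>k. x k - y k) = (\<lambda>l. mat_app K x l - mat_app K y l)"
proof
  show "mat_app K (\<lambda>k. x k - y k) l = mat_app K x l - mat_app K y l" for l
    unfolding mat_app_def
    using suminf_diff[OF mat_app_summable[OF assms(1,2)] mat_app_summable[OF assms(1,3)], of l l]
    by (simp add: right_diff_distrib)
qed

lemma mat_app_trunc: "mat_app K (seq_trunc n x) l = (\<Sum>k<n. K l k * x k)"
  unfolding mat_app_def by (rule suminf_seq_trunc) simp

lemma l2_inner_trunc: "l2_inner y (seq_trunc n x) = (\<Sum>k<n. y k * cnj (x k))"
  unfolding l2_inner_def by (rule suminf_seq_trunc) simp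

text \<open>
  Only finitely many rows of the matrix enter, so the two summations can be interchanged without
  knowing that the matrix is bounded.
\<close>

lemma hermitian_trunc_sym:
  assumes K: "l2_operator K" and herm: "\<And>l k. K k l = cnj (K l k)" and x: "x \<in> l2"
  shows "l2_inner (mat_app K x) (seq_trunc n y) = l2_inner x (mat_app K (seq_trunc n y))"
proof -
  have "l2_inner (mat_app K x) (seq_trunc n y) = (\<Sum>l<n. (\<Sum>k. K l k * x k) * cnj (y l))"
    unfolding l2_inner_trunc mat_app_def ..
  also have "\<dots> = (\<Sum>l<n. \<Sum>k. K l k * x k * cnj (y l))"
    by (intro sum.cong refl suminf_mult2 mat_app_summable[OF K x])
  also have "\<dots> = (\<Sum>k. \<Sum>l<n. K l k * x k * cnj (y l))"
    by (intro suminf_sum[symmetric] summable_mult2 mat_app_summable[OF K x])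
  also have "\<dots> = l2_inner x (mat_app K (seq_trunc n y))"
    unfolding l2_inner_def mat_app_trunc
  proof (rule arg_cong[where f = suminf], rule ext)
    fix k
    have "cnj (\<Sum>l<n. K k l * y l) = (\<Sum>l<n. K l k * cnj (y l))"
      by (simp add: herm[of k])
    then show "(\<Sum>l<n. K l k * x k * cnj (y l)) = x k * cnj (\<Sum>l<n. K k l * y l)"
      by (simp add: sum_distrib_left ac_simps)
  qed
  finally show ?thesis .
qed

lemma hermitian_bounded:
  assumes K: "l2_operator K" and herm: "\<And>l k. K k l = cnj (K l k)"
  shows "\<exists>B\<ge>0. \<forall>x\<in>l2. l2_norm (mat_app K x) \<le> B * l2_norm x"
  by (rule Hellinger_Toeplitz) (auto intro: mat_app_l2[OF K] hermitian_trunc_sym[OF K herm])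

lemma hermitian_sym:
  assumes K: "l2_operator K" and herm: "\<And>l k. K k l = cnj (K l k)"
    and x: "x \<in> l2" and y: "y \<in> l2"
  shows "l2_inner (mat_app K x) y = l2_inner x (mat_app K y)"
proof -
  let ?C = "count_space (UNIV :: nat set)"
  obtain B where B: "0 \<le> B" "\<And>x. x \<in> l2 \<Longrightarrow> l2_norm (mat_app K x) \<le> B * l2_norm x"
    using hermitian_bounded[OF K herm] by blast
  note trunc = seq_trunc_tendsto[OF y]
  have "L2_tendsto ?C (\<lambda>n. mat_app K (seq_trunc n y)) (mat_app K y)"
  proof (rule L2_tendstoI_bound)
    show "L2_norm ?C (\<lambda>k. mat_app K (seq_trunc n y) k - mat_app K y k) \<le> B * l2_norm (\<lambda>k. seq_trunc n y k - y k)" for n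
      using B(2)[OF l2_diff[OF seq_trunc_l2 y], of n y]
      by (simp add: mat_app_diff[OF K seq_trunc_l2 y])
    show "(\<lambda>n. B * l2_norm (\<lambda>k. seq_trunc n y k - y k)) \<longlonglongrightarrow> 0"
      using tendsto_mult_left[OF L2_tendsto_norm[OF trunc], of B] by simp
  qed (use mat_app_l2[OF K] y seq_trunc_l2 in \<open>auto simp: l2_eq_L2_fun[symmetric]\<close>)
  then have "(\<lambda>n. L2_inner ?C x (mat_app K (seq_trunc n y))) \<longlonglongrightarrow> L2_inner ?C x (mat_app K y)"
    using x by (intro L2_inner_tendsto L2_tendsto_const) (simp_all add: l2_eq_L2_fun)
  moreover have "(\<lambda>n. L2_inner ?C (mat_app K x) (seq_trunc n y)) \<longlonglongrightarrow> L2_inner ?C (mat_app K x) y"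
    using mat_app_l2[OF K x] by (intro L2_inner_tendsto L2_tendsto_const trunc) (simp_all add: l2_eq_L2_fun)
  moreover have "L2_inner ?C (mat_app K x) (seq_trunc n y) = L2_inner ?C x (mat_app K (seq_trunc n y))" for n
    using hermitian_trunc_sym[OF K herm x, of n y] x mat_app_l2[OF K] by (simp add: l2_inner_eq_L2_inner)
  ultimately have "L2_inner ?C (mat_app K x) y = L2_inner ?C x (mat_app K y)"
    by (simp add: LIMSEQ_unique)
  then show ?thesis using x y mat_app_l2[OF K] by (simp add: l2_inner_eq_L2_inner)
qed

text \<open>
  The matrix of multiplication by the symbol \<open>u\<close> followed by the projection onto
  the nonnegative frequencies.
\<close>

definition toeplitz :: "(real \<Rightarrow> real) \<Rightarrow> inf_matrix" where
  "toeplitz u l k = 1 / (2 * pi) * (LINT t|leb_band. trig_exp (int k - int l) t * complex_of_real (u t))"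

lemma toeplitz_hermitian: "toeplitz u k l = cnj (toeplitz u l k)"
proof -
  have "cnj (LINT t|leb_band. trig_exp (int k - int l) t * complex_of_real (u t))
      = (LINT t|leb_band. cnj (trig_exp (int k - int l) t * complex_of_real (u t)))"
    by (rule Bochner_Integration.integral_cnj[symmetric])
  then show ?thesis by (simp add: toeplitz_def trig_exp_cnj)
qed

lemma integrable_trig_exp_mult:
  assumes "integrable leb_band u"
  shows "integrable leb_band (\<lambda>t. trig_exp m t * u t)"
  by (rule Bochner_Integration.integrable_bound[OF assms])
    (use assms in \<open>auto simp: norm_mult intro!: borel_measurable_times\<close>)

text \<open>
  Multiplication by a unimodular exponential removes the negative frequencies. The modulus does
  not change, so estimates for one-sided polynomials, which is what sequences indexed by the
  natural numbers give, hold for all trigonometric polynomials.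
\<close>

lemma trig_poly_shift:
  assumes "p \<in> trig_polys"
  obtains N n x where "\<And>t. p t * trig_exp N t = trig_sum int x n t"
proof -
  obtain F b where F: "finite F" "p = (\<lambda>t. \<Sum>m\<in>F. b m * trig_exp m t)" by (rule trig_polysE[OF assms])
  define N where "N = (\<Sum>m\<in>F. \<bar>m\<bar>)"
  have N: "\<bar>m\<bar> \<le> N" if "m \<in> F" for m unfolding N_def using F(1) that by (intro member_le_sum) auto
  have N0: "0 \<le> N" unfolding N_def by (intro sum_nonneg) auto
  define n where "n = nat (2 * N + 1)"
  define x where "x k = (if int k - N \<in> F then b (int k - N) else 0)" for k
  have "p t * trig_exp N t = trig_sum int x n t" for t
  proof -
    have "p t * trig_exp N t = (\<Sum>m\<in>F. b m * trig_exp (m + N) t)"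
      unfolding F(2) by (simp add: sum_distrib_right mult.assoc trig_exp_mult)
    also have "\<dots> = (\<Sum>k\<in>{k. k < n \<and> int k - N \<in> F}. b (int k - N) * trig_exp (int k) t)"
      by (rule sum.reindex_bij_witness[where i = "\<lambda>k. int k - N" and j = "\<lambda>m. nat (m + N)"])
        (use N N0 in \<open>force simp: n_def\<close>)+
    also have "\<dots> = trig_sum int x n t"
      unfolding x_def by (rule sum.mono_neutral_cong_left) auto
    finally show ?thesis .
  qed
  then show ?thesis by (rule that)
qed

text \<open>
  Expanding \<open>\<bar>\<Sum> x k * exp(i k t)\<bar>\<^sup>2\<close> under the integral
  produces exactly the entries of the matrix. For an integrable symbol this makes the quadratic
  form a test of boundedness.
\<close>

lemma toeplitz_quadratic_form:
  assumes u: "integrable leb_band u"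
  shows "l2_inner (mat_app (toeplitz u) (seq_trunc n x)) (seq_trunc n x)
    = complex_of_real (1 / (2 * pi) * (LINT t|leb_band. u t * (cmod (trig_sum int x n t))\<^sup>2))"
proof -
  have uc: "integrable leb_band (\<lambda>t. complex_of_real (u t))" using u by simp
  have int: "integrable leb_band (\<lambda>t. x k * cnj (x l) * (trig_exp (int k - int l) t * complex_of_real (u t)))" for k l
    by (intro integrable_mult_right integrable_trig_exp_mult[OF uc])
  have pt: "complex_of_real (u t * (cmod (trig_sum int x n t))\<^sup>2)
     = (\<Sum>l<n. \<Sum>k<n. x k * cnj (x l) * (trig_exp (int k - int l) t * complex_of_real (u t)))" for t
  proof -
    have "complex_of_real (u t * (cmod (trig_sum int x n t))\<^sup>2)
       = complex_of_real (u t) * ((trig_sum int x n t) * (\<Sum>l<n. cnj (x l) * trig_exp (- int l) t))"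
      by (simp add: complex_norm_square trig_exp_cnj del: of_real_power)
    also have "(trig_sum int x n t) * (\<Sum>l<n. cnj (x l) * trig_exp (- int l) t)
       = (\<Sum>l<n. \<Sum>k<n. x k * cnj (x l) * trig_exp (int k - int l) t)"
    proof -
      have e: "x k * trig_exp (int k) t * (cnj (x l) * trig_exp (- int l) t) = x k * cnj (x l) * trig_exp (int k - int l) t" for k l
        using trig_exp_mult[of "int k" t "- int l"] by (simp add: ac_simps)
      then show ?thesis unfolding sum_product by (subst sum.swap) (simp only: e)
    qed
    also have "complex_of_real (u t) * \<dots> = (\<Sum>l<n. \<Sum>k<n. x k * cnj (x l) * (trig_exp (int k - int l) t * complex_of_real (u t)))"
      unfolding sum_distrib_left by (intro sum.cong refl) (simp only: mult_ac)
    finally show ?thesis .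
  qed
  have "complex_of_real (LINT t|leb_band. u t * (cmod (trig_sum int x n t))\<^sup>2)
      = (LINT t|leb_band. (\<Sum>l<n. \<Sum>k<n. x k * cnj (x l) * (trig_exp (int k - int l) t * complex_of_real (u t))))"
    unfolding pt[symmetric] by (rule integral_complex_of_real[symmetric])
  also have "\<dots> = (\<Sum>l<n. \<Sum>k<n. x k * cnj (x l) * (LINT t|leb_band. trig_exp (int k - int l) t * complex_of_real (u t)))"
  proof (subst Bochner_Integration.integral_sum)
    show "integrable leb_band (\<lambda>t. \<Sum>k<n. x k * cnj (x l) * (trig_exp (int k - int l) t * complex_of_real (u t)))" for l
      by (intro Bochner_Integration.integrable_sum int)
    have "(LINT t|leb_band. (\<Sum>k<n. x k * cnj (x l) * (trig_exp (int k - int l) t * complex_of_real (u t))))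
        = (\<Sum>k<n. LINT t|leb_band. x k * cnj (x l) * (trig_exp (int k - int l) t * complex_of_real (u t)))" for l
      by (intro Bochner_Integration.integral_sum int)
    then show "(\<Sum>l<n. LINT t|leb_band. (\<Sum>k<n. x k * cnj (x l) * (trig_exp (int k - int l) t * complex_of_real (u t))))
        = (\<Sum>l<n. \<Sum>k<n. x k * cnj (x l) * (LINT t|leb_band. trig_exp (int k - int l) t * complex_of_real (u t)))"
      by simp
  qed
  finally have "complex_of_real (1 / (2 * pi) * (LINT t|leb_band. u t * (cmod (trig_sum int x n t))\<^sup>2))
      = (\<Sum>l<n. \<Sum>k<n. toeplitz u l k * x k * cnj (x l))"
    unfolding toeplitz_def of_real_mult by (simp add: sum_distrib_left ac_simps)
  then show ?thesis
    by (simp add: l2_inner_trunc mat_app_trunc sum_distrib_right)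
qed

lemma trunc_trig_sum_norm:
  "(LINT t|leb_band. (cmod (trig_sum int x n t))\<^sup>2) = 2 * pi * (l2_norm (seq_trunc n x))\<^sup>2"
proof -
  have "(l2_norm (seq_trunc n x))\<^sup>2 = (\<Sum>k. (cmod (seq_trunc n x k))\<^sup>2)" by (rule l2_norm_sq) simp
  also have "\<dots> = (\<Sum>k<n. (cmod (x k))\<^sup>2)" by (rule suminf_seq_trunc) simp
  finally show ?thesis using trig_sum_norm[of int "{..<n}" x] by (simp add: L2_norm_sq)
qed

lemma weight_bound_from_analytic:
  fixes u :: "real \<Rightarrow> real"
  assumes u: "integrable leb_band u"
    and le: "\<And>n x. 0 \<le> (LINT t|leb_band. u t * (cmod (trig_sum int x n t))\<^sup>2)"
  shows "AE t in leb_band. 0 \<le> u t"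
proof (rule trig_polys_weight_nonneg[OF u])
  fix p assume p: "p \<in> trig_polys"
  obtain N n x where eq: "\<And>t. p t * trig_exp N t = trig_sum int x n t"
    by (rule trig_poly_shift[OF p]) (rule that)
  have "cmod (p t) = cmod (trig_sum int x n t)" for t
    unfolding eq[symmetric] by (simp add: norm_mult)
  then show "0 \<le> (LINT t|leb_band. u t * (cmod (p t))\<^sup>2)" using le[where n = n and x = x] by simp
qed

lemma trig_sum_weight_integrable:
  fixes u :: "real \<Rightarrow> real"
  assumes u: "integrable leb_band u"
  shows "integrable leb_band (\<lambda>t. u t * (cmod (trig_sum int x n t))\<^sup>2)"
proof -
  have "cmod (trig_sum int x n t) \<le> (\<Sum>k<n. cmod (x k))" for t
    by (rule order_trans[OF norm_sum]) (simp add: norm_mult)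
  then have le: "(cmod (trig_sum int x n t))\<^sup>2 \<le> (\<Sum>k<n. cmod (x k))\<^sup>2" for t
    by (intro power_mono) auto
  show ?thesis
  proof (rule Bochner_Integration.integrable_bound[OF integrable_mult_left[OF u, of "(\<Sum>k<n. cmod (x k))\<^sup>2"]])
    show "AE t in leb_band. norm (u t * (cmod (trig_sum int x n t))\<^sup>2) \<le> norm (u t * (\<Sum>k<n. cmod (x k))\<^sup>2)"
      using le by (intro AE_I2) (simp add: abs_mult mult_left_mono)
  qed (use u in \<open>auto intro!: borel_measurable_times\<close>)
qed

text \<open>
  A Toeplitz matrix acting on \<open>\<ell>\<^sub>2\<close> is symmetric, hence bounded by some
  \<open>B\<close>; then \<open>\<integral> u \<bar>X\<bar>\<^sup>2 \<le> B \<integral>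
  \<bar>X\<bar>\<^sup>2\<close> for all trigonometric polynomials \<open>X\<close>, which forces
  \<open>u \<le> B\<close>.
\<close>

theorem toeplitz_operator_symbol_bounded:
  assumes u: "integrable leb_band u" and K: "l2_operator (toeplitz u)"
  shows "\<exists>B. AE t in leb_band. u t \<le> B"
proof -
  obtain B where B: "0 \<le> B" "\<And>x. x \<in> l2 \<Longrightarrow> l2_norm (mat_app (toeplitz u) x) \<le> B * l2_norm x"
    using hermitian_bounded[OF K toeplitz_hermitian] by blast
  have "AE t in leb_band. 0 \<le> B - u t"
  proof (rule weight_bound_from_analytic)
    fix n and x :: "nat \<Rightarrow> complex"
    let ?x = "seq_trunc n x" and ?X = "trig_sum int x n"
    have "1 / (2 * pi) * (LINT t|leb_band. u t * (cmod (?X t))\<^sup>2) \<le> cmod (l2_inner (mat_app (toeplitz u) ?x) ?x)"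
      unfolding toeplitz_quadratic_form[OF u] norm_of_real by (rule abs_ge_self)
    also have "\<dots> \<le> l2_norm (mat_app (toeplitz u) ?x) * l2_norm ?x"
      using mat_app_l2[OF K seq_trunc_l2] by (simp add: l2_inner_eq_L2_inner L2_Cauchy_Schwarz l2_eq_L2_fun[symmetric])
    also have "\<dots> \<le> B * (l2_norm ?x)\<^sup>2"
      using mult_right_mono[OF B(2)[of ?x], of "l2_norm ?x"] by (simp add: power2_eq_square mult.assoc)
    also have "\<dots> = 1 / (2 * pi) * (B * (LINT t|leb_band. (cmod (?X t))\<^sup>2))"
      unfolding trunc_trig_sum_norm by simp
    finally have "(LINT t|leb_band. u t * (cmod (?X t))\<^sup>2) \<le> B * (LINT t|leb_band. (cmod (?X t))\<^sup>2)"
      by (simp add: divide_le_cancel)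
    moreover have "(LINT t|leb_band. (B - u t) * (cmod (?X t))\<^sup>2)
       = B * (LINT t|leb_band. (cmod (?X t))\<^sup>2) - (LINT t|leb_band. u t * (cmod (?X t))\<^sup>2)"
      using trig_sum_weight_integrable[OF u] L2_fun_integrable[OF trig_sum_L2[of x int "{..<n}"]]
      by (simp add: left_diff_distrib)
    ultimately show "0 \<le> (LINT t|leb_band. (B - u t) * (cmod (?X t))\<^sup>2)" by simp
  qed (use u in simp)
  then show ?thesis by (intro exI[of _ B]) simp
qed

text \<open>
  Integrating against \<open>S\<close> times an exponential is a continuous functional on
  \<open>L\<^sub>2\<close> and may be applied to the series of \<open>X\<close> term by term.
  All the matrices of the filtering problem are instances of this convolution formula.
\<close>

lemma fourier_coeff_mult_sums:
  assumes S: "S \<in> L2_fun leb_band" and X: "trig_L2_sums j x X"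
  shows "(\<lambda>k. fourier_coeff S (m - j k) * x k) sums fourier_coeff (\<lambda>t. S t * X t) m"
proof -
  define V where "V t = trig_exp m t * cnj (S t)" for t
  have V: "V \<in> L2_fun leb_band"
    unfolding V_def by (rule L2_fun_bounded_mult[OF L2_fun_cnj[OF S], where K = 1]) auto
  have e: "L2_inner leb_band (trig_exp (j k)) V = L2_inner leb_band S (trig_exp (m - j k))" for k
  proof -
    have "trig_exp (j k) t * cnj (V t) = S t * cnj (trig_exp (m - j k) t)" for t
      using trig_exp_mult[of "j k" t "- m"] by (simp add: V_def trig_exp_cnj mult.commute mult.left_commute)
    then show ?thesis unfolding L2_inner_def by (simp only:)
  qed
  have "L2_inner leb_band (trig_sum j x n) V / (2 * pi)
      = (\<Sum>k<n. fourier_coeff S (m - j k) * x k)" for n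
    by (subst L2_inner_sum_left)
      (auto intro: V simp: L2_inner_cmult_left e fourier_coeff_def sum_divide_distrib mult.commute)
  moreover have "L2_inner leb_band X V / (2 * pi) = fourier_coeff (\<lambda>t. S t * X t) m"
    unfolding fourier_coeff_def L2_inner_def V_def by (simp add: mult.commute mult.left_commute)
  moreover have "(\<lambda>n. L2_inner leb_band (trig_sum j x n) V / (2 * pi))
      \<longlonglongrightarrow> L2_inner leb_band X V / (2 * pi)"
    by (intro tendsto_divide tendsto_const L2_inner_tendsto L2_tendsto_const V X[unfolded trig_L2_sums_iff]) simp
  ultimately show ?thesis unfolding sums_def by simp
qed

lemma toeplitz_fourier_coeff: "toeplitz u l k = fourier_coeff (\<lambda>t. complex_of_real (u t)) (int l - int k)"
  unfolding toeplitz_def fourier_coeff_def L2_inner_def trig_exp_cnj by (simp add: mult.commute)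

lemma toeplitz_apply_sums:
  assumes u: "u \<in> borel_measurable leb_band" "AE t in leb_band. \<bar>u t\<bar> \<le> B"
    and X: "trig_L2_sums int x X"
  shows "(\<lambda>k. toeplitz u l k * x k) sums fourier_coeff (\<lambda>t. complex_of_real (u t) * X t) (int l)"
  unfolding toeplitz_fourier_coeff
  by (rule fourier_coeff_mult_sums[OF _ X]) (rule leb_band.L2_fun_bounded[where K = B], use u in simp_all)

lemma trig_L2_sums_trunc: "trig_L2_sums int (seq_trunc n x) (trig_sum int x n)"
  unfolding trig_L2_sums_iff
proof (rule L2_tendstoI_bound[where r = "\<lambda>m. if n \<le> m then 0 else L2_norm leb_band (\<lambda>t. trig_sum int (seq_trunc n x) m t - trig_sum int x n t)"])
  fix m
  show "L2_norm leb_band (\<lambda>t. trig_sum int (seq_trunc n x) m t - trig_sum int x n t)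
      \<le> (if n \<le> m then 0 else L2_norm leb_band (\<lambda>t. trig_sum int (seq_trunc n x) m t - trig_sum int x n t))"
  proof (cases "n \<le> m")
    case True
    have "(trig_sum int (seq_trunc n x) m t) = trig_sum int x n t" for t
      using True by (intro sum.mono_neutral_cong_right) (auto simp: seq_trunc_def)
    then show ?thesis by simp
  qed simp
next
  show "(\<lambda>m. if n \<le> m then 0 else L2_norm leb_band (\<lambda>t. trig_sum int (seq_trunc n x) m t - trig_sum int x n t)) \<longlonglongrightarrow> 0"
    by (rule tendsto_eventually) (auto simp: eventually_sequentially intro!: exI[of _ n])
qed simp_all

text \<open>
  The inverse of a symmetric operator is symmetric, hence bounded too, say by \<open>D\<close>.
  Since the matrix is multiplication by \<open>u\<close> followed by a projection,
  \<open>\<parallel>x\<parallel> \<le> D \<parallel>K x\<parallel>\<close> and Bessel's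
  inequality give \<open>\<integral> \<bar>X\<bar>\<^sup>2 \<le> D\<^sup>2 \<integral> u\<^sup>2
  \<bar>X\<bar>\<^sup>2\<close> for all trigonometric polynomials, hence \<open>1 \<le>
  D\<^sup>2 u\<^sup>2\<close>.
\<close>

theorem toeplitz_invertible_symbol_bounded_below:
  assumes u: "integrable leb_band u" "AE t in leb_band. 0 \<le> u t" and K: "l2_invertible (toeplitz u)"
  shows "\<exists>d>0. AE t in leb_band. d \<le> u t"
proof -
  let ?K = "toeplitz u"
  have op: "l2_operator ?K" and bij: "bij_betw (mat_app ?K) l2 l2"
    using K by (auto simp: l2_invertible_def)
  obtain B where B: "AE t in leb_band. u t \<le> B" using toeplitz_operator_symbol_bounded[OF u(1) op] by blast
  have um: "u \<in> borel_measurable leb_band" using u(1) by simp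
  have ub: "AE t in leb_band. \<bar>u t\<bar> \<le> B" using B u(2) by eventually_elim simp
  have inv: "mat_app ?K (l2_inverse ?K x) = x" "l2_inverse ?K x \<in> l2" if "x \<in> l2" for x
  proof -
    have "x \<in> mat_app ?K ` l2" using that bij by (simp add: bij_betw_def)
    then show "mat_app ?K (l2_inverse ?K x) = x" "l2_inverse ?K x \<in> l2"
      unfolding l2_inverse_def by (rule f_inv_into_f, rule inv_into_into)
  qed
  have inv': "l2_inverse ?K (mat_app ?K x) = x" if "x \<in> l2" for x
    using that bij unfolding l2_inverse_def bij_betw_def by (intro inv_into_f_f) auto
  have "\<exists>D\<ge>0. \<forall>x\<in>l2. l2_norm (l2_inverse ?K x) \<le> D * l2_norm x"
  proof (rule Hellinger_Toeplitz)
    fix x y n assume x: "x \<in> l2"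
    have "l2_inner (l2_inverse ?K x) (seq_trunc n y)
        = l2_inner (l2_inverse ?K x) (mat_app ?K (l2_inverse ?K (seq_trunc n y)))"
      by (simp add: inv)
    also have "\<dots> = l2_inner (mat_app ?K (l2_inverse ?K x)) (l2_inverse ?K (seq_trunc n y))"
      by (rule hermitian_sym[OF op toeplitz_hermitian, symmetric]) (use x inv in auto)
    finally show "l2_inner (l2_inverse ?K x) (seq_trunc n y) = l2_inner x (l2_inverse ?K (seq_trunc n y))"
      by (simp add: inv x)
  qed (rule inv)
  then obtain D where D: "0 \<le> D" "\<And>x. x \<in> l2 \<Longrightarrow> l2_norm (l2_inverse ?K x) \<le> D * l2_norm x" by blast
  have u2: "integrable leb_band (\<lambda>t. (u t)\<^sup>2)"
    by (rule Bochner_Integration.integrable_bound[OF leb_band.integrable_const[of "B\<^sup>2"]])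
      (use ub in \<open>auto elim!: eventually_mono intro!: borel_measurable_power um simp: abs_le_square_iff[symmetric]\<close>)
  have "AE t in leb_band. 0 \<le> D\<^sup>2 * (u t)\<^sup>2 - 1"
  proof (rule weight_bound_from_analytic)
    fix n and x :: "nat \<Rightarrow> complex"
    let ?x = "seq_trunc n x" and ?X = "trig_sum int x n"
    let ?Y = "\<lambda>t. complex_of_real (u t) * ?X t"
    have YL2: "?Y \<in> L2_fun leb_band"
      by (rule L2_fun_bounded_mult[where K = B]) (use um ub in simp_all)
    have coeff: "mat_app ?K ?x = (\<lambda>l. fourier_coeff ?Y (int l))"
      unfolding mat_app_def
      by (rule ext, rule sums_unique[symmetric], rule toeplitz_apply_sums[OF um ub trig_L2_sums_trunc])
    have "l2_norm ?x \<le> D * l2_norm (mat_app ?K ?x)"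
      using D(2)[OF mat_app_l2[OF op seq_trunc_l2], of n x] by (simp add: inv')
    then have "2 * pi * (l2_norm ?x)\<^sup>2 \<le> 2 * pi * (D * l2_norm (mat_app ?K ?x))\<^sup>2"
      by (intro mult_left_mono power_mono) auto
    also have "\<dots> = D\<^sup>2 * (2 * pi * (l2_norm (mat_app ?K ?x))\<^sup>2)" by (simp add: power_mult_distrib)
    also have "\<dots> \<le> D\<^sup>2 * (L2_norm leb_band ?Y)\<^sup>2"
      unfolding coeff using Bessel(2)[OF YL2, of int] by (intro mult_left_mono) auto
    also have "(L2_norm leb_band ?Y)\<^sup>2 = (LINT t|leb_band. (u t)\<^sup>2 * (cmod (?X t))\<^sup>2)"
      unfolding L2_norm_sq by (simp add: norm_mult power_mult_distrib)
    finally have "(LINT t|leb_band. (cmod (?X t))\<^sup>2) \<le> D\<^sup>2 * (LINT t|leb_band. (u t)\<^sup>2 * (cmod (?X t))\<^sup>2)"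
      unfolding trunc_trig_sum_norm .
    moreover have "(LINT t|leb_band. (D\<^sup>2 * (u t)\<^sup>2 - 1) * (cmod (?X t))\<^sup>2)
       = D\<^sup>2 * (LINT t|leb_band. (u t)\<^sup>2 * (cmod (?X t))\<^sup>2) - (LINT t|leb_band. (cmod (?X t))\<^sup>2)"
      using trig_sum_weight_integrable[OF u2] L2_fun_integrable[OF trig_sum_L2[of x int "{..<n}"]]
      by (simp add: left_diff_distrib mult.assoc)
    ultimately show "0 \<le> (LINT t|leb_band. (D\<^sup>2 * (u t)\<^sup>2 - 1) * (cmod (?X t))\<^sup>2)" by simp
  qed (use u2 in simp)
  \<comment> \<open>The constant \<open>D + 1\<close> avoids a separate case for \<open>D = 0\<close>.\<close>
  then have "AE t in leb_band. 1 / (D + 1) \<le> u t"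
    using u(2)
  proof eventually_elim
    case (elim t)
    have "1 \<le> (D * u t)\<^sup>2" using elim by (simp add: power_mult_distrib)
    then have "1 \<le> D * u t" using elim D(1) by (metis abs_le_square_iff abs_of_nonneg mult_nonneg_nonneg one_power2 abs_one)
    also have "\<dots> \<le> (D + 1) * u t" using elim by (simp add: distrib_right)
    finally show ?case using D(1) by (simp add: field_simps)
  qed
  then show ?thesis using D(1) by (intro exI[of _ "1 / (D + 1)"]) auto
qed

section \<open>The canonical factorization inverts the Toeplitz operator\<close>

lemma fourier_coeff_cong_AE:
  assumes "X \<in> borel_measurable leb_band" "Y \<in> borel_measurable leb_band" "AE t in leb_band. X t = Y t"
  shows "fourier_coeff X m = fourier_coeff Y m"
proof -
  have "L2_inner leb_band X (trig_exp m) = L2_inner leb_band Y (trig_exp m)"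
    unfolding L2_inner_def trig_exp_cnj
    by (rule integral_cong_AE) (use assms in \<open>auto intro!: borel_measurable_times\<close>)
  then show ?thesis by (simp add: fourier_coeff_def)
qed

lemma fourier_coeff_diff:
  "X \<in> L2_fun leb_band \<Longrightarrow> Y \<in> L2_fun leb_band \<Longrightarrow>
    fourier_coeff (\<lambda>t. X t - Y t) m = fourier_coeff X m - fourier_coeff Y m"
  by (simp add: fourier_coeff_def L2_inner_diff_left diff_divide_distrib)

lemma inj_neg_int: "inj (\<lambda>k. - int k)"
  by (simp add: inj_def)

text \<open>
  Write \<open>\<Pi>\<close> for the projection onto the nonnegative frequencies. The transpose
  of the matrix acts as \<open>X \<mapsto> \<Pi>(\<Theta> X)\<close>, and the conjugate as
  \<open>Y \<mapsto> cnj \<Theta> * Y\<close>, where no projection is needed. As \<open>1 / w =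
  \<Psi> * cnj \<Psi>\<close> and \<open>\<Psi> * \<Theta> = 1\<close>, applying the Toeplitz
  operator to the result \<open>cnj \<Theta> * Y\<close> gives \<open>\<Pi>(\<Psi> Y)\<close>.
  Now \<open>Y = \<Theta> X - N\<close> with \<open>N\<close> of negative frequencies, so
  \<open>\<Psi> Y = X - \<Psi> N\<close>, and \<open>\<Psi> N\<close> has only negative
  frequencies because \<open>\<Psi>\<close> has no positive ones. The bounds on \<open>1 /
  w\<close> make \<open>\<Psi>\<close> and \<open>\<Theta>\<close> bounded multipliers.
\<close>

theorem toeplitz_inverse_factorization:
  fixes w :: "real \<Rightarrow> real"
  assumes d: "0 < d" "AE t in leb_band. d \<le> 1 / w t" and B: "AE t in leb_band. 1 / w t \<le> B"
    and w: "w \<in> borel_measurable leb_band"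
    and K: "l2_invertible (toeplitz (\<lambda>t. 1 / w t))"
    and cf: "canonical_factorization w \<psi> \<theta>"
  shows "l2_operator (mat_transpose (Theta_mat \<theta>))" "l2_operator (mat_cnj (Theta_mat \<theta>))"
    "x \<in> l2 \<Longrightarrow> l2_inverse (toeplitz (\<lambda>t. 1 / w t)) x
       = mat_app (mat_cnj (Theta_mat \<theta>)) (mat_app (mat_transpose (Theta_mat \<theta>)) x)"
proof -
  let ?u = "\<lambda>t. 1 / w t"
  obtain \<Psi> \<Theta> where \<Psi>: "trig_L2_sums (\<lambda>k. - int k) \<psi> \<Psi>" and \<Theta>: "trig_L2_sums (\<lambda>k. - int k) \<theta> \<Theta>"
    and ae: "AE t in leb_band. \<Psi> t * \<Theta> t = 1 \<and> 1 / w t = (cmod (\<Psi> t))\<^sup>2 \<and> 1 / w t = cmod (\<Theta> t) powi (-2)"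
    using cf unfolding canonical_factorization_def by blast
  have \<Psi>L: "\<Psi> \<in> L2_fun leb_band" and \<Theta>L: "\<Theta> \<in> L2_fun leb_band"
    using \<Psi> \<Theta> by (auto simp: trig_L2_sums_def dest: L2_tendsto_lim_fun)
  note [measurable] = w L2_fun_measurable[OF \<Psi>L] L2_fun_measurable[OF \<Theta>L]
  have \<Psi>b: "AE t in leb_band. cmod (\<Psi> t) \<le> sqrt B"
    using ae B by eventually_elim (simp add: real_le_rsqrt)
  have \<Theta>b: "AE t in leb_band. cmod (\<Theta> t) \<le> 1 / sqrt d"
    using ae d(2)
  proof eventually_elim
    case (elim t)
    have "sqrt d \<le> cmod (\<Psi> t)" using elim by (intro real_le_lsqrt) auto
    moreover have "cmod (\<Psi> t) * cmod (\<Theta> t) = 1" using elim by (metis norm_mult norm_one)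
    ultimately have "sqrt d * cmod (\<Theta> t) \<le> 1" by (metis mult_right_mono norm_ge_zero)
    then show ?case using d(1) by (simp add: field_simps)
  qed
  have ub: "AE t in leb_band. \<bar>1 / w t\<bar> \<le> B" using B d(2) by eventually_elim (use d(1) in auto)
  have \<Theta>m: "(\<lambda>t. \<Theta> t * X t) \<in> L2_fun leb_band" if "X \<in> L2_fun leb_band" for X
    by (rule L2_fun_bounded_mult[OF that _ \<Theta>b]) measurable
  have c\<Theta>m: "(\<lambda>t. cnj (\<Theta> t) * X t) \<in> L2_fun leb_band" if "X \<in> L2_fun leb_band" for X
    by (rule L2_fun_bounded_mult[OF that, where K = "1 / sqrt d"]) (use \<Theta>b in auto)
  have \<Psi>m: "(\<lambda>t. \<Psi> t * X t) \<in> L2_fun leb_band" if "X \<in> L2_fun leb_band" for X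
    by (rule L2_fun_bounded_mult[OF that _ \<Psi>b]) measurable
  have \<Theta>c: "fourier_coeff \<Theta> (int i - int k) = Theta_mat \<theta> k i" for i k
  proof (cases "i \<le> k")
    case True
    then show ?thesis using trig_L2_sums_coeff(1)[OF \<Theta> inj_neg_int, of "k - i"]
      by (simp add: Theta_mat_def of_nat_diff)
  next
    case False
    then have "int i - int k \<notin> range (\<lambda>k. - int k)" by auto
    then show ?thesis using False trig_L2_sums_coeff(2)[OF \<Theta> inj_neg_int] by (simp add: Theta_mat_def)
  qed
  have cnj_coeff: "fourier_coeff (\<lambda>t. cnj (\<Theta> t)) m = cnj (fourier_coeff \<Theta> (- m))" for m
  proof -
    have "L2_inner leb_band (\<lambda>t. cnj (\<Theta> t)) (trig_exp m) = cnj (L2_inner leb_band \<Theta> (trig_exp (- m)))"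
      unfolding L2_inner_def by (subst Bochner_Integration.integral_cnj[symmetric]) (simp add: trig_exp_cnj)
    then show ?thesis by (simp add: fourier_coeff_def)
  qed
  have c\<Theta>L: "(\<lambda>t. cnj (\<Theta> t)) \<in> L2_fun leb_band" using \<Theta>L by blast
  \<comment> \<open>Both matrices act on Fourier coefficients as multiplication followed by the projection onto
      the nonnegative frequencies.\<close>
  have T_sums: "(\<lambda>k. mat_transpose (Theta_mat \<theta>) i k * x k) sums fourier_coeff (\<lambda>t. \<Theta> t * X t) (int i)"
    if "trig_L2_sums int x X" for x X i
    using fourier_coeff_mult_sums[OF \<Theta>L that, of "int i"] by (simp add: \<Theta>c mat_transpose_def)
  have C_sums: "(\<lambda>k. mat_cnj (Theta_mat \<theta>) i k * x k) sums fourier_coeff (\<lambda>t. cnj (\<Theta> t) * X t) (int i)"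
    if "trig_L2_sums int x X" for x X i
    using fourier_coeff_mult_sums[OF c\<Theta>L that, of "int i"] by (simp add: cnj_coeff \<Theta>c mat_cnj_def)
  have T_app: "mat_app (mat_transpose (Theta_mat \<theta>)) x = (\<lambda>i. fourier_coeff (\<lambda>t. \<Theta> t * X t) (int i))"
    if "trig_L2_sums int x X" for x X
    unfolding mat_app_def using sums_unique[OF T_sums[OF that]] by auto
  have C_app: "mat_app (mat_cnj (Theta_mat \<theta>)) x = (\<lambda>i. fourier_coeff (\<lambda>t. cnj (\<Theta> t) * X t) (int i))"
    if "trig_L2_sums int x X" for x X
    unfolding mat_app_def using sums_unique[OF C_sums[OF that]] by auto
  have fn: "\<exists>X. trig_L2_sums int x X \<and> X \<in> L2_fun leb_band" if x: "x \<in> l2" for x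
    using trig_L2_sums_exists[OF inj_of_nat x] by (auto simp: trig_L2_sums_def dest: L2_tendsto_lim_fun)
  have inj_int: "inj int" by (rule inj_of_nat)
  show T_op: "l2_operator (mat_transpose (Theta_mat \<theta>))"
    unfolding l2_operator_def
  proof (intro ballI conjI allI)
    fix x l assume "x \<in> l2"
    then obtain X where X: "trig_L2_sums int x X" "X \<in> L2_fun leb_band" using fn by blast
    show "summable (\<lambda>k. mat_transpose (Theta_mat \<theta>) l k * x k)" using T_sums[OF X(1)] by (rule sums_summable)
    show "mat_app (mat_transpose (Theta_mat \<theta>)) x \<in> l2"
      unfolding T_app[OF X(1)] by (intro Bessel(1) \<Theta>m X inj_int)
  qed
  show C_op: "l2_operator (mat_cnj (Theta_mat \<theta>))"
    unfolding l2_operator_def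
  proof (intro ballI conjI allI)
    fix x l assume "x \<in> l2"
    then obtain X where X: "trig_L2_sums int x X" "X \<in> L2_fun leb_band" using fn by blast
    show "summable (\<lambda>k. mat_cnj (Theta_mat \<theta>) l k * x k)" using C_sums[OF X(1)] by (rule sums_summable)
    show "mat_app (mat_cnj (Theta_mat \<theta>)) x \<in> l2"
      unfolding C_app[OF X(1)] by (intro Bessel(1) c\<Theta>m X inj_int)
  qed
  assume x: "x \<in> l2"
  obtain X where X: "trig_L2_sums int x X" "X \<in> L2_fun leb_band" using fn[OF x] by blast
  define y where "y = mat_app (mat_transpose (Theta_mat \<theta>)) x"
  have y: "y \<in> l2" unfolding y_def by (rule mat_app_l2[OF T_op x])
  obtain Y where Y: "trig_L2_sums int y Y" "Y \<in> L2_fun leb_band" using fn[OF y] by blast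
  define z where "z = mat_app (mat_cnj (Theta_mat \<theta>)) y"
  have z: "z \<in> l2" unfolding z_def by (rule mat_app_l2[OF C_op y])
  obtain Z where Z: "trig_L2_sums int z Z" "Z \<in> L2_fun leb_band" using fn[OF z] by blast
  note [measurable] = L2_fun_measurable[OF X(2)] L2_fun_measurable[OF Y(2)] L2_fun_measurable[OF Z(2)]
  \<comment> \<open>Multiplying by the conjugate of \<open>\<Theta>\<close> creates no negative frequencies.\<close>
  have "AE t in leb_band. Z t = cnj (\<Theta> t) * Y t"
  proof (rule fourier_coeff_unique[OF Z(2) c\<Theta>m[OF Y(2)]])
    fix m
    show "fourier_coeff Z m = fourier_coeff (\<lambda>t. cnj (\<Theta> t) * Y t) m"
    proof (cases "m \<in> range int")
      case True
      then obtain k where m: "m = int k" by blast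
      show ?thesis unfolding m trig_L2_sums_coeff(1)[OF Z(1) inj_int] z_def C_app[OF Y(1)] ..
    next
      case False
      then have neg: "m < 0" by (metis nonneg_int_cases not_less rangeI)
      have "fourier_coeff (\<lambda>t. cnj (\<Theta> t)) (m - int k) = 0" for k
      proof -
        have "- (m - int k) \<notin> range (\<lambda>k. - int k)" using neg by auto
        then show ?thesis using trig_L2_sums_coeff(2)[OF \<Theta> inj_neg_int] by (simp add: cnj_coeff)
      qed
      then have "fourier_coeff (\<lambda>t. cnj (\<Theta> t) * Y t) m = 0"
        using fourier_coeff_mult_sums[OF c\<Theta>L Y(1), of m] by (simp add: sums_iff)
      then show ?thesis using trig_L2_sums_coeff(2)[OF Z(1) inj_int False] by simp
    qed
  qed
  with ae have uZ: "AE t in leb_band. complex_of_real (1 / w t) * Z t = \<Psi> t * Y t"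
  proof eventually_elim
    case (elim t)
    have a: "complex_of_real (1 / w t) = \<Psi> t * cnj (\<Psi> t)"
      using elim by (metis complex_norm_square)
    have b: "cnj (\<Psi> t) * cnj (\<Theta> t) = 1" using elim by (metis complex_cnj_mult complex_cnj_one)
    have "complex_of_real (1 / w t) * Z t = \<Psi> t * (cnj (\<Psi> t) * cnj (\<Theta> t)) * Y t"
      unfolding a elim(2) by (simp only: mult.assoc)
    then show ?case unfolding b by simp
  qed
  \<comment> \<open>The part of \<open>\<Theta> X\<close> that the projection onto the nonnegative frequencies removes.\<close>
  define N where "N t = \<Theta> t * X t - Y t" for t
  have N: "N \<in> L2_fun leb_band" unfolding N_def by (intro L2_fun_diff \<Theta>m X Y)
  have N0: "fourier_coeff N m = 0" if "0 \<le> m" for m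
  proof -
    obtain i where m: "m = int i" using \<open>0 \<le> m\<close> nonneg_int_cases by blast
    show ?thesis
      unfolding m N_def fourier_coeff_diff[OF \<Theta>m[OF X(2)] Y(2)] trig_L2_sums_coeff(1)[OF Y(1) inj_int]
      by (simp add: y_def T_app[OF X(1)])
  qed
  have \<Psi>N: "fourier_coeff (\<lambda>t. \<Psi> t * N t) (int l) = 0" for l
    using fourier_coeff_mult_sums[OF N \<Psi>, of "int l"] by (simp add: N0 sums_iff mult.commute)
  have "mat_app (toeplitz ?u) z l = x l" for l
  proof -
    have "mat_app (toeplitz ?u) z l = fourier_coeff (\<lambda>t. complex_of_real (?u t) * Z t) (int l)"
      unfolding mat_app_def by (rule sums_unique[symmetric], rule toeplitz_apply_sums[OF _ ub Z(1)]) measurable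
    also have "\<dots> = fourier_coeff (\<lambda>t. \<Psi> t * Y t) (int l)"
      by (rule fourier_coeff_cong_AE[OF _ _ uZ]) measurable
    also have "\<dots> = fourier_coeff (\<lambda>t. X t - \<Psi> t * N t) (int l)"
    proof (rule fourier_coeff_cong_AE)
      show "AE t in leb_band. \<Psi> t * Y t = X t - \<Psi> t * N t"
        using ae
      proof eventually_elim
        case (elim t)
        have "\<Psi> t * N t = (\<Psi> t * \<Theta> t) * X t - \<Psi> t * Y t" by (simp add: N_def algebra_simps)
        with elim show ?case by simp
      qed
    qed (use L2_fun_measurable[OF N] in measurable)
    also have "\<dots> = x l"
      using fourier_coeff_diff[OF X(2) \<Psi>m[OF N]] \<Psi>N trig_L2_sums_coeff(1)[OF X(1) inj_int] by simp
    finally show ?thesis .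
  qed
  then have "mat_app (toeplitz ?u) z = x" by blast
  moreover have "inj_on (mat_app (toeplitz ?u)) l2" using K by (auto simp: l2_invertible_def bij_betw_def)
  ultimately have "l2_inverse (toeplitz ?u) x = z"
    unfolding l2_inverse_def using inv_into_f_f[OF _ z] by metis
  then show "l2_inverse (toeplitz ?u) x = mat_app (mat_cnj (Theta_mat \<theta>)) (mat_app (mat_transpose (Theta_mat \<theta>)) x)"
    by (simp add: z_def y_def)
qed

section \<open>Gram matrices and isometries\<close>

text \<open>
  The graph of the linear extension of a correspondence \<open>S\<close> between two families of
  functions. Working with a relation avoids showing that the extension is well defined.
\<close>

inductive_set lin_pairs :: "(('a \<Rightarrow> complex) \<times> ('b \<Rightarrow> complex)) set \<Rightarrow> (('a \<Rightarrow> complex) \<times> ('b \<Rightarrow> complex)) set"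
  for S where
  base: "p \<in> S \<Longrightarrow> p \<in> lin_pairs S"
| zero: "((\<lambda>x. 0), (\<lambda>y. 0)) \<in> lin_pairs S"
| add: "(X, Y) \<in> lin_pairs S \<Longrightarrow> (X', Y') \<in> lin_pairs S \<Longrightarrow> ((\<lambda>x. X x + X' x), (\<lambda>y. Y y + Y' y)) \<in> lin_pairs S"
| cmult: "(X, Y) \<in> lin_pairs S \<Longrightarrow> ((\<lambda>x. c * X x), (\<lambda>y. c * Y y)) \<in> lin_pairs S"

lemma lin_pairs_diff:
  assumes "(X, Y) \<in> lin_pairs S" "(X', Y') \<in> lin_pairs S"
  shows "((\<lambda>x. X x - X' x), (\<lambda>y. Y y - Y' y)) \<in> lin_pairs S"
  using lin_pairs.add[OF assms(1) lin_pairs.cmult[OF assms(2), of "-1"]] by simp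

lemma lin_pairs_sum:
  assumes "\<And>i. i \<in> I \<Longrightarrow> (X i, Y i) \<in> lin_pairs S"
  shows "((\<lambda>x. \<Sum>i\<in>I. X i x), (\<lambda>y. \<Sum>i\<in>I. Y i y)) \<in> lin_pairs S"
  using assms by (induction I rule: infinite_finite_induct) (auto intro: lin_pairs.zero lin_pairs.add)

lemma lin_pairs_L2:
  assumes "\<And>X Y. (X, Y) \<in> S \<Longrightarrow> X \<in> L2_fun M \<and> Y \<in> L2_fun N" and "(X, Y) \<in> lin_pairs S"
  shows "X \<in> L2_fun M" "Y \<in> L2_fun N"
proof -
  have "fst p \<in> L2_fun M \<and> snd p \<in> L2_fun N" if "p \<in> lin_pairs S" for p
    using that by induction (use assms(1) in \<open>auto simp: prod_eq_iff\<close>)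
  from this[OF assms(2)] show "X \<in> L2_fun M" "Y \<in> L2_fun N" by auto
qed

text \<open>
  Both sides are sesquilinear, so it suffices that the two Gram matrices agree.
\<close>

lemma lin_pairs_inner:
  assumes L2: "\<And>X Y. (X, Y) \<in> S \<Longrightarrow> X \<in> L2_fun M \<and> Y \<in> L2_fun N"
    and gram: "\<And>X Y X' Y'. (X, Y) \<in> S \<Longrightarrow> (X', Y') \<in> S \<Longrightarrow> L2_inner M X X' = L2_inner N Y Y'"
    and XY: "(X, Y) \<in> lin_pairs S" and XY': "(X', Y') \<in> lin_pairs S"
  shows "L2_inner M X X' = L2_inner N Y Y'"
proof -
  have in_L2: "X \<in> L2_fun M" "Y \<in> L2_fun N" if "(X, Y) \<in> lin_pairs S" for X Y
    by (rule lin_pairs_L2(1)[OF L2 that], assumption) (rule lin_pairs_L2(2)[OF L2 that])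
  have zero: "L2_inner K (\<lambda>x. 0) W = 0" "L2_inner K W (\<lambda>x. 0) = 0" for K :: "'d measure" and W
    by (simp_all add: L2_inner_def)
  have 1: "L2_inner M (fst q) (fst p) = L2_inner N (snd q) (snd p)" if "p \<in> lin_pairs S" "q \<in> S" for p q
    using that(1)
  proof induction
    case (base p)
    then show ?case using gram[of "fst q" "snd q" "fst p" "snd p"] that(2) by simp
  next
    case (add X Y X' Y')
    have "fst q \<in> L2_fun M" "snd q \<in> L2_fun N" using L2[of "fst q" "snd q"] that(2) by auto
    then show ?case using add in_L2[OF add.hyps(1)] in_L2[OF add.hyps(2)] by (simp add: L2_inner_add_right)
  qed (simp_all add: zero L2_inner_cmult_right)
  have "L2_inner M (fst q) (fst p) = L2_inner N (snd q) (snd p)" if "q \<in> lin_pairs S" "p \<in> lin_pairs S" for p q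
    using that(1)
  proof induction
    case (base q)
    then show ?case using 1 that(2) by simp
  next
    case (add X Y X' Y')
    have "fst p \<in> L2_fun M" "snd p \<in> L2_fun N" using in_L2[of "fst p" "snd p"] that(2) by auto
    then show ?case using add in_L2[OF add.hyps(1)] in_L2[OF add.hyps(2)] by (simp add: L2_inner_add_left)
  qed (simp_all add: zero L2_inner_cmult_left)
  from this[OF XY XY'] show ?thesis by simp
qed

lemma lin_pairs_norm:
  assumes L2: "\<And>X Y. (X, Y) \<in> S \<Longrightarrow> X \<in> L2_fun M \<and> Y \<in> L2_fun N"
    and gram: "\<And>X Y X' Y'. (X, Y) \<in> S \<Longrightarrow> (X', Y') \<in> S \<Longrightarrow> L2_inner M X X' = L2_inner N Y Y'"
    and XY: "(X, Y) \<in> lin_pairs S"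
  shows "L2_norm M X = L2_norm N Y"
proof -
  have "complex_of_real ((L2_norm M X)\<^sup>2) = complex_of_real ((L2_norm N Y)\<^sup>2)"
    unfolding L2_inner_self[symmetric] by (rule lin_pairs_inner[OF L2 gram XY XY])
  then have "(L2_norm M X)\<^sup>2 = (L2_norm N Y)\<^sup>2" by (rule of_real_eq_iff[THEN iffD1])
  then show ?thesis by (simp add: power2_eq_iff_nonneg)
qed

section \<open>Spectral measures\<close>

definition band_density :: "(real \<Rightarrow> real) \<Rightarrow> bool" where
  "band_density f \<longleftrightarrow> (\<forall>t\<in>{-pi..<pi}. 0 \<le> f t) \<and> integrable leb_band f"

lemma band_density_add: "band_density f \<Longrightarrow> band_density g \<Longrightarrow> band_density (\<lambda>t. f t + g t)"
  by (auto simp: band_density_def)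

lemma band_density_measurable: "band_density f \<Longrightarrow> f \<in> borel_measurable leb_band"
  by (auto simp: band_density_def)

lemma band_density_measurable': "band_density f \<Longrightarrow> (\<lambda>t. f t / (2 * pi)) \<in> borel_measurable leb_band"
  using band_density_measurable[of f] by simp

lemma sets_spectral_measure [simp]: "sets (spectral_measure f) = sets leb_band"
  by (simp add: spectral_measure_def)

lemma measurable_spectral_measure: "borel_measurable (spectral_measure f) = (borel_measurable leb_band :: (real \<Rightarrow> 'b::topological_space) set)"
  by (rule measurable_cong_sets) auto

lemma integral_spectral_measure:
  fixes X :: "real \<Rightarrow> 'b::{banach, second_countable_topology}"
  assumes "band_density f" "X \<in> borel_measurable leb_band"
  shows "(LINT t|spectral_measure f. X t) = (LINT t|leb_band. (f t / (2 * pi)) *\<^sub>R X t)"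
  unfolding spectral_measure_def using assms
  by (intro integral_density AE_I2 band_density_measurable') (auto simp: band_density_def)

lemma integrable_spectral_measure:
  fixes X :: "real \<Rightarrow> 'b::{banach, second_countable_topology}"
  assumes "band_density f" "X \<in> borel_measurable leb_band"
  shows "integrable (spectral_measure f) X \<longleftrightarrow> integrable leb_band (\<lambda>t. f t *\<^sub>R X t)"
proof -
  have "integrable (spectral_measure f) X \<longleftrightarrow> integrable leb_band (\<lambda>t. (f t / (2 * pi)) *\<^sub>R X t)"
    unfolding spectral_measure_def using assms
    by (intro integrable_density AE_I2 band_density_measurable') (auto simp: band_density_def)
  also have "\<dots> \<longleftrightarrow> integrable leb_band (\<lambda>t. f t *\<^sub>R X t)"
    using integrable_scaleR_right[of "2 * pi" leb_band "\<lambda>t. (f t / (2 * pi)) *\<^sub>R X t"]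
      integrable_scaleR_right[of "1 / (2 * pi)" leb_band "\<lambda>t. f t *\<^sub>R X t"] by auto
  finally show ?thesis .
qed

lemma finite_spectral_measure:
  assumes "band_density f"
  shows "finite_measure (spectral_measure f)"
proof (rule finite_measureI)
  have [measurable]: "f \<in> borel_measurable leb_band" by (rule band_density_measurable[OF assms])
  have "emeasure (spectral_measure f) (space (spectral_measure f)) = (\<integral>\<^sup>+t. ennreal (f t / (2 * pi)) \<partial>leb_band)"
    unfolding spectral_measure_def using sets.top[of leb_band]
    by (subst emeasure_density) (auto intro!: nn_integral_cong simp: indicator_def)
  also have "\<dots> \<le> (\<integral>\<^sup>+t. ennreal (norm (f t / (2 * pi))) \<partial>leb_band)"
    by (intro nn_integral_mono ennreal_leI) (simp only: real_norm_def abs_ge_self)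
  also have "\<dots> < \<infinity>"
    using assms integrable_divide[of leb_band f "2 * pi"] unfolding band_density_def integrable_iff_bounded by blast
  finally show "emeasure (spectral_measure f) (space (spectral_measure f)) \<noteq> \<infinity>" by simp
qed

lemma L2_fun_spectral_measure:
  assumes "band_density f"
  shows "X \<in> L2_fun (spectral_measure f) \<longleftrightarrow>
    X \<in> borel_measurable leb_band \<and> integrable leb_band (\<lambda>t. f t * (cmod (X t))\<^sup>2)"
proof -
  have "integrable (spectral_measure f) (\<lambda>t. (cmod (X t))\<^sup>2) \<longleftrightarrow> integrable leb_band (\<lambda>t. f t * (cmod (X t))\<^sup>2)"
    if "X \<in> borel_measurable leb_band"
    using integrable_spectral_measure[OF assms, of "\<lambda>t. (cmod (X t))\<^sup>2"] that by simp
  then show ?thesis unfolding L2_fun_def measurable_spectral_measure by blast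
qed

lemma L2_inner_spectral_measure:
  assumes f: "band_density f" and X: "X \<in> borel_measurable leb_band" and Y: "Y \<in> borel_measurable leb_band"
  shows "L2_inner (spectral_measure f) X Y = 1 / (2 * pi) * (LINT t|leb_band. f t * (X t * cnj (Y t)))"
proof -
  have m: "(\<lambda>t. X t * cnj (Y t)) \<in> borel_measurable leb_band"
    using X Y measurable_compose[OF Y borel_measurable_cnj] by simp
  have "(\<lambda>t. (f t / (2 * pi)) *\<^sub>R (X t * cnj (Y t))) = (\<lambda>t. complex_of_real (1 / (2 * pi)) * (f t * (X t * cnj (Y t))))"
    by (simp add: scaleR_conv_of_real)
  then show ?thesis
    unfolding L2_inner_def integral_spectral_measure[OF f m] by (simp only: integral_mult_right_zero)
qed

lemma L2_norm_spectral_measure: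
  assumes f: "band_density f" and X: "X \<in> borel_measurable leb_band"
  shows "(L2_norm (spectral_measure f) X)\<^sup>2 = 1 / (2 * pi) * (LINT t|leb_band. f t * (cmod (X t))\<^sup>2)"
proof -
  have "(L2_norm (spectral_measure f) X)\<^sup>2 = (LINT t|leb_band. (f t / (2 * pi)) *\<^sub>R (cmod (X t))\<^sup>2)"
    unfolding L2_norm_sq by (rule integral_spectral_measure[OF f]) (use X in measurable)
  also have "(\<lambda>t. (f t / (2 * pi)) *\<^sub>R (cmod (X t))\<^sup>2) = (\<lambda>t. (1 / (2 * pi)) * (f t * (cmod (X t))\<^sup>2))"
    by simp
  finally show ?thesis by (simp only: integral_mult_right_zero)
qed

lemma trig_exp_spectral [simp]: "band_density f \<Longrightarrow> trig_exp m \<in> L2_fun (spectral_measure f)"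
  by (rule trig_exp_L2[OF finite_spectral_measure]) auto

lemma L2_fun_spectral_sumD:
  assumes "band_density f" "band_density g" and X: "X \<in> L2_fun (spectral_measure (\<lambda>t. f t + g t))"
  shows "X \<in> L2_fun (spectral_measure f)"
    and "L2_norm (spectral_measure f) X \<le> L2_norm (spectral_measure (\<lambda>t. f t + g t)) X"
proof -
  note fg = band_density_add[OF assms(1,2)]
  have m: "X \<in> borel_measurable leb_band" and i: "integrable leb_band (\<lambda>t. (f t + g t) * (cmod (X t))\<^sup>2)"
    using X by (auto simp: L2_fun_spectral_measure[OF fg])
  have le: "f t * (cmod (X t))\<^sup>2 \<le> (f t + g t) * (cmod (X t))\<^sup>2" "0 \<le> f t * (cmod (X t))\<^sup>2"
    if "t \<in> {-pi..<pi}" for t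
    using assms that by (auto simp: band_density_def intro: mult_right_mono)
  have fm: "f \<in> borel_measurable leb_band" by (rule band_density_measurable[OF assms(1)])
  have i': "integrable leb_band (\<lambda>t. f t * (cmod (X t))\<^sup>2)"
  proof (rule Bochner_Integration.integrable_bound[OF i])
    show "AE t in leb_band. norm (f t * (cmod (X t))\<^sup>2) \<le> norm ((f t + g t) * (cmod (X t))\<^sup>2)"
    proof (rule AE_I2)
      fix t assume "t \<in> space leb_band"
      then have "0 \<le> f t * (cmod (X t))\<^sup>2" "f t * (cmod (X t))\<^sup>2 \<le> (f t + g t) * (cmod (X t))\<^sup>2"
        using le[of t] by auto
      then show "norm (f t * (cmod (X t))\<^sup>2) \<le> norm ((f t + g t) * (cmod (X t))\<^sup>2)"
        unfolding real_norm_def by linarith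
    qed
  qed (use fm m in measurable)
  then show "X \<in> L2_fun (spectral_measure f)"
    using m by (simp add: L2_fun_spectral_measure[OF assms(1)])
  have "(LINT t|leb_band. f t * (cmod (X t))\<^sup>2) \<le> (LINT t|leb_band. (f t + g t) * (cmod (X t))\<^sup>2)"
    by (rule integral_mono[OF i' i]) (use le in auto)
  then have "(L2_norm (spectral_measure f) X)\<^sup>2 \<le> (L2_norm (spectral_measure (\<lambda>t. f t + g t)) X)\<^sup>2"
    unfolding L2_norm_spectral_measure[OF assms(1) m] L2_norm_spectral_measure[OF fg m]
    by (simp add: divide_right_mono)
  then show "L2_norm (spectral_measure f) X \<le> L2_norm (spectral_measure (\<lambda>t. f t + g t)) X"
    by (rule power2_le_imp_le) simp
qed

text \<open>
  Fourier series converge with respect to Lebesgue measure; an essentially bounded density lets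
  them converge in the spectral measure as well.
\<close>

lemma L2_tendsto_spectral_bounded:
  assumes f: "band_density f" and K: "AE t in leb_band. f t \<le> K"
    and X: "L2_tendsto leb_band Xs X"
  shows "L2_tendsto (spectral_measure f) Xs X"
proof -
  have fm: "f \<in> borel_measurable leb_band" by (rule band_density_measurable[OF f])
  have *: "Y \<in> L2_fun (spectral_measure f) \<and> (L2_norm (spectral_measure f) Y)\<^sup>2 \<le> K / (2 * pi) * (L2_norm leb_band Y)\<^sup>2"
    if Y: "Y \<in> L2_fun leb_band" for Y
  proof -
    have m: "Y \<in> borel_measurable leb_band" by (rule L2_fun_measurable[OF Y])
    have i: "integrable leb_band (\<lambda>t. K * (cmod (Y t))\<^sup>2)" using L2_fun_integrable[OF Y] by simp
    have le: "AE t in leb_band. f t * (cmod (Y t))\<^sup>2 \<le> K * (cmod (Y t))\<^sup>2"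
      using K by eventually_elim (simp add: mult_right_mono)
    have nn: "AE t in leb_band. 0 \<le> f t * (cmod (Y t))\<^sup>2"
      using f by (intro AE_I2) (auto simp: band_density_def)
    have i': "integrable leb_band (\<lambda>t. f t * (cmod (Y t))\<^sup>2)"
    proof (rule Bochner_Integration.integrable_bound[OF i])
      show "AE t in leb_band. norm (f t * (cmod (Y t))\<^sup>2) \<le> norm (K * (cmod (Y t))\<^sup>2)"
        using le nn by eventually_elim simp
    qed (use fm m in measurable)
    have "(LINT t|leb_band. f t * (cmod (Y t))\<^sup>2) \<le> (LINT t|leb_band. K * (cmod (Y t))\<^sup>2)"
      by (rule integral_mono_AE[OF i' i le])
    then show ?thesis
      using i' m unfolding L2_norm_spectral_measure[OF f m] L2_fun_spectral_measure[OF f] L2_norm_sq[of leb_band]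
      by (simp add: divide_right_mono)
  qed
  have "(\<lambda>n. (L2_norm (spectral_measure f) (\<lambda>t. Xs n t - X t))\<^sup>2) \<longlonglongrightarrow> 0"
  proof (rule tendsto_sandwich[OF always_eventually always_eventually tendsto_const])
    show "\<forall>n. (L2_norm (spectral_measure f) (\<lambda>t. Xs n t - X t))\<^sup>2 \<le> K / (2 * pi) * (L2_norm leb_band (\<lambda>t. Xs n t - X t))\<^sup>2"
      using * X by (auto simp: L2_tendsto_def)
    show "(\<lambda>n. K / (2 * pi) * (L2_norm leb_band (\<lambda>t. Xs n t - X t))\<^sup>2) \<longlonglongrightarrow> 0"
      using X by (intro tendsto_mult_right_zero) (simp add: L2_tendsto_def L2_norm_sq)
  qed auto
  then show ?thesis
    using * X unfolding L2_tendsto_def L2_norm_sq[symmetric] by auto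
qed

section \<open>Stationary sequences and their spectral isometry\<close>

lemma rv_space_L2: "X \<in> rv_space M \<Longrightarrow> X \<in> L2_fun M"
  by (simp add: rv_space_def)

lemma (in prob_space) integral_eq_inner: "(LINT \<omega>|M. X \<omega>) = L2_inner M X (\<lambda>\<omega>. 1)"
  by (simp add: L2_inner_def)

lemma (in prob_space) one_L2: "(\<lambda>\<omega>. 1) \<in> L2_fun M"
  by (rule L2_fun_bounded[where K = 1]) auto

lemma (in prob_space) rv_space_iff: "X \<in> rv_space M \<longleftrightarrow> X \<in> L2_fun M \<and> L2_inner M X (\<lambda>\<omega>. 1) = 0"
  by (simp add: rv_space_def integral_eq_inner)

lemma (in prob_space) rv_space_limit:
  assumes "\<And>n. Xs n \<in> rv_space M" "L2_tendsto M Xs X"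
  shows "X \<in> rv_space M"
proof -
  have "(\<lambda>n. L2_inner M (Xs n) (\<lambda>\<omega>. 1)) \<longlonglongrightarrow> L2_inner M X (\<lambda>\<omega>. 1)"
    by (intro L2_inner_tendsto assms L2_tendsto_const one_L2)
  then show ?thesis
    using assms L2_tendsto_lim_fun[OF assms(2)] by (simp add: rv_space_iff LIMSEQ_const_iff)
qed

lemma (in prob_space) rv_space_add:
  "X \<in> rv_space M \<Longrightarrow> Y \<in> rv_space M \<Longrightarrow> (\<lambda>\<omega>. X \<omega> + Y \<omega>) \<in> rv_space M"
  by (auto simp: rv_space_iff L2_inner_add_left one_L2)

lemma (in prob_space) rv_space_sum:
  "(\<And>i. i \<in> I \<Longrightarrow> X i \<in> rv_space M) \<Longrightarrow> (\<lambda>\<omega>. \<Sum>i\<in>I. c i * X i \<omega>) \<in> rv_space M"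
proof (induction I rule: infinite_finite_induct)
  case (insert i I)
  then have "(\<lambda>\<omega>. c i * X i \<omega>) \<in> rv_space M"
    by (auto simp: rv_space_iff L2_inner_cmult_left)
  with insert show ?case by (simp add: rv_space_add)
qed (simp_all add: rv_space_def)

text \<open>
  Kolmogorov's isomorphism between the span of the sequence and \<open>L\<^sub>2\<close> of its
  spectral measure, \<open>\<xi> m \<mapsto> exp(i m t)\<close>, expressed by the equality of
  Gram matrices.
\<close>

definition spectral_isometry :: "'w measure \<Rightarrow> (int \<Rightarrow> 'w \<Rightarrow> complex) \<Rightarrow> (real \<Rightarrow> real) \<Rightarrow> bool" where
  "spectral_isometry M \<xi> f \<longleftrightarrow> (\<forall>m. \<xi> m \<in> rv_space M) \<and>
     (\<forall>m n. L2_inner M (\<xi> m) (\<xi> n) = L2_inner (spectral_measure f) (trig_exp m) (trig_exp n))"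

lemma spectral_isometry_rv: "spectral_isometry M \<xi> f \<Longrightarrow> \<xi> m \<in> rv_space M"
  and spectral_isometry_L2: "spectral_isometry M \<xi> f \<Longrightarrow> \<xi> m \<in> L2_fun M"
  by (auto simp: spectral_isometry_def rv_space_def)

lemma has_spectral_density_isometry:
  assumes "stationary_seq M \<xi>" "has_spectral_density M \<xi> f"
  shows "band_density f" "spectral_isometry M \<xi> f"
proof -
  show f: "band_density f"
    using assms(2) unfolding has_spectral_density_def band_density_def set_integrable_leb_band by blast
  have "L2_inner M (\<xi> m) (\<xi> n) = L2_inner (spectral_measure f) (trig_exp m) (trig_exp n)" for m n
  proof -
    have "L2_inner M (\<xi> m) (\<xi> n) = 1 / (2 * pi) * (CLBINT t:{-pi..<pi}. cis (of_int (m - n) * t) * f t)"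
      using assms(2) unfolding has_spectral_density_def L2_inner_def
      by (metis add.commute diff_add_cancel)
    also have "\<dots> = L2_inner (spectral_measure f) (trig_exp m) (trig_exp n)"
      unfolding set_integral_leb_band
      by (subst L2_inner_spectral_measure[OF f])
        (auto simp: trig_exp_cnj trig_exp_mult, simp add: trig_exp_def mult.commute)
    finally show ?thesis .
  qed
  then show "spectral_isometry M \<xi> f"
    using assms(1) unfolding spectral_isometry_def stationary_seq_def by blast
qed

lemma (in prob_space) spectral_isometry_add:
  assumes f: "band_density f" "spectral_isometry M \<xi> f" and g: "band_density g" "spectral_isometry M \<eta> g"
    and unc: "uncorrelated_seqs M \<xi> \<eta>"
  shows "spectral_isometry M (\<lambda>m \<omega>. \<xi> m \<omega> + \<eta> m \<omega>) (\<lambda>t. f t + g t)"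
  unfolding spectral_isometry_def
proof (intro conjI allI)
  note L2 = spectral_isometry_L2[OF f(2)] spectral_isometry_L2[OF g(2)]
  show "(\<lambda>\<omega>. \<xi> m \<omega> + \<eta> m \<omega>) \<in> rv_space M" for m
    using f g by (intro rv_space_add spectral_isometry_rv)
  fix m n
  have 0: "L2_inner M (\<xi> m) (\<eta> n) = 0" for m n using unc by (simp add: uncorrelated_seqs_def L2_inner_def)
  have 00: "L2_inner M (\<eta> m) (\<xi> n) = 0" for m n using 0[of n m] L2_inner_commute[of M "\<eta> m" "\<xi> n"] by simp
  have int: "integrable leb_band (\<lambda>t. complex_of_real (h t) * trig_exp k t)" if "band_density h" for h k
    using integrable_trig_exp_mult[of "\<lambda>t. complex_of_real (h t)" k] that
    by (simp add: band_density_def mult.commute)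
  have e: "L2_inner (spectral_measure h) (trig_exp m) (trig_exp n) = 1 / (2 * pi) * (LINT t|leb_band. h t * trig_exp (m - n) t)"
    if "band_density h" for h
    by (subst L2_inner_spectral_measure[OF that]) (auto simp: trig_exp_cnj trig_exp_mult)
  have "L2_inner M (\<lambda>\<omega>. \<xi> m \<omega> + \<eta> m \<omega>) (\<lambda>\<omega>. \<xi> n \<omega> + \<eta> n \<omega>) = L2_inner M (\<xi> m) (\<xi> n) + L2_inner M (\<eta> m) (\<eta> n)"
    using L2 by (simp add: L2_inner_add_left L2_inner_add_right L2_fun_add 0 00)
  also have "\<dots> = L2_inner (spectral_measure f) (trig_exp m) (trig_exp n) + L2_inner (spectral_measure g) (trig_exp m) (trig_exp n)"
    using f(2) g(2) by (simp add: spectral_isometry_def)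
  also have "\<dots> = L2_inner (spectral_measure (\<lambda>t. f t + g t)) (trig_exp m) (trig_exp n)"
    using int[OF f(1)] int[OF g(1)]
    by (simp add: e f g e[OF band_density_add[OF f(1) g(1)]] distrib_right add_divide_distrib)
  finally show "L2_inner M (\<lambda>\<omega>. \<xi> m \<omega> + \<eta> m \<omega>) (\<lambda>\<omega>. \<xi> n \<omega> + \<eta> n \<omega>)
      = L2_inner (spectral_measure (\<lambda>t. f t + g t)) (trig_exp m) (trig_exp n)" .
qed

abbreviation (input) spectral_pairs :: "(int \<Rightarrow> 'w \<Rightarrow> complex) \<Rightarrow> (('w \<Rightarrow> complex) \<times> (real \<Rightarrow> complex)) set" where
  "spectral_pairs \<xi> \<equiv> {(\<xi> m, trig_exp m) | m. True}"

lemma spectral_pairs_sum: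
  "((\<lambda>\<omega>. \<Sum>k\<in>I. b k * \<xi> (j k) \<omega>), (\<lambda>t. \<Sum>k\<in>I. b k * trig_exp (j k) t)) \<in> lin_pairs (spectral_pairs \<xi>)"
  by (intro lin_pairs_sum lin_pairs.cmult lin_pairs.base) blast

lemma spectral_isometry_inner:
  assumes "band_density f" "spectral_isometry M \<xi> f"
    and "(X, Y) \<in> lin_pairs (spectral_pairs \<xi>)" "(X', Y') \<in> lin_pairs (spectral_pairs \<xi>)"
  shows "L2_inner M X X' = L2_inner (spectral_measure f) Y Y'"
  by (rule lin_pairs_inner[OF _ _ assms(3,4)]) (use assms(1,2) in \<open>auto simp: spectral_isometry_def rv_space_def\<close>)

lemma spectral_isometry_norm:
  assumes "band_density f" "spectral_isometry M \<xi> f" and "(X, Y) \<in> lin_pairs (spectral_pairs \<xi>)"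
  shows "L2_norm M X = L2_norm (spectral_measure f) Y"
  by (rule lin_pairs_norm[OF _ _ assms(3)]) (use assms(1,2) in \<open>auto simp: spectral_isometry_def rv_space_def\<close>)

text \<open>
  The isometry makes the sums of random variables a Cauchy sequence as soon as their spectral
  counterparts converge.
\<close>

lemma (in prob_space) spectral_isometry_limit:
  assumes f: "band_density f" and \<xi>: "spectral_isometry M \<xi> f"
    and lim: "L2_tendsto (spectral_measure f) (trig_sum j b) X"
  shows "\<exists>Y. Y \<in> rv_space M \<and> L2_tendsto M (\<lambda>n \<omega>. \<Sum>k<n. b k * \<xi> (j k) \<omega>) Y"
proof -
  let ?S = "\<lambda>n \<omega>. \<Sum>k<n. b k * \<xi> (j k) \<omega>" and ?p = "trig_sum j b"
  have S: "?S n \<in> rv_space M" for n by (intro rv_space_sum spectral_isometry_rv[OF \<xi>])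
  have "\<exists>Y. L2_tendsto M ?S Y"
  proof (rule L2_complete)
    show "?S n \<in> L2_fun M" for n by (rule rv_space_L2[OF S])
    fix e :: real assume "0 < e"
    then have "eventually (\<lambda>n. L2_norm (spectral_measure f) (\<lambda>t. ?p n t - X t) < e / 2) sequentially"
      by (intro order_tendstoD(2)[OF L2_tendsto_norm[OF lim]]) simp
    then obtain N where N: "\<And>n. N \<le> n \<Longrightarrow> L2_norm (spectral_measure f) (\<lambda>t. ?p n t - X t) < e / 2"
      by (auto simp: eventually_sequentially)
    show "\<exists>N. \<forall>m\<ge>N. \<forall>n\<ge>N. L2_norm M (\<lambda>\<omega>. ?S m \<omega> - ?S n \<omega>) < e"
    proof (intro exI allI impI)
      fix m n assume mn: "N \<le> m" "N \<le> n"
      have "L2_norm M (\<lambda>\<omega>. ?S m \<omega> - ?S n \<omega>) = L2_norm (spectral_measure f) (\<lambda>t. ?p m t - ?p n t)"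
        by (intro spectral_isometry_norm[OF f \<xi>] lin_pairs_diff spectral_pairs_sum)
      also have "\<dots> \<le> L2_norm (spectral_measure f) (\<lambda>t. ?p m t - X t) + L2_norm (spectral_measure f) (\<lambda>t. X t - ?p n t)"
        by (rule L2_norm_triangle_diff) (use lim in \<open>auto simp: L2_tendsto_def\<close>)
      also have "\<dots> < e" using N[OF mn(1)] N[OF mn(2)] by (simp add: L2_norm_minus_commute[of _ X])
      finally show "L2_norm M (\<lambda>\<omega>. ?S m \<omega> - ?S n \<omega>) < e" .
    qed
  qed
  then obtain Y where Y: "L2_tendsto M ?S Y" by blast
  show ?thesis by (intro exI[of _ Y] conjI Y rv_space_limit[OF _ Y] S)
qed

section \<open>Stochastic integrals\<close>

text \<open>
  The process is normalized at the left end of the band because the Gram matrix of these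
  increments is \<open>(x, y) \<mapsto> F(min x y)\<close>, with \<open>F\<close> the integrated
  density, and every other increment is a difference of two of them. Thereby step functions on
  different partitions can be compared without a common refinement.
\<close>

definition increment_pairs :: "(real \<Rightarrow> 'w \<Rightarrow> complex) \<Rightarrow> (('w \<Rightarrow> complex) \<times> (real \<Rightarrow> complex)) set" where
  "increment_pairs Z = {((\<lambda>\<omega>. Z x \<omega> - Z (-pi) \<omega>), (\<lambda>t. indicator {-pi..<x} t)) | x. -pi \<le> x \<and> x \<le> pi}"

lemma increment_rv:
  assumes "uncorrelated_increments M f Z" "-pi \<le> a" "a \<le> b" "b \<le> pi"
  shows "(\<lambda>\<omega>. Z b \<omega> - Z a \<omega>) \<in> rv_space M"
  using assms unfolding uncorrelated_increments_def by blast

lemma increment_pairs_L2: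
  assumes f: "band_density f" and Z: "uncorrelated_increments M f Z" and "(X, Y) \<in> increment_pairs Z"
  shows "X \<in> L2_fun M \<and> Y \<in> L2_fun (spectral_measure f)"
proof -
  interpret finite_measure "spectral_measure f" by (rule finite_spectral_measure[OF f])
  obtain x where x: "-pi \<le> x" "x \<le> pi" "X = (\<lambda>\<omega>. Z x \<omega> - Z (-pi) \<omega>)" "Y = (\<lambda>t. indicator {-pi..<x} t)"
    using assms(3) unfolding increment_pairs_def by auto
  have "Y \<in> L2_fun (spectral_measure f)"
    unfolding x by (rule L2_fun_bounded[where K = 1]) (auto simp: measurable_spectral_measure indicator_def[abs_def] intro!: measurable_leb_band)
  then show ?thesis using increment_rv[OF Z, of "-pi" x] x by (simp add: rv_space_L2)
qed

lemma increment_pairs_gram_le: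
  assumes f: "band_density f" and Z: "uncorrelated_increments M f Z" and xy: "-pi \<le> x" "x \<le> y" "y \<le> pi"
  shows "L2_inner M (\<lambda>\<omega>. Z x \<omega> - Z (-pi) \<omega>) (\<lambda>\<omega>. Z y \<omega> - Z (-pi) \<omega>)
    = L2_inner (spectral_measure f) (\<lambda>t. indicator {-pi..<x} t) (\<lambda>t. indicator {-pi..<y} t)"
proof -
  let ?u = "\<lambda>x \<omega>. Z x \<omega> - Z (-pi) \<omega>"
  have u: "?u x \<in> L2_fun M" "(\<lambda>\<omega>. Z y \<omega> - Z x \<omega>) \<in> L2_fun M"
    using increment_rv[OF Z, of "-pi" x] increment_rv[OF Z, of x y] xy by (auto intro: rv_space_L2)
  have "L2_inner M (?u x) (?u y) = L2_inner M (?u x) (\<lambda>\<omega>. ?u x \<omega> + (Z y \<omega> - Z x \<omega>))" by simp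
  also have "\<dots> = L2_inner M (?u x) (?u x) + L2_inner M (?u x) (\<lambda>\<omega>. Z y \<omega> - Z x \<omega>)"
    by (rule L2_inner_add_right) (use u in auto)
  also have "L2_inner M (?u x) (\<lambda>\<omega>. Z y \<omega> - Z x \<omega>) = 0"
    using Z xy unfolding uncorrelated_increments_def L2_inner_def by blast
  also have "L2_inner M (?u x) (?u x) = complex_of_real (1 / (2 * pi) * (LBINT t:{-pi..<x}. f t))"
    using Z xy unfolding uncorrelated_increments_def L2_inner_self L2_norm_sq by simp
  also have "(LBINT t:{-pi..<x}. f t) = (LINT t|leb_band. f t * indicator {-pi..<x} t)"
    unfolding set_integral_leb_band[symmetric] set_lebesgue_integral_def
    using xy by (intro Bochner_Integration.integral_cong refl) (auto simp: indicator_def)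
  also have "complex_of_real (1 / (2 * pi) * (LINT t|leb_band. f t * indicator {-pi..<x} t))
     = 1 / (2 * pi) * (LINT t|leb_band. complex_of_real (f t * indicator {-pi..<x} t))"
    unfolding integral_complex_of_real by simp
  also have "\<dots> = L2_inner (spectral_measure f) (\<lambda>t. indicator {-pi..<x} t) (\<lambda>t. indicator {-pi..<y} t)"
  proof (subst L2_inner_spectral_measure[OF f])
    have "complex_of_real (f t * indicator {-pi..<x} t)
      = complex_of_real (f t) * (indicator {-pi..<x} t * cnj (indicator {-pi..<y} t))" for t
      using xy by (auto simp: indicator_def)
    then show "1 / (2 * pi) * (LINT t|leb_band. complex_of_real (f t * indicator {-pi..<x} t))
      = 1 / (2 * pi) * (LINT t|leb_band. complex_of_real (f t) * (indicator {-pi..<x} t * cnj (indicator {-pi..<y} t)))"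
      by (simp only:)
  qed (auto intro!: measurable_leb_band)
  finally show ?thesis by simp
qed

lemma increment_pairs_gram:
  assumes f: "band_density f" and Z: "uncorrelated_increments M f Z"
    and p: "(X, Y) \<in> increment_pairs Z" "(X', Y') \<in> increment_pairs Z"
  shows "L2_inner M X X' = L2_inner (spectral_measure f) Y Y'"
proof -
  obtain x where x: "-pi \<le> x" "x \<le> pi" "X = (\<lambda>\<omega>. Z x \<omega> - Z (-pi) \<omega>)" "Y = (\<lambda>t. indicator {-pi..<x} t)"
    using p(1) unfolding increment_pairs_def by auto
  obtain y where y: "-pi \<le> y" "y \<le> pi" "X' = (\<lambda>\<omega>. Z y \<omega> - Z (-pi) \<omega>)" "Y' = (\<lambda>t. indicator {-pi..<y} t)"
    using p(2) unfolding increment_pairs_def by auto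
  show ?thesis
  proof (cases "x \<le> y")
    case True
    then show ?thesis using increment_pairs_gram_le[OF f Z] x y by simp
  next
    case False
    then have "L2_inner M X' X = L2_inner (spectral_measure f) Y' Y"
      using increment_pairs_gram_le[OF f Z, of y x] x y by simp
    then show ?thesis using L2_inner_commute by metis
  qed
qed

lemma band_partition_bounds:
  assumes "band_partition n s"
  shows "i \<le> n \<Longrightarrow> -pi \<le> s i" "i \<le> n \<Longrightarrow> s i \<le> pi"
proof -
  have mono: "s i \<le> s (Suc i)" if "i < n" for i using assms that by (auto simp: band_partition_def)
  have lo: "i \<le> n \<longrightarrow> -pi \<le> s i" for i
  proof (induction i)
    case 0
    then show ?case using assms by (simp add: band_partition_def)
  next
    case (Suc i)
    then show ?case using mono[of i] by auto
  qed
  then show "i \<le> n \<Longrightarrow> -pi \<le> s i" by blast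
  assume "i \<le> n"
  then have "s i \<le> s n" by (induction rule: inc_induct) (use mono order_trans in blast)+
  then show "s i \<le> pi" using assms by (simp add: band_partition_def)
qed

lemma step_pair:
  assumes "band_partition n s"
  shows "(step_integral Z n s c, step_fun n s c) \<in> lin_pairs (increment_pairs Z)"
proof -
  have "((\<lambda>\<omega>. \<Sum>i<n. c i * ((Z (s (Suc i)) \<omega> - Z (-pi) \<omega>) - (Z (s i) \<omega> - Z (-pi) \<omega>))),
      (\<lambda>t. \<Sum>i<n. c i * (indicator {-pi..<s (Suc i)} t - indicator {-pi..<s i} t))) \<in> lin_pairs (increment_pairs Z)"
    by (intro lin_pairs_sum lin_pairs.cmult lin_pairs_diff lin_pairs.base)
      (auto simp: increment_pairs_def intro!: exI band_partition_bounds[OF assms])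
  moreover have "(\<lambda>t. \<Sum>i<n. c i * (indicator {-pi..<s (Suc i)} t - indicator {-pi..<s i} t)) = step_fun n s c"
  proof
    fix t
    have "indicator {-pi..<s (Suc i)} t - indicator {-pi..<s i} t = (indicator {s i..<s (Suc i)} t :: complex)" if "i < n" for i
      using band_partition_bounds[OF assms, of i] assms that by (auto simp: indicator_def band_partition_def)
    then show "(\<Sum>i<n. c i * (indicator {-pi..<s (Suc i)} t - indicator {-pi..<s i} t)) = step_fun n s c t"
      unfolding step_fun_def by (intro sum.cong) auto
  qed
  moreover have "(\<lambda>\<omega>. \<Sum>i<n. c i * ((Z (s (Suc i)) \<omega> - Z (-pi) \<omega>) - (Z (s i) \<omega> - Z (-pi) \<omega>))) = step_integral Z n s c"
    by (simp add: step_integral_def fun_eq_iff)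
  ultimately show ?thesis by simp
qed

lemma increment_pairs_norm:
  assumes f: "band_density f" and Z: "uncorrelated_increments M f Z" and p: "(X, Y) \<in> lin_pairs (increment_pairs Z)"
  shows "L2_norm M X = L2_norm (spectral_measure f) Y" "X \<in> L2_fun M" "Y \<in> L2_fun (spectral_measure f)"
proof -
  note L2 = increment_pairs_L2[OF f Z]
  show "L2_norm M X = L2_norm (spectral_measure f) Y"
    by (rule lin_pairs_norm[OF _ _ p]) (use L2 increment_pairs_gram[OF f Z] in blast)+
  show "X \<in> L2_fun M" by (rule lin_pairs_L2(1)[OF _ p]) (rule L2)
  show "Y \<in> L2_fun (spectral_measure f)" by (rule lin_pairs_L2(2)[OF _ p]) (rule L2)
qed

text \<open>
  The isometry for step functions passes to the limit, whatever approximating sequence defines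
  the integral.
\<close>

lemma stoch_integral_step_norm:
  assumes f: "band_density f" and Z: "uncorrelated_increments M f Z"
    and h: "has_stoch_integral M f Z h Y" and s: "band_partition n s"
  shows "L2_norm M (\<lambda>\<omega>. Y \<omega> - step_integral Z n s c \<omega>) = L2_norm (spectral_measure f) (\<lambda>t. h t - step_fun n s c t)"
proof -
  obtain n' s' c' where p: "\<And>j. band_partition (n' j) (s' j)"
    and 1: "L2_tendsto (spectral_measure f) (\<lambda>j. step_fun (n' j) (s' j) (c' j)) h"
    and 2: "L2_tendsto M (\<lambda>j. step_integral Z (n' j) (s' j) (c' j)) Y"
    using h unfolding has_stoch_integral_def by blast
  note sp = increment_pairs_norm[OF f Z step_pair[OF s, of Z c]]
  have "(\<lambda>j. (L2_norm M (\<lambda>\<omega>. step_integral Z (n' j) (s' j) (c' j) \<omega> - step_integral Z n s c \<omega>))\<^sup>2)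
      \<longlonglongrightarrow> (L2_norm M (\<lambda>\<omega>. Y \<omega> - step_integral Z n s c \<omega>))\<^sup>2"
    by (intro L2_norm_tendsto L2_tendsto_diff 2 L2_tendsto_const sp)
  moreover have "L2_norm M (\<lambda>\<omega>. step_integral Z (n' j) (s' j) (c' j) \<omega> - step_integral Z n s c \<omega>)
      = L2_norm (spectral_measure f) (\<lambda>t. step_fun (n' j) (s' j) (c' j) t - step_fun n s c t)" for j
    by (intro increment_pairs_norm(1)[OF f Z] lin_pairs_diff step_pair p s)
  moreover have "(\<lambda>j. (L2_norm (spectral_measure f) (\<lambda>t. step_fun (n' j) (s' j) (c' j) t - step_fun n s c t))\<^sup>2)
      \<longlonglongrightarrow> (L2_norm (spectral_measure f) (\<lambda>t. h t - step_fun n s c t))\<^sup>2"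
    by (intro L2_norm_tendsto L2_tendsto_diff 1 L2_tendsto_const sp)
  ultimately have "(L2_norm M (\<lambda>\<omega>. Y \<omega> - step_integral Z n s c \<omega>))\<^sup>2 = (L2_norm (spectral_measure f) (\<lambda>t. h t - step_fun n s c t))\<^sup>2"
    by (simp add: LIMSEQ_unique)
  then show ?thesis by (simp add: power2_eq_iff_nonneg)
qed

definition uniform_node :: "nat \<Rightarrow> nat \<Rightarrow> real" where
  "uniform_node n i = -pi + 2 * pi * real i / real (Suc n)"

abbreviation "sample_fun n p \<equiv> step_fun (Suc n) (uniform_node n) (\<lambda>i. p (uniform_node n i))"
abbreviation "sample_integral Z n p \<equiv> step_integral Z (Suc n) (uniform_node n) (\<lambda>i. p (uniform_node n i))"

lemma uniform_partition: "band_partition (Suc n) (uniform_node n)"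
  unfolding band_partition_def uniform_node_def
  by (auto intro!: divide_right_mono mult_left_mono simp: algebra_simps simp del: of_nat_Suc)

text \<open>
  At each point the sampled function takes the value at the left end of the cell containing the
  point; the same \<open>x\<close> serves all functions.
\<close>

lemma sample_fun_near:
  assumes t: "t \<in> {-pi..<pi}"
  obtains x where "\<And>p. sample_fun n p t = p x" "\<bar>x - t\<bar> \<le> 2 * pi / real (Suc n)"
proof -
  define y where "y = (t + pi) * real (Suc n) / (2 * pi)"
  define i where "i = nat \<lfloor>y\<rfloor>"
  have y: "0 \<le> y" "y < real (Suc n)"
  proof -
    show "0 \<le> y" unfolding y_def using t by (intro divide_nonneg_pos mult_nonneg_nonneg) auto
    have "(t + pi) * real (Suc n) < (2 * pi) * real (Suc n)"
      using t by (intro mult_strict_right_mono) auto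
    then show "y < real (Suc n)" unfolding y_def by (simp add: field_simps del: of_nat_Suc)
  qed
  have i: "real i \<le> y" "y < real i + 1" unfolding i_def using y(1) by linarith+
  have in_iff: "t \<in> {uniform_node n k..<uniform_node n (Suc k)} \<longleftrightarrow> k = i" for k
  proof -
    have "t \<in> {uniform_node n k..<uniform_node n (Suc k)} \<longleftrightarrow> real k \<le> y \<and> y < real (Suc k)"
      unfolding uniform_node_def y_def by (auto simp: field_simps simp del: of_nat_Suc)
    also have "\<dots> \<longleftrightarrow> k = i" using i by auto
    finally show ?thesis .
  qed
  have "sample_fun n p t = p (uniform_node n i)" for p
  proof -
    have "sample_fun n p t = (\<Sum>k<Suc n. if k = i then p (uniform_node n k) else 0)"
      unfolding step_fun_def by (intro sum.cong refl) (use in_iff in \<open>simp add: indicator_def\<close>)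
    also have "\<dots> = p (uniform_node n i)" using i(1) y(2) by (subst sum.delta) auto
    finally show ?thesis .
  qed
  moreover have "\<bar>uniform_node n i - t\<bar> \<le> 2 * pi / real (Suc n)"
  proof -
    have "uniform_node n i - t = (real i - y) * (2 * pi / real (Suc n))"
      unfolding uniform_node_def y_def by (simp add: field_simps del: of_nat_Suc)
    moreover have "\<bar>real i - y\<bar> \<le> 1" using i by linarith
    ultimately show ?thesis using mult_right_mono[of "\<bar>real i - y\<bar>" 1 "2 * pi / real (Suc n)"]
      by (simp add: abs_mult del: of_nat_Suc)
  qed
  ultimately show ?thesis by (rule that)
qed

lemma sample_fun_tendsto:
  assumes f: "band_density f"
    and cont: "continuous_on UNIV p" and bd: "\<And>t. cmod (p t) \<le> K"
  shows "L2_tendsto (spectral_measure f) (\<lambda>n. sample_fun n p) p"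
proof -
  interpret finite_measure "spectral_measure f" by (rule finite_spectral_measure[OF f])
  have sp: "space (spectral_measure f) = {-pi..<pi}" by (simp add: spectral_measure_def)
  show ?thesis
  proof (rule L2_tendsto_bounded_pointwise[where K = K])
    show "sample_fun n p \<in> borel_measurable (spectral_measure f)" for n
    proof -
      have "(\<lambda>t. \<Sum>i<Suc n. p (uniform_node n i) * indicator {uniform_node n i..<uniform_node n (Suc i)} t) \<in> borel_measurable borel"
        by (intro borel_measurable_sum borel_measurable_times borel_measurable_const borel_measurable_indicator) simp
      then show ?thesis unfolding measurable_spectral_measure step_fun_def[abs_def] by (rule measurable_leb_band)
    qed
    show "p \<in> borel_measurable (spectral_measure f)"
      unfolding measurable_spectral_measure by (intro measurable_leb_band borel_measurable_continuous_onI cont)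
    show "AE t in spectral_measure f. cmod (sample_fun n p t) \<le> K" for n
    proof (rule AE_I2, unfold sp)
      fix t assume "t \<in> {-pi..<pi}"
      then obtain x where "\<And>q::real \<Rightarrow> complex. sample_fun n q t = q x" using sample_fun_near by metis
      then show "cmod (sample_fun n p t) \<le> K" using bd[of x] by simp
    qed
    show "AE t in spectral_measure f. (\<lambda>n. sample_fun n p t) \<longlonglongrightarrow> p t"
    proof (rule AE_I2, unfold sp)
      fix t assume t: "t \<in> {-pi..<pi}"
      have "\<forall>n. \<exists>x. sample_fun n p t = p x \<and> \<bar>x - t\<bar> \<le> 2 * pi / real (Suc n)"
        using sample_fun_near[OF t] by metis
      then obtain x where x: "\<And>n. sample_fun n p t = p (x n)" "\<And>n. \<bar>x n - t\<bar> \<le> 2 * pi / real (Suc n)" by metis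
      have "(\<lambda>n. x n - t) \<longlonglongrightarrow> 0"
        by (rule Lim_null_comparison[OF _ LIMSEQ_Suc[OF lim_const_over_n[of "2 * pi"]]])
          (use x(2) in auto)
      then have "x \<longlonglongrightarrow> t" by (simp add: LIM_zero_iff)
      moreover have "isCont p t" using cont by (simp add: continuous_on_eq_continuous_at)
      ultimately show "(\<lambda>n. sample_fun n p t) \<longlonglongrightarrow> p t"
        unfolding x by (rule isCont_tendsto_compose[rotated])
    qed
  qed
qed

lemma continuous_trig_exp [continuous_intros]: "continuous_on S (trig_exp m)"
  unfolding trig_exp_def by (intro continuous_intros)

lemma sample_trig_tendsto:
  assumes f: "band_density f"
  shows "L2_tendsto (spectral_measure f) (\<lambda>n. sample_fun n (\<lambda>t. \<Sum>k\<in>I. b k * trig_exp (j k) t)) (\<lambda>t. \<Sum>k\<in>I. b k * trig_exp (j k) t)"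
proof (rule sample_fun_tendsto[OF f, where K = "\<Sum>k\<in>I. cmod (b k)"])
  show "continuous_on UNIV (\<lambda>t. \<Sum>k\<in>I. b k * trig_exp (j k) t)" by (intro continuous_intros)
  show "cmod (\<Sum>k\<in>I. b k * trig_exp (j k) t) \<le> (\<Sum>k\<in>I. cmod (b k))" for t
    by (rule order_trans[OF norm_sum]) (simp add: norm_mult)
qed

text \<open>
  The step functions that define the integrals of \<open>exp(i m t)\<close> with respect to two
  different processes are unrelated. Samples on uniform partitions approximate in every spectral
  measure at once, so that their integrals with respect to the two processes can be added.
\<close>

lemma sample_integral_tendsto:
  assumes f: "band_density f" and rep: "spectral_representation M f Z \<xi>"
  shows "L2_tendsto M (\<lambda>n. sample_integral Z n (\<lambda>t. \<Sum>k\<in>I. b k * trig_exp (j k) t)) (\<lambda>\<omega>. \<Sum>k\<in>I. b k * \<xi> (j k) \<omega>)"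
proof -
  have Z: "uncorrelated_increments M f Z" and h: "\<And>m. has_stoch_integral M f Z (trig_exp m) (\<xi> m)"
    using rep by (auto simp: spectral_representation_def trig_exp_def[abs_def])
  have single: "L2_tendsto M (\<lambda>n. sample_integral Z n (trig_exp m)) (\<xi> m)" for m
    unfolding L2_tendsto_iff
  proof (intro conjI allI)
    show "sample_integral Z n (trig_exp m) \<in> L2_fun M" for n
      by (rule increment_pairs_norm(2)[OF f Z step_pair[OF uniform_partition]])
    show "\<xi> m \<in> L2_fun M" using h by (auto simp: has_stoch_integral_def rv_space_def)
    have "L2_tendsto (spectral_measure f) (\<lambda>n. sample_fun n (trig_exp m)) (trig_exp m)"
      using sample_trig_tendsto[OF f, where I = "{m}" and b = "\<lambda>_. 1" and j = "\<lambda>m. m"] by simp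
    then show "(\<lambda>n. L2_norm M (\<lambda>\<omega>. sample_integral Z n (trig_exp m) \<omega> - \<xi> m \<omega>)) \<longlonglongrightarrow> 0"
      unfolding L2_norm_minus_commute[of M _ "\<xi> m"] stoch_integral_step_norm[OF f Z h uniform_partition]
      by (simp add: L2_norm_minus_commute[of _ "trig_exp m"] L2_tendsto_iff)
  qed
  have "sample_integral Z n (\<lambda>t. \<Sum>k\<in>I. b k * trig_exp (j k) t) = (\<lambda>\<omega>. \<Sum>k\<in>I. b k * sample_integral Z n (trig_exp (j k)) \<omega>)" for n
    unfolding step_integral_def
    by (rule ext) (simp only: sum_distrib_left sum_distrib_right mult.assoc, rule sum.swap)
  then show ?thesis
    using L2_tendsto_sum[of I M "\<lambda>k n \<omega>. b k * sample_integral Z n (trig_exp (j k)) \<omega>" "\<lambda>k \<omega>. b k * \<xi> (j k) \<omega>"]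
      L2_tendsto_cmult[OF single] by simp
qed

lemma step_integral_add:
  "step_integral (\<lambda>t \<omega>. Z t \<omega> + Z' t \<omega>) n s c = (\<lambda>\<omega>. step_integral Z n s c \<omega> + step_integral Z' n s c \<omega>)"
  unfolding step_integral_def by (simp add: sum.distrib[symmetric] algebra_simps)

text \<open>
  Each trigonometric polynomial \<open>p n\<close> is close to a step function whose integral is
  close to the corresponding combination of random variables; a diagonal choice of step
  functions then tends to \<open>h\<close>, and their integrals to \<open>Y\<close>.
\<close>

theorem stoch_integral_of_limit:
  assumes f: "band_density f" "spectral_representation M f Z\<^sub>\<xi> \<xi>"
    and g: "band_density g" "spectral_representation M g Z\<^sub>\<eta> \<eta>"
    and h: "L2_tendsto (spectral_measure (\<lambda>t. f t + g t)) (trig_sum j b) h"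
    and Y: "L2_tendsto M (\<lambda>n \<omega>. \<Sum>k<n. b k * (\<xi> (j k) \<omega> + \<eta> (j k) \<omega>)) Y" "Y \<in> rv_space M"
  shows "has_stoch_integral M (\<lambda>t. f t + g t) (\<lambda>t \<omega>. Z\<^sub>\<xi> t \<omega> + Z\<^sub>\<eta> t \<omega>) h Y"
proof -
  let ?w = "\<lambda>t. f t + g t" and ?Z = "\<lambda>t \<omega>. Z\<^sub>\<xi> t \<omega> + Z\<^sub>\<eta> t \<omega>"
  let ?p = "trig_sum j b" and ?X = "\<lambda>n \<omega>. \<Sum>k<n. b k * (\<xi> (j k) \<omega> + \<eta> (j k) \<omega>)"
  note w = band_density_add[OF f(1) g(1)]
  have samp: "L2_tendsto (spectral_measure ?w) (\<lambda>m. sample_fun m (?p n)) (?p n)" for n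
    by (rule sample_trig_tendsto[OF w])
  have sampI: "L2_tendsto M (\<lambda>m. sample_integral ?Z m (?p n)) (?X n)" for n
  proof -
    have "?X n = (\<lambda>\<omega>. (\<Sum>k<n. b k * \<xi> (j k) \<omega>) + (\<Sum>k<n. b k * \<eta> (j k) \<omega>))"
      by (simp add: sum.distrib distrib_left)
    then show ?thesis
      unfolding step_integral_add using sample_integral_tendsto[OF f, where I = "{..<n}" and b = b and j = j]
        sample_integral_tendsto[OF g, where I = "{..<n}" and b = b and j = j]
      by (simp only:) (rule L2_tendsto_add)
  qed
  define good where "good n m \<longleftrightarrow>
      L2_norm (spectral_measure ?w) (\<lambda>t. ?p n t - sample_fun m (?p n) t) < 1 / real (Suc n) \<and>
      L2_norm M (\<lambda>\<omega>. ?X n \<omega> - sample_integral ?Z m (?p n) \<omega>) < 1 / real (Suc n)" for n m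
  have "\<exists>m. good n m" for n
  proof -
    have "eventually (\<lambda>m. L2_norm (spectral_measure ?w) (\<lambda>t. ?p n t - sample_fun m (?p n) t) < 1 / real (Suc n)) sequentially"
      unfolding L2_norm_minus_commute[of "spectral_measure ?w" "?p n"]
      by (intro order_tendstoD(2)[OF L2_tendsto_norm[OF samp]]) simp
    moreover have "eventually (\<lambda>m. L2_norm M (\<lambda>\<omega>. ?X n \<omega> - sample_integral ?Z m (?p n) \<omega>) < 1 / real (Suc n)) sequentially"
      unfolding L2_norm_minus_commute[of M "?X n"]
      by (intro order_tendstoD(2)[OF L2_tendsto_norm[OF sampI]]) simp
    ultimately have "eventually (good n) sequentially" unfolding good_def by (rule eventually_conj)
    then show ?thesis unfolding eventually_sequentially by blast
  qed
  then obtain \<mu> where good: "\<And>n. good n (\<mu> n)" by metis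
  have \<mu>: "L2_norm (spectral_measure ?w) (\<lambda>t. ?p n t - sample_fun (\<mu> n) (?p n) t) < 1 / real (Suc n)"
      "L2_norm M (\<lambda>\<omega>. ?X n \<omega> - sample_integral ?Z (\<mu> n) (?p n) \<omega>) < 1 / real (Suc n)" for n
    using good[of n] unfolding good_def by blast+
  have null: "(\<lambda>n. r n) \<longlonglongrightarrow> 0" if "\<And>n. 0 \<le> r n" "\<And>n. r n < 1 / real (Suc n)" for r :: "nat \<Rightarrow> real"
    by (rule Lim_null_comparison[OF _ LIMSEQ_Suc[OF lim_1_over_n]])
      (use that in \<open>auto simp: less_imp_le simp del: of_nat_Suc\<close>)
  show ?thesis
    unfolding has_stoch_integral_def
  proof (intro conjI Y exI allI)
    show "band_partition (Suc (\<mu> n)) (uniform_node (\<mu> n))" for n by (rule uniform_partition)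
    show "L2_tendsto (spectral_measure ?w) (\<lambda>n. sample_fun (\<mu> n) (?p n)) h"
      by (rule L2_tendsto_shift_diff[OF h]) (use samp in \<open>auto intro!: null \<mu> dest: L2_tendsto_fun\<close>)
    show "L2_tendsto M (\<lambda>n. sample_integral ?Z (\<mu> n) (?p n)) Y"
      by (rule L2_tendsto_shift_diff[OF Y(1)]) (use sampI in \<open>auto intro!: null \<mu> dest: L2_tendsto_fun\<close>)
  qed
qed

text \<open>
  Two sequences of step functions with the same limit have differences tending to
  \<open>0\<close> in both spectral measures. The two isometries and the triangle inequality
  carry this over to the integrals.
\<close>

theorem stoch_integral_unique:
  assumes f: "band_density f" "uncorrelated_increments M f Z\<^sub>\<xi>"
    and g: "band_density g" "uncorrelated_increments M g Z\<^sub>\<eta>"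
    and Y: "has_stoch_integral M (\<lambda>t. f t + g t) (\<lambda>t \<omega>. Z\<^sub>\<xi> t \<omega> + Z\<^sub>\<eta> t \<omega>) h Y"
    and Y': "has_stoch_integral M (\<lambda>t. f t + g t) (\<lambda>t \<omega>. Z\<^sub>\<xi> t \<omega> + Z\<^sub>\<eta> t \<omega>) h Y'"
  shows "AE \<omega> in M. Y \<omega> = Y' \<omega>"
proof -
  let ?w = "\<lambda>t. f t + g t" and ?Z = "\<lambda>t \<omega>. Z\<^sub>\<xi> t \<omega> + Z\<^sub>\<eta> t \<omega>"
  note w = band_density_add[OF f(1) g(1)]
  obtain n s c where p: "\<And>j. band_partition (n j) (s j)"
    and 1: "L2_tendsto (spectral_measure ?w) (\<lambda>j. step_fun (n j) (s j) (c j)) h"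
    and 2: "L2_tendsto M (\<lambda>j. step_integral ?Z (n j) (s j) (c j)) Y"
    using Y unfolding has_stoch_integral_def by blast
  obtain n' s' c' where p': "\<And>j. band_partition (n' j) (s' j)"
    and 3: "L2_tendsto (spectral_measure ?w) (\<lambda>j. step_fun (n' j) (s' j) (c' j)) h"
    and 4: "L2_tendsto M (\<lambda>j. step_integral ?Z (n' j) (s' j) (c' j)) Y'"
    using Y' unfolding has_stoch_integral_def by blast
  let ?d = "\<lambda>j t. step_fun (n j) (s j) (c j) t - step_fun (n' j) (s' j) (c' j) t"
  let ?I = "\<lambda>Z j \<omega>. step_integral Z (n j) (s j) (c j) \<omega> - step_integral Z (n' j) (s' j) (c' j) \<omega>"
  have d: "L2_tendsto (spectral_measure ?w) ?d (\<lambda>t. h t - h t)" by (rule L2_tendsto_diff[OF 1 3])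
  have dn: "(\<lambda>j. L2_norm (spectral_measure ?w) (?d j)) \<longlonglongrightarrow> 0" using L2_tendsto_norm[OF d] by simp
  have dL: "?d j \<in> L2_fun (spectral_measure ?w)" for j using L2_tendsto_fun[OF d] .
  have dL': "?d j \<in> L2_fun (spectral_measure (\<lambda>t. g t + f t))" for j using dL by (simp add: add.commute)
  have pair: "(?I Z j, ?d j) \<in> lin_pairs (increment_pairs Z)" for Z :: "real \<Rightarrow> 'a \<Rightarrow> complex" and j
    by (intro lin_pairs_diff step_pair p p')
  have bound: "L2_norm M (?I ?Z j) \<le> 2 * L2_norm (spectral_measure ?w) (?d j)" for j
  proof -
    have "?I ?Z j = (\<lambda>\<omega>. ?I Z\<^sub>\<xi> j \<omega> + ?I Z\<^sub>\<eta> j \<omega>)" unfolding step_integral_add by (simp add: algebra_simps)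
    then have "L2_norm M (?I ?Z j) \<le> L2_norm M (?I Z\<^sub>\<xi> j) + L2_norm M (?I Z\<^sub>\<eta> j)"
      using L2_norm_triangle[OF increment_pairs_norm(2)[OF f pair] increment_pairs_norm(2)[OF g pair], of j j] by simp
    also have "\<dots> = L2_norm (spectral_measure f) (?d j) + L2_norm (spectral_measure g) (?d j)"
      by (simp only: increment_pairs_norm(1)[OF f pair] increment_pairs_norm(1)[OF g pair])
    also have "\<dots> \<le> 2 * L2_norm (spectral_measure ?w) (?d j)"
      using L2_fun_spectral_sumD(2)[OF f(1) g(1) dL, of j] L2_fun_spectral_sumD(2)[OF g(1) f(1) dL', of j]
      by (simp add: add.commute[of "g _"])
    finally show ?thesis .
  qed
  have "(\<lambda>j. L2_norm M (?I ?Z j)) \<longlonglongrightarrow> 0"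
  proof (rule Lim_null_comparison[OF always_eventually])
    show "\<forall>j. norm (L2_norm M (?I ?Z j)) \<le> 2 * L2_norm (spectral_measure ?w) (?d j)" using bound by simp
    show "(\<lambda>j. 2 * L2_norm (spectral_measure ?w) (?d j)) \<longlonglongrightarrow> 0" using tendsto_mult_left[OF dn, of 2] by simp
  qed
  then have "L2_tendsto M (\<lambda>j. step_integral ?Z (n' j) (s' j) (c' j)) Y"
    by (intro L2_tendsto_shift_diff[OF 2]) (use L2_tendsto_fun[OF 4] in auto)
  from L2_tendsto_unique[OF this 4] show ?thesis .
qed

lemma has_stoch_integral_cong_AE:
  assumes "has_stoch_integral M w Z h Y" "Y' \<in> rv_space M" "AE \<omega> in M. Y \<omega> = Y' \<omega>"
  shows "has_stoch_integral M w Z h Y'"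
  using assms L2_tendsto_cong_AE[OF _ L2_fun_measurable[OF rv_space_L2[OF assms(2)]] assms(3)]
  unfolding has_stoch_integral_def by blast

section \<open>Orthogonal projections\<close>

text \<open>
  Different indices may carry the same random variable, and \<open>lin_combs\<close> is indexed
  by the variables themselves, so the coefficients of equal variables have to be added.
\<close>

lemma sum_in_lin_combs:
  assumes "finite I" "\<And>k. k \<in> I \<Longrightarrow> \<zeta> (j k) \<in> S"
  shows "(\<lambda>\<omega>. \<Sum>k\<in>I. b k * \<zeta> (j k) \<omega>) \<in> lin_combs S"
proof -
  have "(\<lambda>\<omega>. \<Sum>k\<in>I. b k * \<zeta> (j k) \<omega>) = (\<lambda>\<omega>. \<Sum>X\<in>(\<lambda>k. \<zeta> (j k)) ` I. (\<Sum>k\<in>{k\<in>I. \<zeta> (j k) = X}. b k) * X \<omega>)"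
  proof
    fix \<omega>
    have "(\<Sum>k\<in>I. b k * \<zeta> (j k) \<omega>) = (\<Sum>X\<in>(\<lambda>k. \<zeta> (j k)) ` I. \<Sum>k\<in>{k\<in>I. \<zeta> (j k) = X}. b k * \<zeta> (j k) \<omega>)"
      by (rule sum.image_gen[OF assms(1)])
    also have "\<dots> = (\<Sum>X\<in>(\<lambda>k. \<zeta> (j k)) ` I. (\<Sum>k\<in>{k\<in>I. \<zeta> (j k) = X}. b k) * X \<omega>)"
      unfolding sum_distrib_right by (intro sum.cong refl) auto
    finally show "(\<Sum>k\<in>I. b k * \<zeta> (j k) \<omega>) = (\<Sum>X\<in>(\<lambda>k. \<zeta> (j k)) ` I. (\<Sum>k\<in>{k\<in>I. \<zeta> (j k) = X}. b k) * X \<omega>)" .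
  qed
  moreover have "finite ((\<lambda>k. \<zeta> (j k)) ` I)" "(\<lambda>k. \<zeta> (j k)) ` I \<subseteq> S" using assms by auto
  ultimately show ?thesis unfolding lin_combs_def mem_Collect_eq by (intro exI conjI)
qed

lemma orthogonal_closed_lin_span:
  assumes D: "D \<in> L2_fun M" and S: "S \<subseteq> L2_fun M" and orth: "\<And>X. X \<in> S \<Longrightarrow> L2_inner M D X = 0"
    and W: "W \<in> closed_lin_span M S"
  shows "L2_inner M D W = 0"
proof -
  obtain Ys where Ys: "\<And>n. Ys n \<in> lin_combs S" "L2_tendsto M Ys W"
    using W unfolding closed_lin_span_def by blast
  have "L2_inner M D (Ys n) = 0" for n
  proof -
    obtain T c where T: "T \<subseteq> S" "Ys n = (\<lambda>\<omega>. \<Sum>X\<in>T. c X * X \<omega>)"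
      using Ys(1)[of n] unfolding lin_combs_def by blast
    have "L2_inner M D (Ys n) = (\<Sum>X\<in>T. L2_inner M D (\<lambda>\<omega>. c X * X \<omega>))"
      unfolding T by (rule L2_inner_sum_right) (use T(1) S D in auto)
    then show ?thesis using T(1) orth by (auto simp: L2_inner_cmult_right intro!: sum.neutral)
  qed
  moreover have "(\<lambda>n. L2_inner M D (Ys n)) \<longlonglongrightarrow> L2_inner M D W"
    by (intro L2_inner_tendsto L2_tendsto_const D Ys)
  ultimately show ?thesis by (simp add: LIMSEQ_const_iff)
qed

lemma is_orth_projection_iff:
  "is_orth_projection M S X Y \<longleftrightarrow> Y \<in> S \<and> (\<forall>W\<in>S. L2_inner M (\<lambda>\<omega>. X \<omega> - Y \<omega>) W = 0)"
  by (simp add: is_orth_projection_def L2_inner_def)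

lemma orth_projection_unique:
  assumes X: "X \<in> L2_fun M" and S: "S \<subseteq> L2_fun M"
    and Y: "is_orth_projection M S X Y" and Y': "is_orth_projection M S X Y'"
  shows "AE \<omega> in M. Y \<omega> = Y' \<omega>"
proof -
  have YL: "Y \<in> L2_fun M" "Y' \<in> L2_fun M" using Y Y' S by (auto simp: is_orth_projection_iff)
  have "L2_inner M (\<lambda>\<omega>. Y \<omega> - Y' \<omega>) W = 0" if W: "W \<in> S" for W
  proof -
    have WL: "W \<in> L2_fun M" using W S by auto
    have "L2_inner M (\<lambda>\<omega>. X \<omega> - Y' \<omega>) W - L2_inner M (\<lambda>\<omega>. X \<omega> - Y \<omega>) W = L2_inner M (\<lambda>\<omega>. Y \<omega> - Y' \<omega>) W"
      using X YL WL by (simp add: L2_inner_diff_left)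
    then show ?thesis using Y Y' W by (simp add: is_orth_projection_iff)
  qed
  then have "L2_inner M (\<lambda>\<omega>. Y \<omega> - Y' \<omega>) (\<lambda>\<omega>. Y \<omega> - Y' \<omega>) = 0"
    using YL Y Y' by (simp add: L2_inner_diff_right L2_fun_diff is_orth_projection_iff)
  then have "L2_norm M (\<lambda>\<omega>. Y \<omega> - Y' \<omega>) = 0" by (simp add: L2_inner_self)
  from L2_norm_eq_0_imp_AE[OF L2_fun_diff[OF YL] this] show ?thesis by simp
qed

lemma orth_projection_cong_AE:
  assumes Y: "is_orth_projection M (closed_lin_span M S) X Y" and X: "X \<in> L2_fun M"
    and Y': "Y' \<in> rv_space M" and eq: "AE \<omega> in M. Y \<omega> = Y' \<omega>"
  shows "is_orth_projection M (closed_lin_span M S) X Y'"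
  unfolding is_orth_projection_iff
proof (intro conjI ballI)
  have YS: "Y \<in> closed_lin_span M S" using Y by (simp add: is_orth_projection_iff)
  then show "Y' \<in> closed_lin_span M S"
    unfolding closed_lin_span_def using Y' L2_tendsto_cong_AE[OF _ L2_fun_measurable[OF rv_space_L2[OF Y']] eq] by blast
  fix W assume W: "W \<in> closed_lin_span M S"
  have m: "W \<in> borel_measurable M" "Y \<in> borel_measurable M" "Y' \<in> borel_measurable M" "X \<in> borel_measurable M"
    using W YS Y' X by (auto simp: closed_lin_span_def rv_space_def L2_fun_def)
  have "L2_inner M (\<lambda>\<omega>. X \<omega> - Y \<omega>) W = L2_inner M (\<lambda>\<omega>. X \<omega> - Y' \<omega>) W"
    unfolding L2_inner_def
    by (rule integral_cong_AE) (use eq m measurable_compose[OF m(1) borel_measurable_cnj] in auto)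
  then show "L2_inner M (\<lambda>\<omega>. X \<omega> - Y' \<omega>) W = 0" using Y W by (simp add: is_orth_projection_iff)
qed

section \<open>Optimal linear filtering\<close>

lemma parseval_sums:
  assumes Y: "Y \<in> L2_fun leb_band" and X: "trig_L2_sums j x X"
  shows "(\<lambda>k. fourier_coeff Y (j k) * cnj (x k)) sums (L2_inner leb_band Y X / (2 * pi))"
proof -
  have "(\<lambda>n. L2_inner leb_band Y (trig_sum j x n) / (2 * pi)) \<longlonglongrightarrow> L2_inner leb_band Y X / (2 * pi)"
    by (intro tendsto_divide tendsto_const L2_inner_tendsto L2_tendsto_const Y X[unfolded trig_L2_sums_iff]) simp
  then show ?thesis unfolding sums_def trig_sum_inner[OF Y] by simp
qed

text \<open>
  The cross terms \<open>\<plusminus> 2 f g Re (A * cnj C)\<close> of the two squares cancel.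
  This identity is what separates the error into the part of the matrix \<open>Q\<close> and the
  part of \<open>P\<close> and \<open>R\<close>.
\<close>

lemma filtering_error_identity:
  fixes A C :: complex and f g :: real
  assumes "0 < f + g"
  shows "(cmod (A * g + C))\<^sup>2 / (f + g)\<^sup>2 * f + (cmod (A * f - C))\<^sup>2 / (f + g)\<^sup>2 * g
    = f * g / (f + g) * (cmod A)\<^sup>2 + (cmod C)\<^sup>2 / (f + g)"
proof -
  have "(cmod (A * g + C))\<^sup>2 * f + (cmod (A * f - C))\<^sup>2 * g = (f + g) * (f * g * (cmod A)\<^sup>2 + (cmod C)\<^sup>2)"
    unfolding cmod_power2 by (simp add: power2_eq_square) algebra
  moreover have "(cmod (A * g + C))\<^sup>2 / (f + g)\<^sup>2 * f + (cmod (A * f - C))\<^sup>2 / (f + g)\<^sup>2 * g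
      = ((cmod (A * g + C))\<^sup>2 * f + (cmod (A * f - C))\<^sup>2 * g) / (f + g)\<^sup>2"
    by (simp add: add_divide_distrib)
  moreover have "(f + g) * (f * g * (cmod A)\<^sup>2 + (cmod C)\<^sup>2) / (f + g)\<^sup>2 = (f * g * (cmod A)\<^sup>2 + (cmod C)\<^sup>2) / (f + g)"
    using assms by (simp add: power2_eq_square)
  ultimately show ?thesis by (simp add: add_divide_distrib)
qed

locale filtering = prob_space M for M :: "'w measure" +
  fixes \<xi> \<eta> :: "int \<Rightarrow> 'w \<Rightarrow> complex" and Z\<^sub>\<xi> Z\<^sub>\<eta> :: "real \<Rightarrow> 'w \<Rightarrow> complex"
    and f g :: "real \<Rightarrow> real" and a :: "nat \<Rightarrow> complex"
  assumes f: "band_density f" and g: "band_density g"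
    and \<xi>: "spectral_isometry M \<xi> f" and \<eta>: "spectral_isometry M \<eta> g"
    and unc: "uncorrelated_seqs M \<xi> \<eta>"
    and rep\<xi>: "spectral_representation M f Z\<^sub>\<xi> \<xi>" and rep\<eta>: "spectral_representation M g Z\<^sub>\<eta> \<eta>"
    and recip: "(\<integral>\<^sup>+t\<in>{-pi..<pi}. 1 / ennreal (f t + g t) \<partial>lborel) < \<infinity>"
    and a1: "summable (\<lambda>k. cmod (a k))" and a2: "a \<in> l2"
    and P: "l2_invertible (P_mat f g)" and R: "l2_operator (R_mat f g)" and Q: "l2_operator (Q_mat f g)"
begin

abbreviation "w \<equiv> \<lambda>t. f t + g t"
abbreviation "\<zeta> \<equiv> \<lambda>m \<omega>. \<xi> m \<omega> + \<eta> m \<omega>"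
abbreviation "Z \<equiv> \<lambda>t \<omega>. Z\<^sub>\<xi> t \<omega> + Z\<^sub>\<eta> t \<omega>"
abbreviation "H\<^sub>0 \<equiv> closed_lin_span M {\<zeta> m | m. m \<le> 0}"
abbreviation "A \<equiv> A_fun a"
abbreviation "Ra \<equiv> mat_app (R_mat f g) a"
abbreviation "c \<equiv> l2_inverse (P_mat f g) Ra"
abbreviation "F t \<equiv> complex_of_real (f t / w t)"
abbreviation "G t \<equiv> complex_of_real (f t * g t / w t)"
abbreviation "U t \<equiv> complex_of_real (1 / w t)"
abbreviation "past d X n \<omega> \<equiv> \<Sum>k<n. d k * X (- int k) \<omega>"
abbreviation "A_poly n t \<equiv> \<Sum>k<n. a k * trig_exp (- int k) t"

lemmas w_density = band_density_add[OF f g]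
lemmas fm [measurable] = band_density_measurable[OF f]
lemmas gm [measurable] = band_density_measurable[OF g]

lemma \<zeta>: "spectral_isometry M \<zeta> w"
  by (rule spectral_isometry_add[OF f \<xi> g \<eta> unc])

lemma nonneg: "AE t in leb_band. 0 \<le> f t \<and> 0 \<le> g t"
  using f g by (intro AE_I2) (auto simp: band_density_def)

lemma w_pos: "AE t in leb_band. 0 < w t"
  and recip_integrable: "integrable leb_band (\<lambda>t. 1 / w t)"
proof -
  have eq: "(\<integral>\<^sup>+t\<in>{-pi..<pi}. 1 / ennreal (w t) \<partial>lborel) = (\<integral>\<^sup>+t. 1 / ennreal (w t) \<partial>leb_band)"
    unfolding leb_band_def by (subst nn_integral_restrict_space) auto
  then have fin: "(\<integral>\<^sup>+t. 1 / ennreal (w t) \<partial>leb_band) < \<infinity>" using recip by simp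
  then have "AE t in leb_band. 1 / ennreal (w t) \<noteq> \<infinity>"
    by (intro nn_integral_noteq_infinite) auto
  with nonneg show pos: "AE t in leb_band. 0 < w t"
  proof eventually_elim
    case (elim t)
    have "w t \<noteq> 0" using elim(2) by (intro notI) simp
    with elim(1) show ?case by linarith
  qed
  have "(\<integral>\<^sup>+t. ennreal (norm (1 / w t)) \<partial>leb_band) = (\<integral>\<^sup>+t. 1 / ennreal (w t) \<partial>leb_band)"
  proof (rule nn_integral_cong_AE)
    show "AE t in leb_band. ennreal (norm (1 / w t)) = 1 / ennreal (w t)"
      using pos by eventually_elim (simp add: divide_ennreal[symmetric])
  qed
  then show "integrable leb_band (\<lambda>t. 1 / w t)"
    using fin by (intro integrableI_bounded) auto
qed

lemma P_toeplitz: "P_mat f g = toeplitz (\<lambda>t. 1 / w t)"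
  unfolding P_mat_def[abs_def] toeplitz_def[abs_def] set_integral_leb_band trig_exp_def
  by (simp add: mult.commute)

text \<open>
  The matrix \<open>P\<close> is the Toeplitz matrix of \<open>1 / (f + g)\<close>, so its
  invertibility bounds \<open>f + g\<close> from above and below. From here on
  \<open>L\<^sub>2(f + g)\<close> is \<open>L\<^sub>2\<close> of Lebesgue measure with an
  equivalent norm.
\<close>

lemma essential_bounds:
  obtains d K where "0 < d" "0 < K" "AE t in leb_band. 0 < w t \<and> w t \<le> K \<and> d \<le> 1 / w t \<and> 1 / w t \<le> K"
proof -
  have nn: "AE t in leb_band. 0 \<le> 1 / w t" using w_pos by eventually_elim simp
  obtain d where d: "0 < d" "AE t in leb_band. d \<le> 1 / w t"
    using toeplitz_invertible_symbol_bounded_below[OF recip_integrable nn] P unfolding P_toeplitz by blast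
  obtain B where B: "AE t in leb_band. 1 / w t \<le> B"
    using toeplitz_operator_symbol_bounded[OF recip_integrable] P unfolding P_toeplitz l2_invertible_def by blast
  show ?thesis
  proof (rule that[OF d(1)])
    show "0 < max B (1 / d)" using d(1) by (simp add: less_max_iff_disj)
    show "AE t in leb_band. 0 < w t \<and> w t \<le> max B (1 / d) \<and> d \<le> 1 / w t \<and> 1 / w t \<le> max B (1 / d)"
      using w_pos d(2) B
    proof eventually_elim
      case (elim t)
      then have "w t \<le> 1 / d" using d(1) by (simp add: field_simps)
      with elim show ?case by (simp add: le_max_iff_disj)
    qed
  qed
qed

lemma A_poly_pointwise: "(\<lambda>n. A_poly n t) \<longlonglongrightarrow> A t"
  and A_poly_bound: "cmod (A_poly n t) \<le> (\<Sum>k. cmod (a k))"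
proof -
  have "summable (\<lambda>k. a k * cis (- (real k * t)))"
    by (rule summable_norm_cancel) (use a1 in \<open>simp add: norm_mult\<close>)
  then have "(\<lambda>k. a k * cis (- (real k * t))) sums A t" unfolding A_fun_def by (rule summable_sums)
  then show "(\<lambda>n. A_poly n t) \<longlonglongrightarrow> A t" by (simp add: sums_def trig_exp_def)
  show "cmod (A_poly n t) \<le> (\<Sum>k. cmod (a k))" for n
  proof -
    have "cmod (A_poly n t) \<le> (\<Sum>k<n. cmod (a k))"
      by (rule order_trans[OF norm_sum]) (simp add: norm_mult)
    also have "\<dots> \<le> (\<Sum>k. cmod (a k))" by (rule sum_le_suminf[OF a1]) auto
    finally show ?thesis .
  qed
qed

lemma A_measurable [measurable]: "A \<in> borel_measurable borel"
  by (rule borel_measurable_LIMSEQ_metric[where f = A_poly]) (auto intro: A_poly_pointwise)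

lemma A_poly_tendsto:
  assumes fin: "finite_measure \<nu>" and sets: "sets \<nu> = sets leb_band"
  shows "L2_tendsto \<nu> A_poly A"
  by (rule finite_measure.L2_tendsto_bounded_pointwise[OF fin, where K = "\<Sum>k. cmod (a k)"])
    (auto simp: A_poly_pointwise A_poly_bound measurable_cong_sets[OF sets refl])

lemma A_L2: "A \<in> L2_fun leb_band"
  by (rule L2_tendsto_lim_fun[OF A_poly_tendsto[OF finite_measure_leb_band refl]])

lemma A_sums: "trig_L2_sums (\<lambda>k. - int k) a A"
  unfolding trig_L2_sums_iff by (rule A_poly_tendsto[OF finite_measure_leb_band refl])

lemma exists_A\<xi>: "\<exists>A\<xi>. ms_sums M (\<lambda>k \<omega>. a k * \<xi> (- int k) \<omega>) A\<xi>"
  using spectral_isometry_limit[OF f \<xi> A_poly_tendsto[OF finite_spectral_measure[OF f]]]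
  by (simp add: ms_sums_def)

lemma ratio_bound: "AE t in leb_band. cmod (F t) \<le> 1"
  using nonneg w_pos
proof eventually_elim
  case (elim t)
  then have "\<bar>f t / w t\<bar> \<le> 1" by (simp add: abs_of_nonneg)
  then show ?case by (simp only: norm_of_real)
qed

lemma fA_L2: "(\<lambda>t. F t * A t) \<in> L2_fun leb_band"
  by (rule L2_fun_bounded_mult[OF A_L2 _ ratio_bound]) measurable

text \<open>
  The entry of \<open>R\<close> at \<open>(l, k)\<close> is the coefficient of \<open>f / (f +
  g)\<close> at \<open>l + 1 + k\<close>, and \<open>A\<close> has the coefficient \<open>a
  k\<close> at \<open>- k\<close>; so \<open>R a\<close> is a convolution, read off at the
  positive frequencies.
\<close>

lemma Ra_coeff: "Ra l = fourier_coeff (\<lambda>t. F t * A t) (int l + 1)"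
proof -
  have "R_mat f g l k = fourier_coeff F (int l + 1 - - int k)" for k
    unfolding R_mat_def fourier_coeff_def L2_inner_def set_integral_leb_band trig_exp_cnj
    by (simp add: trig_exp_def algebra_simps)
  moreover have "(\<lambda>k. fourier_coeff F (int l + 1 - - int k) * a k)
      sums fourier_coeff (\<lambda>t. F t * A t) (int l + 1)"
    by (rule fourier_coeff_mult_sums[OF leb_band.L2_fun_bounded[OF _ ratio_bound] A_sums]) measurable
  ultimately show ?thesis unfolding mat_app_def by (simp add: sums_iff)
qed

lemma fg_bound: obtains K where "AE t in leb_band. cmod (G t) \<le> K"
proof -
  obtain d K where K: "AE t in leb_band. 0 < w t \<and> w t \<le> K \<and> d \<le> 1 / w t \<and> 1 / w t \<le> K"
    by (rule essential_bounds)
  have "AE t in leb_band. cmod (G t) \<le> K"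
    using K nonneg
  proof eventually_elim
    case (elim t)
    have "f t * g t \<le> w t * w t" using elim by (intro mult_mono) auto
    then have "f t * g t / w t \<le> w t" using elim by (simp add: field_simps)
    with elim show ?case by (simp del: of_real_divide of_real_mult of_real_add add: abs_of_nonneg)
  qed
  then show ?thesis by (rule that)
qed

lemma Qa_coeff: "mat_app (Q_mat f g) a l = fourier_coeff (\<lambda>t. G t * A t) (- int l)"
proof -
  have "Q_mat f g l k = fourier_coeff G (- int l - - int k)" for k
    unfolding Q_mat_def fourier_coeff_def L2_inner_def set_integral_leb_band trig_exp_cnj
    by (simp add: trig_exp_def algebra_simps)
  moreover obtain K where K: "AE t in leb_band. cmod (G t) \<le> K"
    by (rule fg_bound)
  have "(\<lambda>k. fourier_coeff G (- int l - - int k) * a k)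
      sums fourier_coeff (\<lambda>t. G t * A t) (- int l)"
    by (rule fourier_coeff_mult_sums[OF leb_band.L2_fun_bounded[OF _ K] A_sums]) measurable
  ultimately show ?thesis unfolding mat_app_def by (simp add: sums_iff)
qed

lemma Qa_inner: "l2_inner (mat_app (Q_mat f g) a) a
    = complex_of_real (1 / (2 * pi) * (LINT t|leb_band. f t * g t / w t * (cmod (A t))\<^sup>2))"
proof -
  obtain K where K: "AE t in leb_band. cmod (G t) \<le> K" by (rule fg_bound)
  have "(\<lambda>t. G t * A t) \<in> L2_fun leb_band"
    by (rule L2_fun_bounded_mult[OF A_L2 _ K]) measurable
  from parseval_sums[OF this A_sums]
  have "l2_inner (mat_app (Q_mat f g) a) a = L2_inner leb_band (\<lambda>t. G t * A t) A / (2 * pi)"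
    unfolding l2_inner_def Qa_coeff by (simp add: sums_iff)
  also have "L2_inner leb_band (\<lambda>t. G t * A t) A
      = (LINT t|leb_band. complex_of_real (f t * g t / w t * (cmod (A t))\<^sup>2))"
    unfolding L2_inner_def of_real_mult[of _ "(cmod _)\<^sup>2"] complex_norm_square by (simp add: mult.assoc)
  finally show ?thesis unfolding integral_complex_of_real by simp
qed

lemma Ra_l2: "Ra \<in> l2" by (rule mat_app_l2[OF R a2])

lemma c_l2: "c \<in> l2" and P_c: "mat_app (P_mat f g) c = Ra"
proof -
  have "Ra \<in> mat_app (P_mat f g) ` l2" using P Ra_l2 by (simp add: l2_invertible_def bij_betw_def)
  then show "c \<in> l2" "mat_app (P_mat f g) c = Ra"
    unfolding l2_inverse_def by (rule inv_into_into, rule f_inv_into_f)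
qed

lemma inj_shift: "inj (\<lambda>k. int k + 1)" by (simp add: inj_def)

lemma exists_C: "\<exists>C. trig_L2_sums (\<lambda>k. int k + 1) c C"
  by (rule trig_L2_sums_exists[OF inj_shift c_l2])

context
  fixes C assumes C: "trig_L2_sums (\<lambda>k. int k + 1) c C"
begin

abbreviation "h \<equiv> spectral_char f g a C"

lemma C_L2: "C \<in> L2_fun leb_band"
  using C unfolding trig_L2_sums_iff by (rule L2_tendsto_lim_fun)

lemmas C_measurable [measurable] = L2_fun_measurable[OF C_L2]

lemma h_eq: "h t = F t * A t - U t * C t"
  unfolding spectral_char_def by simp

lemma recip_bound: obtains K where "AE t in leb_band. cmod (U t) \<le> K"
proof -
  obtain d K where K: "AE t in leb_band. 0 < w t \<and> w t \<le> K \<and> d \<le> 1 / w t \<and> 1 / w t \<le> K"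
    by (rule essential_bounds)
  have "AE t in leb_band. cmod (U t) \<le> K"
    using K by eventually_elim (simp only: norm_of_real, simp)
  then show ?thesis by (rule that)
qed

lemma uC_L2: "(\<lambda>t. U t * C t) \<in> L2_fun leb_band"
proof -
  obtain K where K: "AE t in leb_band. cmod (U t) \<le> K" by (rule recip_bound)
  show ?thesis by (rule L2_fun_bounded_mult[OF C_L2 _ K]) measurable
qed

lemma h_L2: "h \<in> L2_fun leb_band"
  unfolding h_eq[abs_def] by (rule L2_fun_diff[OF fA_L2 uC_L2])

text \<open>
  The equation \<open>P c = R a\<close>, read coefficient by coefficient, equates the
  coefficients of \<open>C / (f + g)\<close> and of \<open>A f / (f + g)\<close> at the positive
  frequencies.
\<close>

lemma h_no_positive_frequency: "fourier_coeff h (int l + 1) = 0"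
proof -
  obtain K where K: "AE t in leb_band. cmod (U t) \<le> K" by (rule recip_bound)
  have "(\<lambda>k. fourier_coeff U (int l + 1 - (int k + 1)) * c k)
      sums fourier_coeff (\<lambda>t. U t * C t) (int l + 1)"
    by (rule fourier_coeff_mult_sums[OF leb_band.L2_fun_bounded[OF _ K] C]) measurable
  then have "(\<lambda>k. P_mat f g l k * c k) sums fourier_coeff (\<lambda>t. U t * C t) (int l + 1)"
    unfolding P_toeplitz toeplitz_fourier_coeff by simp
  then have "mat_app (P_mat f g) c l = fourier_coeff (\<lambda>t. U t * C t) (int l + 1)"
    unfolding mat_app_def by (rule sums_unique[symmetric])
  then have "fourier_coeff (\<lambda>t. U t * C t) (int l + 1)
      = fourier_coeff (\<lambda>t. F t * A t) (int l + 1)"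
    unfolding P_c Ra_coeff by simp
  then show ?thesis unfolding h_eq[abs_def] fourier_coeff_diff[OF fA_L2 uC_L2] by simp
qed

abbreviation "b k \<equiv> fourier_coeff h (- int k)"
abbreviation "h_poly n t \<equiv> \<Sum>k<n. b k * trig_exp (- int k) t"

text \<open>
  Without positive frequencies, \<open>h\<close> is the sum of its Fourier series over \<open>m
  \<le> 0\<close>. The partial sums correspond to combinations of past observations.
\<close>

lemma h_sums: "L2_tendsto leb_band h_poly h"
proof -
  have "fourier_coeff h m = 0" if "m \<notin> range (\<lambda>k. - int k)" for m
  proof -
    have "0 < m"
    proof (rule ccontr)
      assume "\<not> 0 < m"
      then have "m = - int (nat (- m))" by simp
      then show False using that by blast
    qed
    then have "m = int (nat (m - 1)) + 1" by simp
    then show ?thesis using h_no_positive_frequency by metis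
  qed
  from fourier_series[OF h_L2 inj_neg_int this] show ?thesis unfolding trig_L2_sums_iff .
qed

lemma h_sums_spectral:
  "L2_tendsto (spectral_measure w) h_poly h" "L2_tendsto (spectral_measure f) h_poly h"
  "L2_tendsto (spectral_measure g) h_poly h"
proof -
  obtain d K where K: "AE t in leb_band. 0 < w t \<and> w t \<le> K \<and> d \<le> 1 / w t \<and> 1 / w t \<le> K"
    by (rule essential_bounds)
  show "L2_tendsto (spectral_measure w) h_poly h" "L2_tendsto (spectral_measure f) h_poly h"
    "L2_tendsto (spectral_measure g) h_poly h"
    by (rule L2_tendsto_spectral_bounded[OF w_density _ h_sums, of K], use K in \<open>auto elim: eventually_mono\<close>)
      (rule L2_tendsto_spectral_bounded[OF f _ h_sums, of K] L2_tendsto_spectral_bounded[OF g _ h_sums, of K],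
       use K nonneg in \<open>eventually_elim, simp\<close>)+
qed

text \<open>
  The limit in mean square of the partial sums of the Fourier series of \<open>h\<close>, with
  each exponential replaced by the observation at the same time; it is determined up to null
  sets only, hence the choice.
\<close>

definition estimate :: "'w \<Rightarrow> complex" where
  "estimate = (SOME Y. Y \<in> rv_space M \<and> L2_tendsto M (past b \<zeta>) Y)"

lemma estimate: "estimate \<in> rv_space M" "L2_tendsto M (past b \<zeta>) estimate"
  using someI_ex[OF spectral_isometry_limit[OF w_density \<zeta> h_sums_spectral(1)]] unfolding estimate_def by blast+

lemma estimate_span: "estimate \<in> H\<^sub>0"
  unfolding closed_lin_span_def
proof (intro CollectI conjI estimate(1) exI[of _ "past b \<zeta>"] estimate(2) allI)
  show "past b \<zeta> n \<in> lin_combs {\<zeta> m | m. m \<le> 0}" for n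
    by (rule sum_in_lin_combs[where \<zeta> = \<zeta> and j = "\<lambda>k. - int k"]) auto
qed

lemma estimate_stoch_integral: "has_stoch_integral M w Z h estimate"
  by (rule stoch_integral_of_limit[OF f rep\<xi> g rep\<eta> h_sums_spectral(1) estimate(2,1)])

lemma A_h_f: "(\<lambda>t. A t - h t) \<in> L2_fun (spectral_measure f)" and h_g: "h \<in> L2_fun (spectral_measure g)"
  using A_poly_tendsto[OF finite_spectral_measure[OF f]] h_sums_spectral
  by (auto dest: L2_tendsto_lim_fun)

context
  fixes A\<xi> assumes A\<xi>: "ms_sums M (\<lambda>k \<omega>. a k * \<xi> (- int k) \<omega>) A\<xi>"
begin

lemma A\<xi>_lim: "L2_tendsto M (past a \<xi>) A\<xi>"
  using A\<xi> by (simp add: ms_sums_def)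

lemma A\<xi>_L2: "A\<xi> \<in> L2_fun M"
  by (rule L2_tendsto_lim_fun[OF A\<xi>_lim])

text \<open>
  On the spectral side the inner product is the integral of \<open>A f - h (f + g) = C\<close>
  against \<open>exp(- i m t)\<close>, that is, a coefficient of \<open>C\<close>. It vanishes
  because all frequencies of \<open>C\<close> are positive while \<open>m \<le> 0\<close>.
\<close>

lemma orthogonal_observation:
  assumes "m \<le> 0"
  shows "L2_inner M (\<lambda>\<omega>. A\<xi> \<omega> - estimate \<omega>) (\<zeta> m) = 0"
proof -
  note L2 = spectral_isometry_L2[OF \<xi>] spectral_isometry_L2[OF \<eta>] spectral_isometry_L2[OF \<zeta>]
  have mt: "trig_exp m \<in> borel_measurable leb_band" by measurable
  have hm: "h \<in> borel_measurable leb_band" by (rule L2_fun_measurable[OF h_L2])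
  have Am: "A \<in> borel_measurable leb_band" by measurable
  have lim1: "L2_inner M A\<xi> (\<zeta> m) = L2_inner (spectral_measure f) A (trig_exp m)"
  proof (rule LIMSEQ_unique)
    show "(\<lambda>n. L2_inner M (past a \<xi> n) (\<zeta> m)) \<longlonglongrightarrow> L2_inner M A\<xi> (\<zeta> m)"
      by (intro L2_inner_tendsto A\<xi>_lim L2_tendsto_const L2)
    have "L2_inner M (past a \<xi> n) (\<zeta> m) = L2_inner (spectral_measure f) (A_poly n) (trig_exp m)" for n
    proof -
      have "L2_inner M (past a \<xi> n) (\<eta> m) = (\<Sum>k<n. a k * L2_inner M (\<xi> (- int k)) (\<eta> m))"
        by (subst L2_inner_sum_left) (auto intro: L2 simp: L2_inner_cmult_left)
      also have "\<dots> = 0" using unc by (simp add: uncorrelated_seqs_def L2_inner_def)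
      finally have "L2_inner M (past a \<xi> n) (\<zeta> m) = L2_inner M (past a \<xi> n) (\<xi> m)"
        by (subst L2_inner_add_right) (auto intro!: L2)
      also have "\<dots> = L2_inner (spectral_measure f) (A_poly n) (trig_exp m)"
        by (rule spectral_isometry_inner[OF f \<xi> spectral_pairs_sum lin_pairs.base]) blast
      finally show ?thesis .
    qed
    then show "(\<lambda>n. L2_inner M (past a \<xi> n) (\<zeta> m)) \<longlonglongrightarrow> L2_inner (spectral_measure f) A (trig_exp m)"
      using L2_inner_tendsto[OF A_poly_tendsto[OF finite_spectral_measure[OF f]] L2_tendsto_const[OF trig_exp_spectral[OF f]], of m]
      by simp
  qed
  have lim2: "L2_inner M estimate (\<zeta> m) = L2_inner (spectral_measure w) h (trig_exp m)"
  proof (rule LIMSEQ_unique)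
    show "(\<lambda>n. L2_inner M (past b \<zeta> n) (\<zeta> m)) \<longlonglongrightarrow> L2_inner M estimate (\<zeta> m)"
      by (intro L2_inner_tendsto estimate L2_tendsto_const L2)
    have "L2_inner M (past b \<zeta> n) (\<zeta> m) = L2_inner (spectral_measure w) (h_poly n) (trig_exp m)" for n
      by (rule spectral_isometry_inner[OF w_density \<zeta> spectral_pairs_sum[where \<xi> = \<zeta>] lin_pairs.base]) blast
    then show "(\<lambda>n. L2_inner M (past b \<zeta> n) (\<zeta> m)) \<longlonglongrightarrow> L2_inner (spectral_measure w) h (trig_exp m)"
      using L2_inner_tendsto[OF h_sums_spectral(1) L2_tendsto_const[OF trig_exp_spectral[OF w_density]], of m]
      by simp
  qed
  have int1: "integrable leb_band (\<lambda>t. f t * (A t * cnj (trig_exp m t)))"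
  proof -
    have "integrable (spectral_measure f) (\<lambda>t. A t * cnj (trig_exp m t))"
      by (rule integrable_mult_cnj) (use A_poly_tendsto[OF finite_spectral_measure[OF f]] f in \<open>auto dest: L2_tendsto_lim_fun\<close>)
    then show ?thesis
      by (subst (asm) integrable_spectral_measure[OF f]) (auto simp: trig_exp_cnj scaleR_conv_of_real)
  qed
  have int2: "integrable leb_band (\<lambda>t. complex_of_real (w t) * (h t * cnj (trig_exp m t)))"
  proof -
    have "integrable (spectral_measure w) (\<lambda>t. h t * cnj (trig_exp m t))"
      by (rule integrable_mult_cnj) (use h_sums_spectral(1) w_density in \<open>auto dest: L2_tendsto_lim_fun\<close>)
    then show ?thesis
      by (subst (asm) integrable_spectral_measure[OF w_density]) (use hm in \<open>auto simp: trig_exp_cnj scaleR_conv_of_real\<close>)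
  qed
  have "L2_inner M (\<lambda>\<omega>. A\<xi> \<omega> - estimate \<omega>) (\<zeta> m) = L2_inner M A\<xi> (\<zeta> m) - L2_inner M estimate (\<zeta> m)"
    by (rule L2_inner_diff_left) (use A\<xi>_L2 estimate L2 in \<open>auto simp: rv_space_def\<close>)
  also have "\<dots> = 1 / (2 * pi) * ((LINT t|leb_band. f t * (A t * cnj (trig_exp m t)))
      - (LINT t|leb_band. complex_of_real (w t) * (h t * cnj (trig_exp m t))))"
    unfolding lim1 lim2 L2_inner_spectral_measure[OF f Am mt] L2_inner_spectral_measure[OF w_density hm mt]
    by (simp add: right_diff_distrib)
  also have "\<dots> = 1 / (2 * pi) * (LINT t|leb_band. f t * (A t * cnj (trig_exp m t)) - complex_of_real (w t) * (h t * cnj (trig_exp m t)))"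
    by (simp only: Bochner_Integration.integral_diff[OF int1 int2])
  also have "(LINT t|leb_band. f t * (A t * cnj (trig_exp m t)) - complex_of_real (w t) * (h t * cnj (trig_exp m t)))
      = (LINT t|leb_band. C t * cnj (trig_exp m t))"
  proof (rule integral_cong_AE)
    show "AE t in leb_band. f t * (A t * cnj (trig_exp m t)) - complex_of_real (w t) * (h t * cnj (trig_exp m t)) = C t * cnj (trig_exp m t)"
      using w_pos
    proof eventually_elim
      case (elim t)
      have "complex_of_real (w t) * h t = f t * A t - C t"
      proof -
        have "complex_of_real (w t) * F t = f t" "complex_of_real (w t) * U t = 1"
          using elim unfolding of_real_mult[symmetric] by simp_all
        then show ?thesis unfolding h_eq right_diff_distrib mult.assoc[symmetric] by (simp only: mult_1)
      qed
      then have "complex_of_real (w t) * (h t * cnj (trig_exp m t)) = (f t * A t - C t) * cnj (trig_exp m t)"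
        by (simp only: mult.assoc[symmetric])
      then show ?case by (simp add: algebra_simps)
    qed
  qed (use borel_measurable_integrable[OF int1] borel_measurable_integrable[OF int2] in \<open>auto simp: trig_exp_cnj\<close>)
  also have "\<dots> = 2 * pi * fourier_coeff C m" by (simp add: fourier_coeff_def L2_inner_def)
  also have "fourier_coeff C m = 0"
    using assms by (intro trig_L2_sums_coeff(2)[OF C inj_shift]) auto
  finally show ?thesis by simp
qed

theorem estimate_projection: "is_orth_projection M H\<^sub>0 A\<xi> estimate"
  unfolding is_orth_projection_iff
proof (intro conjI ballI estimate_span)
  fix W assume "W \<in> H\<^sub>0"
  then show "L2_inner M (\<lambda>\<omega>. A\<xi> \<omega> - estimate \<omega>) W = 0"
    by (rule orthogonal_closed_lin_span[rotated 3])
      (use A\<xi>_L2 estimate spectral_isometry_L2[OF \<zeta>] orthogonal_observation in \<open>auto intro: L2_fun_diff rv_space_L2\<close>)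
qed

lemma projection_iff_stoch_integral:
  "is_orth_projection M H\<^sub>0 A\<xi> Y \<longleftrightarrow> has_stoch_integral M w Z h Y"
proof
  assume Y: "is_orth_projection M H\<^sub>0 A\<xi> Y"
  then have "Y \<in> rv_space M" by (auto simp: is_orth_projection_iff closed_lin_span_def)
  moreover have "AE \<omega> in M. estimate \<omega> = Y \<omega>"
    by (rule orth_projection_unique[OF A\<xi>_L2 _ estimate_projection Y]) (auto simp: closed_lin_span_def rv_space_def)
  ultimately show "has_stoch_integral M w Z h Y"
    by (rule has_stoch_integral_cong_AE[OF estimate_stoch_integral])
next
  assume Y: "has_stoch_integral M w Z h Y"
  then have "Y \<in> rv_space M" by (simp add: has_stoch_integral_def)
  moreover have "AE \<omega> in M. estimate \<omega> = Y \<omega>"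
    using rep\<xi> rep\<eta> unfolding spectral_representation_def
    by (intro stoch_integral_unique[OF f _ g _ estimate_stoch_integral Y]) auto
  ultimately show "is_orth_projection M H\<^sub>0 A\<xi> Y"
    by (rule orth_projection_cong_AE[OF estimate_projection A\<xi>_L2])
qed

text \<open>
  The error splits into a combination of values of \<open>\<xi>\<close>, with spectral function
  \<open>A - h\<close>, and one of values of \<open>\<eta>\<close>, with spectral function
  \<open>- h\<close>. The two are orthogonal, so their squared norms add.
\<close>

lemma error_spectral:
  "(L2_norm M (\<lambda>\<omega>. A\<xi> \<omega> - estimate \<omega>))\<^sup>2
    = (L2_norm (spectral_measure f) (\<lambda>t. A t - h t))\<^sup>2 + (L2_norm (spectral_measure g) h)\<^sup>2"
proof (rule LIMSEQ_unique)
  note L2 = spectral_isometry_L2[OF \<xi>] spectral_isometry_L2[OF \<eta>]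
  let ?D = "\<lambda>n \<omega>. past a \<xi> n \<omega> - past b \<zeta> n \<omega>"
  show "(\<lambda>n. (L2_norm M (?D n))\<^sup>2) \<longlonglongrightarrow> (L2_norm M (\<lambda>\<omega>. A\<xi> \<omega> - estimate \<omega>))\<^sup>2"
    by (intro L2_norm_tendsto L2_tendsto_diff A\<xi>_lim estimate)
  have "(L2_norm M (?D n))\<^sup>2 = (L2_norm (spectral_measure f) (\<lambda>t. A_poly n t - h_poly n t))\<^sup>2
      + (L2_norm (spectral_measure g) (h_poly n))\<^sup>2" for n
  proof -
    let ?U = "\<lambda>\<omega>. past a \<xi> n \<omega> - past b \<xi> n \<omega>"
    let ?V = "\<lambda>\<omega>. - 1 * past b \<eta> n \<omega>"
    have U: "(?U, \<lambda>t. A_poly n t - h_poly n t) \<in> lin_pairs (spectral_pairs \<xi>)"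
      by (intro lin_pairs_diff spectral_pairs_sum)
    have sumL2: "past d \<xi> n \<in> L2_fun M" "past d \<eta> n \<in> L2_fun M" for d
      by (auto intro!: L2)
    have 0: "L2_inner M (past d \<xi> n) (past e \<eta> n) = 0" for d e
    proof (subst L2_inner_sum_left)
      have "L2_inner M (\<xi> (- int i)) (past e \<eta> n) = (\<Sum>k<n. cnj (e k) * L2_inner M (\<xi> (- int i)) (\<eta> (- int k)))" for i
        by (subst L2_inner_sum_right) (auto intro: L2 simp: L2_inner_cmult_right)
      also have "\<dots> i = 0" for i using unc by (simp add: uncorrelated_seqs_def L2_inner_def)
      finally show "(\<Sum>i<n. L2_inner M (\<lambda>\<omega>. d i * \<xi> (- int i) \<omega>) (past e \<eta> n)) = 0"
        by (simp add: L2_inner_cmult_left)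
    qed (auto intro!: L2)
    have cross: "L2_inner M ?U ?V = 0"
      unfolding L2_inner_cmult_right by (subst L2_inner_diff_left) (auto simp: 0 sumL2)
    have "?D n = (\<lambda>\<omega>. ?U \<omega> + ?V \<omega>)" by (simp add: distrib_left sum.distrib fun_eq_iff)
    then have "(L2_norm M (?D n))\<^sup>2 = (L2_norm M ?U)\<^sup>2 + 2 * Re (L2_inner M ?U ?V) + (L2_norm M ?V)\<^sup>2"
      by (simp only:) (intro L2_norm_sq_add L2_fun_diff L2_fun_cmult sumL2)
    also have "L2_norm M ?U = L2_norm (spectral_measure f) (\<lambda>t. A_poly n t - h_poly n t)"
      by (rule spectral_isometry_norm[OF f \<xi> U])
    also have "L2_norm M ?V = L2_norm (spectral_measure g) (h_poly n)"
      unfolding L2_norm_cmult using spectral_isometry_norm[OF g \<eta> spectral_pairs_sum[where \<xi> = \<eta>]] by simp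
    finally show ?thesis unfolding cross by simp
  qed
  moreover have "(\<lambda>n. (L2_norm (spectral_measure f) (\<lambda>t. A_poly n t - h_poly n t))\<^sup>2 + (L2_norm (spectral_measure g) (h_poly n))\<^sup>2)
      \<longlonglongrightarrow> (L2_norm (spectral_measure f) (\<lambda>t. A t - h t))\<^sup>2 + (L2_norm (spectral_measure g) h)\<^sup>2"
    by (intro tendsto_add L2_norm_tendsto L2_tendsto_diff h_sums_spectral A_poly_tendsto finite_spectral_measure f) simp
  ultimately show "(\<lambda>n. (L2_norm M (?D n))\<^sup>2) \<longlonglongrightarrow> (L2_norm (spectral_measure f) (\<lambda>t. A t - h t))\<^sup>2 + (L2_norm (spectral_measure g) h)\<^sup>2"
    by simp
qed

end

abbreviation "E1 t \<equiv> (cmod (A t * g t + C t))\<^sup>2 / (f t + g t)\<^sup>2 * f t"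
abbreviation "E2 t \<equiv> (cmod (A t * f t - C t))\<^sup>2 / (f t + g t)\<^sup>2 * g t"

lemma weighted_error_eq: "AE t in leb_band. f t * (cmod (A t - h t))\<^sup>2 = E1 t" "AE t in leb_band. g t * (cmod (h t))\<^sup>2 = E2 t"
proof -
  have h: "h t = (A t * f t - C t) / complex_of_real (w t)" if "0 < w t" for t
    unfolding spectral_char_def using that by (simp add: diff_divide_distrib)
  have Ah: "A t - h t = (A t * g t + C t) / complex_of_real (w t)" if "0 < w t" for t
  proof -
    have "complex_of_real (w t) \<noteq> 0" using that by (simp only: of_real_eq_0_iff)
    then have "A t = A t * complex_of_real (w t) / complex_of_real (w t)" by simp
    then have "A t - h t = (A t * complex_of_real (w t) - (A t * f t - C t)) / complex_of_real (w t)"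
      unfolding h[OF that] diff_divide_distrib by simp
    also have "A t * complex_of_real (w t) - (A t * f t - C t) = A t * g t + C t"
      by (simp add: algebra_simps)
    finally show ?thesis .
  qed
  show "AE t in leb_band. f t * (cmod (A t - h t))\<^sup>2 = E1 t"
    using w_pos by eventually_elim (simp only: Ah norm_divide power_divide norm_of_real power2_abs mult.commute)
  show "AE t in leb_band. g t * (cmod (h t))\<^sup>2 = E2 t"
    using w_pos by eventually_elim (simp only: h norm_divide power_divide norm_of_real power2_abs mult.commute)
qed

lemma E_measurable [measurable]: "E1 \<in> borel_measurable leb_band" "E2 \<in> borel_measurable leb_band"
  by measurable

lemma E_integrable: "integrable leb_band E1" "integrable leb_band E2"
proof -
  have "integrable leb_band (\<lambda>t. f t * (cmod (A t - h t))\<^sup>2)" using A_h_f by (simp add: L2_fun_spectral_measure[OF f])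
  then show "integrable leb_band E1"
    by (rule integrable_cong_AE_imp[OF _ E_measurable(1)]) (use weighted_error_eq(1) in \<open>auto elim: eventually_mono\<close>)
  have "integrable leb_band (\<lambda>t. g t * (cmod (h t))\<^sup>2)" using h_g by (simp add: L2_fun_spectral_measure[OF g])
  then show "integrable leb_band E2"
    by (rule integrable_cong_AE_imp[OF _ E_measurable(2)]) (use weighted_error_eq(2) in \<open>auto elim: eventually_mono\<close>)
qed

lemma E_norm:
  "(L2_norm (spectral_measure f) (\<lambda>t. A t - h t))\<^sup>2 = 1 / (2 * pi) * (LINT t|leb_band. E1 t)"
  "(L2_norm (spectral_measure g) h)\<^sup>2 = 1 / (2 * pi) * (LINT t|leb_band. E2 t)"
proof -
  have m: "h \<in> borel_measurable leb_band" "(\<lambda>t. A t - h t) \<in> borel_measurable leb_band"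
    using L2_fun_measurable[OF h_L2] by auto
  have "(LINT t|leb_band. f t * (cmod (A t - h t))\<^sup>2) = (LINT t|leb_band. E1 t)"
    by (rule integral_cong_AE[OF _ E_measurable(1) weighted_error_eq(1)]) (use m in measurable)
  then show "(L2_norm (spectral_measure f) (\<lambda>t. A t - h t))\<^sup>2 = 1 / (2 * pi) * (LINT t|leb_band. E1 t)"
    by (simp add: L2_norm_spectral_measure[OF f m(2)])
  have "(LINT t|leb_band. g t * (cmod (h t))\<^sup>2) = (LINT t|leb_band. E2 t)"
    by (rule integral_cong_AE[OF _ E_measurable(2) weighted_error_eq(2)]) (use m in measurable)
  then show "(L2_norm (spectral_measure g) h)\<^sup>2 = 1 / (2 * pi) * (LINT t|leb_band. E2 t)"
    by (simp add: L2_norm_spectral_measure[OF g m(1)])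
qed

text \<open>
  By Parseval's identity this is the inner product of \<open>A f / (f + g) = h + C / (f +
  g)\<close> and \<open>C\<close>, and \<open>h\<close> is orthogonal to \<open>C\<close> since
  the two have no frequency in common.
\<close>

lemma Ra_inner: "l2_inner Ra c = complex_of_real (1 / (2 * pi) * (LINT t|leb_band. (cmod (C t))\<^sup>2 / w t))"
proof -
  have 0: "L2_inner leb_band h C = 0"
    using parseval_sums[OF h_L2 C] h_no_positive_frequency by (simp add: sums_iff)
  have "l2_inner Ra c = L2_inner leb_band (\<lambda>t. F t * A t) C / (2 * pi)"
    using parseval_sums[OF fA_L2 C] unfolding l2_inner_def Ra_coeff by (simp add: sums_iff)
  also have "L2_inner leb_band (\<lambda>t. F t * A t) C = L2_inner leb_band (\<lambda>t. U t * C t) C"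
    using 0 unfolding h_eq[abs_def] L2_inner_diff_left[OF fA_L2 uC_L2 C_L2] by simp
  also have "\<dots> = (LINT t|leb_band. complex_of_real ((cmod (C t))\<^sup>2 / w t))"
  proof -
    have "U t * C t * cnj (C t) = complex_of_real ((cmod (C t))\<^sup>2 / w t)" for t
      unfolding of_real_divide complex_norm_square by simp
    then show ?thesis unfolding L2_inner_def by (simp only:)
  qed
  finally show ?thesis unfolding integral_complex_of_real by simp
qed

lemma error_l2: "complex_of_real (1 / (2 * pi) * (LINT t|leb_band. E1 t) + 1 / (2 * pi) * (LINT t|leb_band. E2 t))
    = l2_inner Ra c + l2_inner (mat_app (Q_mat f g) a) a"
proof -
  obtain K where K: "AE t in leb_band. cmod (G t) \<le> K" by (rule fg_bound)
  have i1: "integrable leb_band (\<lambda>t. f t * g t / w t * (cmod (A t))\<^sup>2)"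
  proof -
    have "integrable leb_band (\<lambda>t. G t * A t * cnj (A t))"
      by (intro integrable_mult_cnj A_L2 L2_fun_bounded_mult[OF A_L2 _ K]) measurable
    from integrable_Re[OF this] show ?thesis
      by (simp only: mult.assoc complex_norm_square[symmetric] Re_complex_of_real flip: of_real_mult)
  qed
  have i2: "integrable leb_band (\<lambda>t. (cmod (C t))\<^sup>2 / w t)"
  proof -
    have "integrable leb_band (\<lambda>t. U t * C t * cnj (C t))"
      by (intro integrable_mult_cnj C_L2 uC_L2)
    from integrable_Re[OF this] show ?thesis
      by (simp only: mult.assoc complex_norm_square[symmetric] Re_complex_of_real flip: of_real_mult) simp
  qed
  have "(LINT t|leb_band. E1 t) + (LINT t|leb_band. E2 t) = (LINT t|leb_band. E1 t + E2 t)"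
    by (rule Bochner_Integration.integral_add[OF E_integrable, symmetric])
  also have "\<dots> = (LINT t|leb_band. f t * g t / w t * (cmod (A t))\<^sup>2 + (cmod (C t))\<^sup>2 / w t)"
  proof (rule integral_cong_AE)
    show "AE t in leb_band. E1 t + E2 t = f t * g t / w t * (cmod (A t))\<^sup>2 + (cmod (C t))\<^sup>2 / w t"
      using w_pos by eventually_elim (rule filtering_error_identity)
  qed measurable
  also have "\<dots> = (LINT t|leb_band. f t * g t / w t * (cmod (A t))\<^sup>2) + (LINT t|leb_band. (cmod (C t))\<^sup>2 / w t)"
    by (rule Bochner_Integration.integral_add[OF i1 i2])
  finally have "1 / (2 * pi) * (LINT t|leb_band. E1 t) + 1 / (2 * pi) * (LINT t|leb_band. E2 t)
     = 1 / (2 * pi) * (LINT t|leb_band. (cmod (C t))\<^sup>2 / w t) + 1 / (2 * pi) * (LINT t|leb_band. f t * g t / w t * (cmod (A t))\<^sup>2)"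
    by (simp only: distrib_left[symmetric] add.commute)
  then show ?thesis unfolding Ra_inner Qa_inner by (simp only: of_real_add)
qed

end

lemma canonical_inverse:
  assumes "canonical_factorization w \<psi> \<theta>"
  shows "l2_operator (mat_transpose (Theta_mat \<theta>))" "l2_operator (mat_cnj (Theta_mat \<theta>))"
    "x \<in> l2 \<Longrightarrow> l2_inverse (P_mat f g) x
       = mat_app (mat_cnj (Theta_mat \<theta>)) (mat_app (mat_transpose (Theta_mat \<theta>)) x)"
proof -
  obtain d K where d: "0 < d" and K: "AE t in leb_band. 0 < w t \<and> w t \<le> K \<and> d \<le> 1 / w t \<and> 1 / w t \<le> K"
    by (rule essential_bounds)
  have "AE t in leb_band. d \<le> 1 / w t" "AE t in leb_band. 1 / w t \<le> K"
    using K by (auto elim: eventually_mono)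
  note inv = toeplitz_inverse_factorization[OF d this _ P[unfolded P_toeplitz] assms]
  show "l2_operator (mat_transpose (Theta_mat \<theta>))" "l2_operator (mat_cnj (Theta_mat \<theta>))"
    by (rule inv; measurable)+
  show "x \<in> l2 \<Longrightarrow> l2_inverse (P_mat f g) x
       = mat_app (mat_cnj (Theta_mat \<theta>)) (mat_app (mat_transpose (Theta_mat \<theta>)) x)"
    unfolding P_toeplitz by (rule inv) measurable
qed

end

theorem theorem1:
  fixes M :: "'w measure"
    and \<xi> \<eta> :: "int \<Rightarrow> 'w \<Rightarrow> complex"
    and Z\<^sub>\<xi> Z\<^sub>\<eta> :: "real \<Rightarrow> 'w \<Rightarrow> complex"
    and f g :: "real \<Rightarrow> real"
    and a :: "nat \<Rightarrow> complex"
  assumes "prob_space M"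
    and "stationary_seq M \<xi>" and "stationary_seq M \<eta>"
    and "uncorrelated_seqs M \<xi> \<eta>"
    and "has_spectral_density M \<xi> f" and "has_spectral_density M \<eta> g"
    and "spectral_representation M f Z\<^sub>\<xi> \<xi>" and "spectral_representation M g Z\<^sub>\<eta> \<eta>"
    and "(\<integral>\<^sup>+t\<in>{-pi..<pi}. 1 / ennreal (f t + g t) \<partial>lborel) < \<infinity>"
    and "summable (\<lambda>k. cmod (a k))"
    and "summable (\<lambda>k. (real k + 1) * (cmod (a k))\<^sup>2)"
    and "l2_invertible (P_mat f g)" and "l2_operator (R_mat f g)" and "l2_operator (Q_mat f g)"
  shows "let H\<^sub>0 = closed_lin_span M {\<lambda>\<omega>. \<xi> m \<omega> + \<eta> m \<omega> | m. m \<le> 0};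
             Ra = mat_app (R_mat f g) a;
             c = l2_inverse (P_mat f g) Ra
         in
         (\<exists>A\<xi>. ms_sums M (\<lambda>k \<omega>. a k * \<xi> (- int k) \<omega>) A\<xi>) \<and>
         (\<exists>C. trig_L2_sums (\<lambda>k. int k + 1) c C) \<and>
         (\<forall>A\<xi> C. ms_sums M (\<lambda>k \<omega>. a k * \<xi> (- int k) \<omega>) A\<xi> \<longrightarrow>
            trig_L2_sums (\<lambda>k. int k + 1) c C \<longrightarrow>
            (\<exists>A\<^sub>e. is_orth_projection M H\<^sub>0 A\<xi> A\<^sub>e) \<and>
            spectral_char f g a C \<in> L2_fun (spectral_measure (\<lambda>t. f t + g t)) \<and>
            (\<forall>A\<^sub>e. is_orth_projection M H\<^sub>0 A\<xi> A\<^sub>e \<longleftrightarrow>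
               has_stoch_integral M (\<lambda>t. f t + g t) (\<lambda>t \<omega>. Z\<^sub>\<xi> t \<omega> + Z\<^sub>\<eta> t \<omega>)
                 (spectral_char f g a C) A\<^sub>e) \<and>
            set_integrable lborel {-pi..<pi}
              (\<lambda>t. (cmod (A_fun a t * g t + C t))\<^sup>2 / (f t + g t)\<^sup>2 * f t) \<and>
            set_integrable lborel {-pi..<pi}
              (\<lambda>t. (cmod (A_fun a t * f t - C t))\<^sup>2 / (f t + g t)\<^sup>2 * g t) \<and>
            (\<forall>A\<^sub>e. is_orth_projection M H\<^sub>0 A\<xi> A\<^sub>e \<longrightarrow>
               (LINT \<omega>|M. (cmod (A\<xi> \<omega> - A\<^sub>e \<omega>))\<^sup>2) =
                 1 / (2 * pi) * (LBINT t:{-pi..<pi}.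
                   (cmod (A_fun a t * g t + C t))\<^sup>2 / (f t + g t)\<^sup>2 * f t) +
                 1 / (2 * pi) * (LBINT t:{-pi..<pi}.
                   (cmod (A_fun a t * f t - C t))\<^sup>2 / (f t + g t)\<^sup>2 * g t) \<and>
               complex_of_real (LINT \<omega>|M. (cmod (A\<xi> \<omega> - A\<^sub>e \<omega>))\<^sup>2) =
                 l2_inner Ra c + l2_inner (mat_app (Q_mat f g) a) a)) \<and>
         (\<forall>\<psi> \<theta>. canonical_factorization (\<lambda>t. f t + g t) \<psi> \<theta> \<longrightarrow>
            l2_operator (mat_transpose (Theta_mat \<theta>)) \<and> l2_operator (mat_cnj (Theta_mat \<theta>)) \<and>
            (\<forall>x\<in>l2. l2_inverse (P_mat f g) x =
               mat_app (mat_cnj (Theta_mat \<theta>)) (mat_app (mat_transpose (Theta_mat \<theta>)) x)))"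
proof -
  have a2: "a \<in> l2"
    unfolding l2_def mem_Collect_eq
  proof (rule summable_comparison_test'[OF assms(11)])
    show "norm ((cmod (a k))\<^sup>2) \<le> (real k + 1) * (cmod (a k))\<^sup>2" for k
      using mult_right_mono[of 1 "real k + 1" "(cmod (a k))\<^sup>2"] by simp
  qed
  interpret prob_space M by fact
  interpret filtering M \<xi> \<eta> Z\<^sub>\<xi> Z\<^sub>\<eta> f g a
    by unfold_locales
      (use assms a2 has_spectral_density_isometry in \<open>auto simp del: norm_power\<close>)
  have error: "(LINT \<omega>|M. (cmod (A\<xi> \<omega> - Y \<omega>))\<^sup>2)
      = 1 / (2 * pi) * (LINT t|leb_band. (cmod (A t * g t + C t))\<^sup>2 / (f t + g t)\<^sup>2 * f t)
        + 1 / (2 * pi) * (LINT t|leb_band. (cmod (A t * f t - C t))\<^sup>2 / (f t + g t)\<^sup>2 * g t)"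
    if A\<xi>: "ms_sums M (\<lambda>k \<omega>. a k * \<xi> (- int k) \<omega>) A\<xi>"
      and C: "trig_L2_sums (\<lambda>k. int k + 1) c C" and Y: "is_orth_projection M H\<^sub>0 A\<xi> Y" for A\<xi> C Y
  proof -
    have HL: "H\<^sub>0 \<subseteq> L2_fun M" by (auto simp: closed_lin_span_def rv_space_def)
    have L: "A\<xi> \<in> L2_fun M" "estimate C \<in> L2_fun M" "Y \<in> L2_fun M"
      using A\<xi>_L2[OF C A\<xi>] estimate(1)[OF C] Y HL by (auto simp: rv_space_def is_orth_projection_iff)
    have "AE \<omega> in M. Y \<omega> = estimate C \<omega>"
      by (rule orth_projection_unique[OF L(1) HL Y estimate_projection[OF C A\<xi>]])
    then have "L2_norm M (\<lambda>\<omega>. A\<xi> \<omega> - Y \<omega>) = L2_norm M (\<lambda>\<omega>. A\<xi> \<omega> - estimate C \<omega>)"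
      using L[THEN L2_fun_measurable] by (intro L2_norm_cong_AE) auto
    then show ?thesis
      unfolding L2_norm_sq[symmetric] by (simp only: error_spectral[OF C A\<xi>] E_norm[OF C])
  qed
  show ?thesis
    unfolding Let_def set_integral_leb_band set_integrable_leb_band
  proof (intro conjI allI impI ballI)
    show "\<exists>A\<xi>. ms_sums M (\<lambda>k \<omega>. a k * \<xi> (- int k) \<omega>) A\<xi>" by (rule exists_A\<xi>)
    show "\<exists>C. trig_L2_sums (\<lambda>k. int k + 1) c C" by (rule exists_C)
  next
    fix A\<xi> C assume A\<xi>: "ms_sums M (\<lambda>k \<omega>. a k * \<xi> (- int k) \<omega>) A\<xi>"
      and C: "trig_L2_sums (\<lambda>k. int k + 1) c C"
    show "\<exists>Y. is_orth_projection M H\<^sub>0 A\<xi> Y" using estimate_projection[OF C A\<xi>] by blast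
    show "spectral_char f g a C \<in> L2_fun (spectral_measure (\<lambda>t. f t + g t))"
      by (rule L2_tendsto_lim_fun[OF h_sums_spectral(1)[OF C]])
    show "is_orth_projection M H\<^sub>0 A\<xi> Y \<longleftrightarrow> has_stoch_integral M (\<lambda>t. f t + g t) (\<lambda>t \<omega>. Z\<^sub>\<xi> t \<omega> + Z\<^sub>\<eta> t \<omega>) (spectral_char f g a C) Y" for Y
      by (rule projection_iff_stoch_integral[OF C A\<xi>])
    show "integrable leb_band (\<lambda>t. (cmod (A_fun a t * g t + C t))\<^sup>2 / (f t + g t)\<^sup>2 * f t)"
      "integrable leb_band (\<lambda>t. (cmod (A_fun a t * f t - C t))\<^sup>2 / (f t + g t)\<^sup>2 * g t)"
      by (rule E_integrable[OF C])+
    fix Y assume Y: "is_orth_projection M H\<^sub>0 A\<xi> Y"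
    show "(LINT \<omega>|M. (cmod (A\<xi> \<omega> - Y \<omega>))\<^sup>2)
      = 1 / (2 * pi) * (LINT t|leb_band. (cmod (A_fun a t * g t + C t))\<^sup>2 / (f t + g t)\<^sup>2 * f t)
        + 1 / (2 * pi) * (LINT t|leb_band. (cmod (A_fun a t * f t - C t))\<^sup>2 / (f t + g t)\<^sup>2 * g t)"
      by (rule error[OF A\<xi> C Y])
    show "complex_of_real (LINT \<omega>|M. (cmod (A\<xi> \<omega> - Y \<omega>))\<^sup>2) = l2_inner Ra c + l2_inner (mat_app (Q_mat f g) a) a"
      unfolding error[OF A\<xi> C Y] by (rule error_l2[OF C])
  next
    fix \<psi> \<theta> assume cf: "canonical_factorization (\<lambda>t. f t + g t) \<psi> \<theta>"
    show "l2_operator (mat_transpose (Theta_mat \<theta>))" "l2_operator (mat_cnj (Theta_mat \<theta>))"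
      by (rule canonical_inverse[OF cf])+
    show "l2_inverse (P_mat f g) x = mat_app (mat_cnj (Theta_mat \<theta>)) (mat_app (mat_transpose (Theta_mat \<theta>)) x)"
      if "x \<in> l2" for x
      by (rule canonical_inverse(3)[OF cf that])
  qed
qed

end
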